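(* Let $\mathcal{K}$ be a compact second-countable Hausdorff space, let $\mathcal{C}$ be the set of continuous functions $\mathcal{K}\to\mathbb{R}$, let $\mathcal{F}\subseteq\mathcal{C}$ be a countable generating set, and let $W_1,W_2,\dots$ be a sequence of $\mathcal{K}$-graphons such that $(t(F,W_n):n=1,2,\dots)$ is a convergent sequence for every $\mathcal{F}$-decorated graph $F$. Then there is a $\mathcal{K}$-graphon $W$ such that $t(F,W_n)\to t(F,W)$ for every $\mathcal{C}$-decorated graph $F$.
   Context: A set $\mathcal{F}\subseteq\mathcal{C}$ is a generating set if its linear span is dense in $\mathcal{C}$ in supremum norm. For $\mathcal{F}'\subseteq\mathcal{C}$, an $\mathcal{F}'$-decorated graph on $[k]$ is a symmetric map $F:[k]\times[k]\to\mathcal{F}'$, with entries $F_{i,j}$. Let $\mathcal{P}(\mathcal{K})$ be the space of Borel probability measures on $\mathcal{K}$ with the weak topology. A $\mathcal{K}$-graphon is a Borel measurable map $W:[0,1]^2\to\mathcal{P}(\mathcal{K})$ with $W(x,y)=W(y,x)$ for all $x,y$. For $f\in\mathcal{C}$, $W_f(x,y)=\int_{\mathcal{K}}f\,dW(x,y)$, and for a $\mathcal{C}$-decorated graph $F$ on $[k]$, $t(F,W)=\int_{[0,1]^k}\prod_{1\le i<j\le k}W_{F_{i,j}}(x_i,x_j)\,dx_1\cdots dx_k$. *)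

theory Defs
  imports "HOL-Analysis.Analysis" "HOL-Probability.Probability"
begin

(* Continuous functions on a compact space K are bounded, so the space C of continuous
  real functions on K with the supremum norm is the type ('k \<Rightarrow>\<^sub>C real).*)

definition generating_set :: "('k::topological_space \<Rightarrow>\<^sub>C real) set \<Rightarrow> bool" where
  "generating_set Fs \<longleftrightarrow> closure (span Fs) = UNIV"

definition decorated_graph :: "'f set \<Rightarrow> nat \<Rightarrow> (nat \<Rightarrow> nat \<Rightarrow> 'f) \<Rightarrow> bool" where
  "decorated_graph Fs k F \<longleftrightarrow> (\<forall>i<k. \<forall>j<k. F i j \<in> Fs \<and> F i j = F j i)"

definition unit_sq :: "(real \<times> real) measure" where
  "unit_sq = restrict_space (lborel \<Otimes>\<^sub>M lborel) ({0..1} \<times> {0..1})"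

(* A K-graphon: a Borel measurable symmetric map from [0,1]^2 into the space of Borel
  probability measures on K (with the standard Giry sigma-algebra, which for compact metrizable
  K is the Borel sigma-algebra of the weak topology).*)
definition K_graphon :: "(real \<times> real \<Rightarrow> 'k::topological_space measure) \<Rightarrow> bool" where
  "K_graphon W \<longleftrightarrow> W \<in> unit_sq \<rightarrow>\<^sub>M prob_algebra borel \<and>
     (\<forall>x\<in>{0..1}. \<forall>y\<in>{0..1}. W (x, y) = W (y, x))"

definition W_fun :: "(real \<times> real \<Rightarrow> 'k::topological_space measure) \<Rightarrow> ('k \<Rightarrow>\<^sub>C real) \<Rightarrow> real \<Rightarrow> real \<Rightarrow> real" where
  "W_fun W f x y = (\<integral>z. f z \<partial>(W (x, y)))"

definition hom_density :: "nat \<Rightarrow> (nat \<Rightarrow> nat \<Rightarrow> ('k::topological_space \<Rightarrow>\<^sub>C real)) \<Rightarrow> (real \<times> real \<Rightarrow> 'k measure) \<Rightarrow> real" where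
  "hom_density k F W =
     (\<integral>x. (\<Prod>(i, j) \<in> {(i, j). i < j \<and> j < k}. W_fun W (F i j) (x i) (x j))
        \<partial>(PiM {..<k} (\<lambda>_. restrict_space lborel {0..1})))"

end

(* Fix a countable base of K; the first j base sets cut K into cells indexed by words of length j, and a
   K-graphon becomes the family of [0,1]-valued kernels w |-> W(x,y)(cell w), additive along the binary
   tree of words. For each n refine the vertex space greedily, one set at a time, always choosing a
   set that nearly maximizes the cut-norm defect of the kernel scheduled at that step: vertices then
   acquire binary codes, and the energy increments bound the defects. Along a diagonal
   subsequence all masses of code cells and all kernel averages over pairs of cells converge. Since the
   energies converge too, the limiting step kernels are Cauchy in L1, the counting lemma transfers the
   densities to their limit, and the limiting tree of cell masses at (x,y) is realized by a
   random path pushed forward to K, which replaces a Riesz representation. Finally,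
   continuous decorations are uniform limits of combinations of cell indicators, and also of
   combinations of elements of F, which lifts convergence from the subsequence to the whole sequence. *)

theory Submission
  imports Defs
begin

section \<open>Edge densities and the counting lemma\<close>

text \<open>The vertices of different graphons are unrelated; what matches their cells is that step
  \<open>j\<close> appends exactly one bit to every code. Hence the defect is tested on squares
  \<open>S \<times> S\<close>: one set, so one bit, per step. The limit then only has to record
  numbers indexed by words, and these words are laid out as intervals of [0,1]. The control is
  asymptotic. For fixed \<open>j\<close> the cut defect at step \<open>j\<close> is at most four
  times the square root of an energy increment; this increment converges as \<open>n\<close> grows,
  and the limiting increments tend to 0 in \<open>j\<close> because the limiting energies are
  monotone and bounded by 1. Each kernel is therefore scheduled infinitely often. The delicate point
  on the side of K is that cells need not be closed. A random path determines a point only through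
  the closures of its cells, so the limit measure may give a cell a mass other than the one
  prescribed by the tree. The two are compared only through continuous functions, whose oscillation
  on the closures of cells of long words is small.\<close>

definition bounded_kernel :: "'a measure \<Rightarrow> ('a \<times> 'a \<Rightarrow> real) \<Rightarrow> bool" where
  "bounded_kernel M U \<longleftrightarrow> U \<in> borel_measurable (M \<Otimes>\<^sub>M M) \<and> (\<exists>B. \<forall>z\<in>space (M \<Otimes>\<^sub>M M). \<bar>U z\<bar> \<le> B)"

definition unit_kernel :: "'a measure \<Rightarrow> ('a \<times> 'a \<Rightarrow> real) \<Rightarrow> bool" where
  "unit_kernel M U \<longleftrightarrow> U \<in> borel_measurable (M \<Otimes>\<^sub>M M) \<and> (\<forall>z\<in>space (M \<Otimes>\<^sub>M M). 0 \<le> U z \<and> U z \<le> 1)"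

definition edges :: "nat \<Rightarrow> (nat \<times> nat) set" where
  "edges k = {(i, j). i < j \<and> j < k}"

definition edge_prod :: "nat \<Rightarrow> (nat \<times> nat \<Rightarrow> 'a \<times> 'a \<Rightarrow> real) \<Rightarrow> (nat \<Rightarrow> 'a) \<Rightarrow> real" where
  "edge_prod k U x = (\<Prod>e\<in>edges k. U e (x (fst e), x (snd e)))"

definition edge_density :: "'a measure \<Rightarrow> nat \<Rightarrow> (nat \<times> nat \<Rightarrow> 'a \<times> 'a \<Rightarrow> real) \<Rightarrow> real" where
  "edge_density M k U = (\<integral>x. edge_prod k U x \<partial>PiM {..<k} (\<lambda>_. M))"

lemma finite_edges [simp]: "finite (edges k)"
  by (rule finite_subset[of _ "{..<k} \<times> {..<k}"]) (auto simp: edges_def)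

lemma edges_less: "e \<in> edges k \<Longrightarrow> fst e < k \<and> snd e < k"
  by (auto simp: edges_def)

lemma unit_imp_bounded_kernel: "unit_kernel M U \<Longrightarrow> bounded_kernel M U"
  unfolding unit_kernel_def bounded_kernel_def by (metis abs_of_nonneg)

lemma bounded_kernel_measurable: "bounded_kernel M U \<Longrightarrow> U \<in> borel_measurable (M \<Otimes>\<^sub>M M)"
  by (simp add: bounded_kernel_def)

lemma bounded_kernel_diff:
  assumes "bounded_kernel M U" "bounded_kernel M V"
  shows "bounded_kernel M (\<lambda>z. U z - V z)"
proof -
  obtain A B where AB: "\<And>z. z \<in> space (M \<Otimes>\<^sub>M M) \<Longrightarrow> \<bar>U z\<bar> \<le> A" "\<And>z. z \<in> space (M \<Otimes>\<^sub>M M) \<Longrightarrow> \<bar>V z\<bar> \<le> B"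
    using assms unfolding bounded_kernel_def by auto
  have "\<bar>U z - V z\<bar> \<le> A + B" if "z \<in> space (M \<Otimes>\<^sub>M M)" for z
    using AB[OF that] by linarith
  then show ?thesis using assms unfolding bounded_kernel_def by (auto intro!: exI[of _ "A + B"])
qed

lemma bounded_kernel_cmult:
  assumes "bounded_kernel M U"
  shows "bounded_kernel M (\<lambda>z. c * U z)"
proof -
  obtain A where A: "\<And>z. z \<in> space (M \<Otimes>\<^sub>M M) \<Longrightarrow> \<bar>U z\<bar> \<le> A"
    using assms unfolding bounded_kernel_def by auto
  have "\<bar>c * U z\<bar> \<le> \<bar>c\<bar> * A" if "z \<in> space (M \<Otimes>\<^sub>M M)" for z
    using A[OF that] by (simp add: abs_mult mult_left_mono)
  then show ?thesis using assms unfolding bounded_kernel_def by (auto intro!: exI[of _ "\<bar>c\<bar> * A"])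
qed

lemma bounded_kernel_mult:
  assumes "bounded_kernel M U" "bounded_kernel M V"
  shows "bounded_kernel M (\<lambda>z. U z * V z)"
proof -
  obtain A B where AB: "\<And>z. z \<in> space (M \<Otimes>\<^sub>M M) \<Longrightarrow> \<bar>U z\<bar> \<le> A" "\<And>z. z \<in> space (M \<Otimes>\<^sub>M M) \<Longrightarrow> \<bar>V z\<bar> \<le> B"
    using assms unfolding bounded_kernel_def by auto
  have "\<bar>U z * V z\<bar> \<le> A * B" if "z \<in> space (M \<Otimes>\<^sub>M M)" for z
    using AB[OF that] by (auto simp: abs_mult intro!: mult_mono)
  then show ?thesis using assms unfolding bounded_kernel_def by (auto intro!: exI[of _ "A * B"])
qed

lemma bounded_kernel_const: "bounded_kernel M (\<lambda>z. c)"
  by (auto simp: bounded_kernel_def)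

lemma bounded_kernel_sum:
  assumes "\<And>i. i \<in> S \<Longrightarrow> bounded_kernel M (U i)"
  shows "bounded_kernel M (\<lambda>z. \<Sum>i\<in>S. U i z)"
proof -
  obtain B where B: "\<And>i z. i \<in> S \<Longrightarrow> z \<in> space (M \<Otimes>\<^sub>M M) \<Longrightarrow> \<bar>U i z\<bar> \<le> B i"
    using assms unfolding bounded_kernel_def by metis
  have "\<bar>\<Sum>i\<in>S. U i z\<bar> \<le> (\<Sum>i\<in>S. B i)" if "z \<in> space (M \<Otimes>\<^sub>M M)" for z
    using B[OF _ that] by (intro order_trans[OF sum_abs] sum_mono) auto
  moreover have "(\<lambda>z. \<Sum>i\<in>S. U i z) \<in> borel_measurable (M \<Otimes>\<^sub>M M)"
    using assms by (intro borel_measurable_sum bounded_kernel_measurable)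
  ultimately show ?thesis unfolding bounded_kernel_def by blast
qed

lemma edge_eval_measurable:
  assumes "e \<in> edges k" "U \<in> borel_measurable (M \<Otimes>\<^sub>M M)"
  shows "(\<lambda>x. U (x (fst e), x (snd e))) \<in> borel_measurable (PiM {..<k} (\<lambda>_. M))"
proof -
  have "(\<lambda>x. (x (fst e), x (snd e))) \<in> PiM {..<k} (\<lambda>_. M) \<rightarrow>\<^sub>M M \<Otimes>\<^sub>M M"
    using edges_less[OF assms(1)] by (intro measurable_Pair measurable_component_singleton) auto
  from measurable_compose[OF this assms(2)] show ?thesis .
qed

lemma edge_eval_space:
  assumes "e \<in> edges k" "x \<in> space (PiM {..<k} (\<lambda>_. M))"
  shows "(x (fst e), x (snd e)) \<in> space (M \<Otimes>\<^sub>M M)"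
  using assms edges_less[OF assms(1)] by (auto simp: space_PiM space_pair_measure PiE_iff)

text \<open>Isolating one edge turns multilinearity of the density into linearity of the
  integral.\<close>

lemma edge_prod_remove:
  assumes "e \<in> edges k"
  shows "edge_prod k (U(e := f)) x
    = f (x (fst e), x (snd e)) * (\<Prod>e'\<in>edges k - {e}. U e' (x (fst e'), x (snd e')))"
proof -
  have "edge_prod k (U(e := f)) x = f (x (fst e), x (snd e)) *
      (\<Prod>e'\<in>edges k - {e}. (U(e := f)) e' (x (fst e'), x (snd e')))"
    unfolding edge_prod_def using assms by (subst prod.remove[where x = e]) auto
  also have "(\<Prod>e'\<in>edges k - {e}. (U(e := f)) e' (x (fst e'), x (snd e')))
      = (\<Prod>e'\<in>edges k - {e}. U e' (x (fst e'), x (snd e')))"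
    by (intro prod.cong) auto
  finally show ?thesis .
qed

lemma edge_density_cong:
  assumes "\<And>e z. e \<in> edges k \<Longrightarrow> z \<in> space (M \<Otimes>\<^sub>M M) \<Longrightarrow> U e z = V e z"
  shows "edge_density M k U = edge_density M k V"
  unfolding edge_density_def edge_prod_def
  by (intro Bochner_Integration.integral_cong prod.cong assms edge_eval_space) auto

context prob_space
begin

lemma PiM_prob: "prob_space (PiM (I :: nat set) (\<lambda>_. M))"
  by (intro prob_space_PiM prob_space_axioms)

lemma pair_prob: "prob_space (M \<Otimes>\<^sub>M M)"
  using prob_space_axioms by (intro prob_space_pair)

lemma integrable_kernel: "bounded_kernel M U \<Longrightarrow> integrable (M \<Otimes>\<^sub>M M) U"
  unfolding bounded_kernel_def
  by (metis AE_I2 finite_measure.integrable_const_bound pair_prob prob_space.finite_measure real_norm_def)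

lemma edge_prod_bound:
  assumes "\<And>e. e \<in> edges k \<Longrightarrow> bounded_kernel M (U e)"
  shows "\<exists>B\<ge>0. \<forall>x\<in>space (PiM {..<k} (\<lambda>_. M)). \<bar>\<Prod>e\<in>edges k - D. U e (x (fst e), x (snd e))\<bar> \<le> B"
proof -
  obtain B where B: "\<And>e z. e \<in> edges k \<Longrightarrow> z \<in> space (M \<Otimes>\<^sub>M M) \<Longrightarrow> \<bar>U e z\<bar> \<le> B e"
    using assms unfolding bounded_kernel_def by metis
  have "\<bar>\<Prod>e\<in>edges k - D. U e (x (fst e), x (snd e))\<bar> \<le> (\<Prod>e\<in>edges k - D. \<bar>B e\<bar>)"
    if x: "x \<in> space (PiM {..<k} (\<lambda>_. M))" for x
  proof (unfold abs_prod, rule prod_mono)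
    fix e assume e: "e \<in> edges k - D"
    then have "\<bar>U e (x (fst e), x (snd e))\<bar> \<le> B e"
      using B edge_eval_space[OF _ x] by auto
    then show "0 \<le> \<bar>U e (x (fst e), x (snd e))\<bar> \<and> \<bar>U e (x (fst e), x (snd e))\<bar> \<le> \<bar>B e\<bar>"
      by linarith
  qed
  then show ?thesis by (intro exI[of _ "\<Prod>e\<in>edges k - D. \<bar>B e\<bar>"]) (auto intro: prod_nonneg)
qed

lemma integrable_edge_prod:
  assumes "\<And>e. e \<in> edges k \<Longrightarrow> bounded_kernel M (U e)"
  shows "integrable (PiM {..<k} (\<lambda>_. M)) (edge_prod k U)"
proof -
  interpret P: prob_space "PiM {..<k} (\<lambda>_. M)" by (rule PiM_prob)
  obtain B where "\<forall>x\<in>space (PiM {..<k} (\<lambda>_. M)). \<bar>edge_prod k U x\<bar> \<le> B"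
    using edge_prod_bound[of k U "{}"] assms unfolding edge_prod_def by auto
  moreover have "edge_prod k U \<in> borel_measurable (PiM {..<k} (\<lambda>_. M))"
    unfolding edge_prod_def
    by (intro borel_measurable_prod edge_eval_measurable bounded_kernel_measurable assms)
  ultimately show ?thesis by (intro P.integrable_const_bound[of _ B]) auto
qed

lemma edge_density_upd_cmult:
  assumes "e \<in> edges k"
  shows "edge_density M k (U(e := \<lambda>z. c * f z)) = c * edge_density M k (U(e := f))"
  unfolding edge_density_def edge_prod_remove[OF assms] by (simp add: mult.assoc)

lemma edge_density_upd_diff:
  assumes e: "e \<in> edges k" and "\<And>e'. e' \<in> edges k - {e} \<Longrightarrow> bounded_kernel M (U e')"
    and "bounded_kernel M f" "bounded_kernel M g"
  shows "edge_density M k (U(e := \<lambda>z. f z - g z)) = edge_density M k (U(e := f)) - edge_density M k (U(e := g))"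
proof -
  have "integrable (PiM {..<k} (\<lambda>_. M)) (edge_prod k (U(e := f)))"
    "integrable (PiM {..<k} (\<lambda>_. M)) (edge_prod k (U(e := g)))"
    using assms by (intro integrable_edge_prod; auto)+
  then show ?thesis
    unfolding edge_density_def
    by (subst Bochner_Integration.integral_diff[symmetric])
       (auto simp: edge_prod_remove[OF e, abs_def] left_diff_distrib)
qed

lemma edge_density_upd_sum:
  assumes e: "e \<in> edges k" and "\<And>e'. e' \<in> edges k - {e} \<Longrightarrow> bounded_kernel M (U e')"
    and "\<And>i. i \<in> S \<Longrightarrow> bounded_kernel M (f i)"
  shows "edge_density M k (U(e := \<lambda>z. \<Sum>i\<in>S. f i z)) = (\<Sum>i\<in>S. edge_density M k (U(e := f i)))"
proof -
  have "integrable (PiM {..<k} (\<lambda>_. M)) (edge_prod k (U(e := f i)))" if "i \<in> S" for i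
    using assms that by (intro integrable_edge_prod; auto)
  then have "(\<Sum>i\<in>S. edge_density M k (U(e := f i)))
      = (\<integral>x. (\<Sum>i\<in>S. edge_prod k (U(e := f i)) x) \<partial>PiM {..<k} (\<lambda>_. M))"
    unfolding edge_density_def by (rule Bochner_Integration.integral_sum[symmetric])
  then show ?thesis
    unfolding edge_density_def by (simp add: edge_prod_remove[OF e, abs_def] sum_distrib_right)
qed

text \<open>Without integrability the integral is 0 by convention, and \<open>B\<close> is
  nonnegative because a probability space is nonempty.\<close>

lemma abs_integral_le_const:
  fixes f :: "'a \<Rightarrow> real"
  assumes "\<And>x. x \<in> space M \<Longrightarrow> \<bar>f x\<bar> \<le> B"
  shows "\<bar>\<integral>x. f x \<partial>M\<bar> \<le> B"
proof (cases "integrable M f")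
  case True
  have "\<bar>\<integral>x. f x \<partial>M\<bar> \<le> (\<integral>x. \<bar>f x\<bar> \<partial>M)" by (rule integral_abs_bound)
  also have "\<dots> \<le> (\<integral>x. B \<partial>M)" using True assms by (intro integral_mono) auto
  also have "\<dots> = B" by (simp add: prob_space)
  finally show ?thesis .
next
  case False
  obtain x where "x \<in> space M" using not_empty by auto
  with assms have "0 \<le> B" by (smt (verit))
  then show ?thesis using False by (simp add: not_integrable_integral_eq)
qed

text \<open>Serves to read the inner integral over the two endpoints of an edge as an integral over
  the square of \<open>M\<close>; it is checked on measurable rectangles.\<close>

lemma distr_two_coordinates:
  assumes "p \<noteq> (q :: nat)"
  shows "distr (PiM {p, q} (\<lambda>_. M)) (M \<Otimes>\<^sub>M M) (\<lambda>y. (y p, y q)) = M \<Otimes>\<^sub>M M" (is "?D = _")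
proof (rule pair_measure_eqI[symmetric])
  interpret P: product_prob_space "\<lambda>_. M" "{p, q}"
    by unfold_locales
  have m: "(\<lambda>y. (y p, y q)) \<in> PiM {p, q} (\<lambda>_. M) \<rightarrow>\<^sub>M M \<Otimes>\<^sub>M M"
    by (intro measurable_Pair measurable_component_singleton) auto
  show "sigma_finite_measure M" "sigma_finite_measure M" by unfold_locales
  show "sets (M \<Otimes>\<^sub>M M) = sets ?D" by simp
  fix A B assume AB: "A \<in> sets M" "B \<in> sets M"
  have "(\<lambda>y. (y p, y q)) -` (A \<times> B) \<inter> space (PiM {p, q} (\<lambda>_. M)) = PiE {p, q} (\<lambda>i. if i = p then A else B)"
    using assms AB[THEN sets.sets_into_space] by (auto simp: space_PiM PiE_iff split: if_splits)
  then have "emeasure ?D (A \<times> B) = emeasure (PiM {p, q} (\<lambda>_. M)) (PiE {p, q} (\<lambda>i. if i = p then A else B))"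
    using AB by (subst emeasure_distr[OF m]) auto
  also have "\<dots> = (\<Prod>i\<in>{p, q}. emeasure M (if i = p then A else B))"
    using AB by (intro P.emeasure_PiM) auto
  also have "\<dots> = emeasure M A * emeasure M B" using assms by simp
  finally show "emeasure M A * emeasure M B = emeasure ?D (A \<times> B)" by simp
qed

text \<open>Freezing all coordinates except the two endpoints of the edge \<open>e\<close> splits the remaining
  factors into a function of one endpoint times a function of the other.\<close>

lemma edge_density_upd_cut_bound:
  assumes e: "e \<in> edges k" and H: "\<And>e'. e' \<in> edges k - {e} \<Longrightarrow> unit_kernel M (H e')"
    and D: "bounded_kernel M D"
    and cut: "\<And>a b. a \<in> borel_measurable M \<Longrightarrow> b \<in> borel_measurable M \<Longrightarrow>
      (\<And>x. x \<in> space M \<Longrightarrow> 0 \<le> a x \<and> a x \<le> 1) \<Longrightarrow> (\<And>x. x \<in> space M \<Longrightarrow> 0 \<le> b x \<and> b x \<le> 1) \<Longrightarrow>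
      \<bar>\<integral>z. D z * a (fst z) * b (snd z) \<partial>(M \<Otimes>\<^sub>M M)\<bar> \<le> \<delta>"
  shows "\<bar>edge_density M k (H(e := D))\<bar> \<le> \<delta>"
proof -
  obtain p q where pq: "e = (p, q)" "p < q" "q < k" using e by (auto simp: edges_def)
  let ?I = "{..<k} - {p, q}" and ?J = "{p, q}" and ?E = "edges k - {e}"
  have IJ: "{..<k} = ?I \<union> ?J" using pq by auto
  interpret PS: product_sigma_finite "\<lambda>_::nat. M" by unfold_locales
  interpret P: prob_space "PiM ?I (\<lambda>_. M)" by (rule PiM_prob)
  have "integrable (PiM {..<k} (\<lambda>_. M)) (edge_prod k (H(e := D)))"
    using H D unit_imp_bounded_kernel by (intro integrable_edge_prod; auto)
  then have "edge_density M k (H(e := D))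
    = (\<integral>w. (\<integral>y. edge_prod k (H(e := D)) (merge ?I ?J (w, y)) \<partial>PiM ?J (\<lambda>_. M)) \<partial>PiM ?I (\<lambda>_. M))"
    unfolding edge_density_def by (subst (asm) IJ, subst IJ, intro PS.product_integral_fold) auto
  also have "\<bar>\<dots>\<bar> \<le> \<delta>"
  proof (rule P.abs_integral_le_const)
    fix w assume w: "w \<in> space (PiM ?I (\<lambda>_. M))"
    define a where "a s = (\<Prod>e'\<in>{e'\<in>?E. fst e' \<noteq> q \<and> snd e' \<noteq> q}. H e' ((w(p := s)) (fst e'), (w(p := s)) (snd e')))" for s
    define b where "b s = (\<Prod>e'\<in>{e'\<in>?E. \<not> (fst e' \<noteq> q \<and> snd e' \<noteq> q)}. H e' ((w(q := s)) (fst e'), (w(q := s)) (snd e')))" for s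
    have wM: "w i \<in> space M" if "i < k" "i \<noteq> p" "i \<noteq> q" for i
      using w that by (auto simp: space_PiM)
    have pick: "(\<lambda>s. (w(r := s)) i) \<in> M \<rightarrow>\<^sub>M M" if "i < k" "i = r \<or> (i \<noteq> p \<and> i \<noteq> q)" for i r
      using that wM[of i] by (cases "i = r") auto
    have ok: "i = p \<or> (i \<noteq> p \<and> i \<noteq> q)" if "i \<noteq> q" for i using that by auto
    have ok2: "fst e' = q \<or> (fst e' \<noteq> p \<and> fst e' \<noteq> q)" "snd e' = q \<or> (snd e' \<noteq> p \<and> snd e' \<noteq> q)"
      if "e' \<in> ?E" "\<not> (fst e' \<noteq> q \<and> snd e' \<noteq> q)" for e'
      using that pq by (auto simp: edges_def)
    have prA: "(\<lambda>s. ((w(p := s)) (fst e'), (w(p := s)) (snd e'))) \<in> M \<rightarrow>\<^sub>M M \<Otimes>\<^sub>M M"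
      if "e' \<in> ?E" "fst e' \<noteq> q \<and> snd e' \<noteq> q" for e'
      using that edges_less[of e' k] by (intro measurable_Pair pick ok) auto
    have prB: "(\<lambda>s. ((w(q := s)) (fst e'), (w(q := s)) (snd e'))) \<in> M \<rightarrow>\<^sub>M M \<Otimes>\<^sub>M M"
      if "e' \<in> ?E" "\<not> (fst e' \<noteq> q \<and> snd e' \<noteq> q)" for e'
      using that edges_less[of e' k] by (intro measurable_Pair pick ok2) auto
    have Hm: "H e' \<in> borel_measurable (M \<Otimes>\<^sub>M M)" "z \<in> space (M \<Otimes>\<^sub>M M) \<Longrightarrow> 0 \<le> H e' z \<and> H e' z \<le> 1"
      if "e' \<in> ?E" for e' z using H[OF that] by (auto simp: unit_kernel_def)
    have am: "a \<in> borel_measurable M" unfolding a_def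
      by (intro borel_measurable_prod measurable_compose[OF prA Hm(1)]) auto
    have bm: "b \<in> borel_measurable M" unfolding b_def
      by (intro borel_measurable_prod measurable_compose[OF prB Hm(1)]) auto
    have a01: "0 \<le> a x \<and> a x \<le> 1" if "x \<in> space M" for x
      unfolding a_def using Hm(2) measurable_space[OF prA that]
      by (intro conjI prod_nonneg prod_le_1) auto
    have b01: "0 \<le> b x \<and> b x \<le> 1" if "x \<in> space M" for x
      unfolding b_def using Hm(2) measurable_space[OF prB that]
      by (intro conjI prod_nonneg prod_le_1) blast+
    have split: "edge_prod k (H(e := D)) (merge ?I ?J (w, y)) = D (y p, y q) * a (y p) * b (y q)" for y
    proof -
      let ?x = "merge ?I ?J (w, y)"
      have mI: "?x i = w i" if "i < k" "i \<noteq> p" "i \<noteq> q" for i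
        using that by (auto simp: merge_def)
      have mp: "?x p = y p" and mq: "?x q = y q" by (auto simp: merge_def)
      have "(\<Prod>e'\<in>?E. H e' (?x (fst e'), ?x (snd e')))
        = (\<Prod>e'\<in>{e'\<in>?E. fst e' \<noteq> q \<and> snd e' \<noteq> q}. H e' (?x (fst e'), ?x (snd e')))
        * (\<Prod>e'\<in>{e'\<in>?E. \<not> (fst e' \<noteq> q \<and> snd e' \<noteq> q)}. H e' (?x (fst e'), ?x (snd e')))"
        by (subst prod.union_disjoint[symmetric]) (auto intro!: prod.cong)
      also have "\<dots> = a (y p) * b (y q)"
      proof -
        have xa: "?x i = (w(p := y p)) i" if "i < k" "i \<noteq> q" for i
          using mI[of i] mp that by auto
        have xb: "?x i = (w(q := y q)) i" if "i < k" "i = q \<or> (i \<noteq> p \<and> i \<noteq> q)" for i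
          using mI[of i] mq that by auto
        have "?x (fst e') = (w(p := y p)) (fst e')" "?x (snd e') = (w(p := y p)) (snd e')"
          if "e' \<in> ?E" "fst e' \<noteq> q \<and> snd e' \<noteq> q" for e'
          using that edges_less[of e' k] by (intro xa; blast)+
        moreover have "?x (fst e') = (w(q := y q)) (fst e')" "?x (snd e') = (w(q := y q)) (snd e')"
          if "e' \<in> ?E" "\<not> (fst e' \<noteq> q \<and> snd e' \<noteq> q)" for e'
          using that edges_less[of e' k] ok2[OF that] by (intro xb; blast)+
        ultimately show ?thesis
          unfolding a_def b_def
          by (intro arg_cong2[of _ _ _ _ "(*)"] prod.cong refl) (simp_all del: fun_upd_apply)
      qed
      finally show ?thesis
        unfolding edge_prod_remove[OF e] by (simp add: mp mq pq(1))
    qed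
    let ?\<phi> = "\<lambda>z. D z * a (fst z) * b (snd z)"
    have \<phi>: "?\<phi> \<in> borel_measurable (M \<Otimes>\<^sub>M M)"
      using bounded_kernel_measurable[OF D] am bm by measurable
    have m: "(\<lambda>y. (y p, y q)) \<in> PiM {p, q} (\<lambda>_. M) \<rightarrow>\<^sub>M M \<Otimes>\<^sub>M M"
      by (intro measurable_Pair measurable_component_singleton) auto
    have "(\<integral>y. edge_prod k (H(e := D)) (merge ?I ?J (w, y)) \<partial>PiM ?J (\<lambda>_. M))
      = (\<integral>y. ?\<phi> (y p, y q) \<partial>PiM ?J (\<lambda>_. M))" by (simp add: split)
    also have "\<dots> = (\<integral>z. ?\<phi> z \<partial>(M \<Otimes>\<^sub>M M))"
      using integral_distr[OF m \<phi>] distr_two_coordinates[of p q] pq by simp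
    finally show "\<bar>\<integral>y. edge_prod k (H(e := D)) (merge ?I ?J (w, y)) \<partial>PiM ?J (\<lambda>_. M)\<bar> \<le> \<delta>"
      using cut[OF am bm a01 b01] by simp
  qed
  finally show ?thesis .
qed

text \<open>The cut norm, tested against [0,1]-valued functions instead of sets because freezing the
  other coordinates of a density produces functions.\<close>

definition cut_bound :: "('a \<times> 'a \<Rightarrow> real) \<Rightarrow> real \<Rightarrow> bool" where
  "cut_bound D \<delta> \<longleftrightarrow> (\<forall>a b. a \<in> borel_measurable M \<longrightarrow> b \<in> borel_measurable M \<longrightarrow>
      (\<forall>x\<in>space M. 0 \<le> a x \<and> a x \<le> 1) \<longrightarrow> (\<forall>x\<in>space M. 0 \<le> b x \<and> b x \<le> 1) \<longrightarrow>
      \<bar>\<integral>z. D z * a (fst z) * b (snd z) \<partial>(M \<Otimes>\<^sub>M M)\<bar> \<le> \<delta>)"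

text \<open>Telescoping over edges: the hybrids carry \<open>V\<close> on \<open>D\<close> and
  \<open>U\<close> elsewhere, and exchanging one edge changes the density by the density with
  \<open>U e - V e\<close> at that edge, which the cut bound controls.\<close>

lemma counting_lemma:
  assumes U: "\<And>e. e \<in> edges k \<Longrightarrow> unit_kernel M (U e)" and V: "\<And>e. e \<in> edges k \<Longrightarrow> unit_kernel M (V e)"
    and cut: "\<And>e. e \<in> edges k \<Longrightarrow> cut_bound (\<lambda>z. U e z - V e z) (\<delta> e)"
  shows "\<bar>edge_density M k U - edge_density M k V\<bar> \<le> (\<Sum>e\<in>edges k. \<delta> e)"
proof -
  have "\<bar>edge_density M k U - edge_density M k (\<lambda>e. if e \<in> D then V e else U e)\<bar> \<le> (\<Sum>e\<in>D. \<delta> e)"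
    if "finite D" "D \<subseteq> edges k" for D
    using that
  proof (induction D)
    case (insert e D)
    let ?H = "\<lambda>e. if e \<in> D then V e else U e"
    have e: "e \<in> edges k" using insert by auto
    have H: "unit_kernel M (?H e')" if "e' \<in> edges k" for e' using U V that by auto
    have 1: "?H = ?H(e := U e)" using insert by auto
    have 2: "(\<lambda>e'. if e' \<in> insert e D then V e' else U e') = ?H(e := V e)" by auto
    have "\<bar>edge_density M k (?H(e := \<lambda>z. U e z - V e z))\<bar> \<le> \<delta> e"
      using cut[OF e] H U[OF e] V[OF e] unfolding cut_bound_def
      by (intro edge_density_upd_cut_bound[OF e])
         (auto intro: bounded_kernel_diff unit_imp_bounded_kernel)
    also have "edge_density M k (?H(e := \<lambda>z. U e z - V e z))
      = edge_density M k ?H - edge_density M k (\<lambda>e'. if e' \<in> insert e D then V e' else U e')"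
      unfolding 2 by (subst (2) 1, rule edge_density_upd_diff[OF e])
        (use H U[OF e] V[OF e] unit_imp_bounded_kernel in blast)+
    finally show ?case using insert by auto
  qed simp
  from this[of "edges k"] have "\<bar>edge_density M k U - edge_density M k (\<lambda>e. if e \<in> edges k then V e else U e)\<bar>
    \<le> (\<Sum>e\<in>edges k. \<delta> e)" by simp
  also have "edge_density M k (\<lambda>e. if e \<in> edges k then V e else U e) = edge_density M k V"
    by (rule edge_density_cong) auto
  finally show ?thesis .
qed

end

section \<open>Cut bounds, step kernels and greedy refinement\<close>

context prob_space
begin

text \<open>The integral lies between its values at the indicators of {h \<le> 0} and {h \<ge> 0},
  so one of these two is at least as large in absolute value.\<close>

lemma exists_set_integral_ge:
  fixes h a :: "'a \<Rightarrow> real"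
  assumes h: "integrable M h" and a: "a \<in> borel_measurable M"
    and a01: "\<And>x. x \<in> space M \<Longrightarrow> 0 \<le> a x \<and> a x \<le> 1"
  shows "\<exists>S\<in>sets M. \<bar>\<integral>x. a x * h x \<partial>M\<bar> \<le> \<bar>\<integral>x. indicator S x * h x \<partial>M\<bar>"
proof -
  have ia: "integrable M (\<lambda>x. a x * h x)"
    by (rule Bochner_Integration.integrable_bound[OF h])
      (use h a a01 in \<open>auto simp: abs_mult intro!: AE_I2 mult_left_le_one_le\<close>)
  have hm [measurable]: "h \<in> borel_measurable M" using h by auto
  have ii: "integrable M (\<lambda>x. indicator S x * h x)" if "S \<in> sets M" for S
    using integrable_mult_indicator[OF that h] by simp
  define S where "S = {x\<in>space M. 0 \<le> h x}"
  define T where "T = {x\<in>space M. h x \<le> 0}"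
  have ST: "S \<in> sets M" "T \<in> sets M" unfolding S_def T_def by measurable
  have "(\<integral>x. a x * h x \<partial>M) \<le> (\<integral>x. indicator S x * h x \<partial>M)"
    using ia ii[OF ST(1)] a01
    by (intro integral_mono) (auto simp: S_def indicator_def mult_nonneg_nonpos mult_left_le_one_le)
  moreover have "(\<integral>x. indicator T x * h x \<partial>M) \<le> (\<integral>x. a x * h x \<partial>M)"
  proof (intro integral_mono ia ii ST)
    fix x assume x: "x \<in> space M"
    have "- h x \<ge> 0 \<Longrightarrow> a x * (- h x) \<le> 1 * (- h x)" using a01[OF x] by (intro mult_right_mono) auto
    then show "indicator T x * h x \<le> a x * h x"
      using x a01[OF x] by (auto simp: T_def indicator_def)
  qed
  ultimately have "\<bar>\<integral>x. a x * h x \<partial>M\<bar> \<le> \<bar>\<integral>x. indicator S x * h x \<partial>M\<bar> \<or>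
      \<bar>\<integral>x. a x * h x \<partial>M\<bar> \<le> \<bar>\<integral>x. indicator T x * h x \<partial>M\<bar>" by linarith
  then show ?thesis using ST by blast
qed

lemma bounded_kernel_fst_snd:
  assumes D: "bounded_kernel M D" and a: "a \<in> borel_measurable M" "b \<in> borel_measurable M"
    and "\<And>x. x \<in> space M \<Longrightarrow> 0 \<le> a x \<and> a x \<le> 1" "\<And>x. x \<in> space M \<Longrightarrow> 0 \<le> b x \<and> b x \<le> 1"
  shows "bounded_kernel M (\<lambda>z. D z * a (fst z) * b (snd z))"
proof -
  have "unit_kernel M (\<lambda>z. a (fst z))" "unit_kernel M (\<lambda>z. b (snd z))"
    unfolding unit_kernel_def using assms by (auto simp: space_pair_measure)
  then show ?thesis using D unit_imp_bounded_kernel bounded_kernel_mult by blast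
qed

lemma bounded_kernel_indicator:
  assumes "bounded_kernel M D" "S \<in> sets M" "T \<in> sets M"
  shows "bounded_kernel M (\<lambda>z. D z * indicator S (fst z) * indicator T (snd z))"
  using assms by (intro bounded_kernel_fst_snd borel_measurable_indicator) (auto simp: indicator_def)

text \<open>The form is linear in each weight: with \<open>b\<close> fixed, \<open>a\<close> is
  replaced by an indicator, and then \<open>b\<close> with that indicator fixed.\<close>

lemma cut_bound_from_sets:
  assumes D: "bounded_kernel M D"
    and d: "\<And>S T. S \<in> sets M \<Longrightarrow> T \<in> sets M \<Longrightarrow>
      \<bar>\<integral>z. D z * indicator S (fst z) * indicator T (snd z) \<partial>(M \<Otimes>\<^sub>M M)\<bar> \<le> d"
  shows "cut_bound D d"
  unfolding cut_bound_def
proof (intro allI impI)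
  fix a b :: "'a \<Rightarrow> real"
  assume m [measurable]: "a \<in> borel_measurable M" "b \<in> borel_measurable M"
    and a01: "\<forall>x\<in>space M. 0 \<le> a x \<and> a x \<le> 1" and b01: "\<forall>x\<in>space M. 0 \<le> b x \<and> b x \<le> 1"
  interpret PP: pair_sigma_finite M M by unfold_locales
  have int: "integrable (M \<Otimes>\<^sub>M M) (\<lambda>z. D z * a (fst z) * b (snd z))"
    if "a \<in> borel_measurable M" "b \<in> borel_measurable M"
      "\<forall>x\<in>space M. 0 \<le> a x \<and> a x \<le> 1" "\<forall>x\<in>space M. 0 \<le> b x \<and> b x \<le> 1" for a b
    using that by (intro integrable_kernel bounded_kernel_fst_snd D) auto
  have ind [measurable]: "indicator S \<in> borel_measurable M" "\<forall>x\<in>space M. 0 \<le> (indicator S x :: real) \<and> (indicator S x :: real) \<le> 1"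
    if "S \<in> sets M" for S using that by (auto simp: indicator_def)
  have one: "(\<lambda>x. 1::real) \<in> borel_measurable M" "\<forall>x\<in>space M. 0 \<le> (1::real) \<and> (1::real) \<le> 1" by auto
  define h where "h x = (\<integral>y. D (x, y) * b y \<partial>M)" for x
  have h: "integrable M h"
    using PP.integrable_fst'[OF int[OF one(1) m(2) one(2) b01]] by (simp add: h_def[abs_def])
  have hE: "(\<integral>x. f x * h x \<partial>M) = (\<integral>z. D z * f (fst z) * b (snd z) \<partial>(M \<Otimes>\<^sub>M M))"
    if "f \<in> borel_measurable M" "\<forall>x\<in>space M. 0 \<le> f x \<and> f x \<le> 1" for f
    using PP.integral_fst'[OF int[OF that(1) m(2) that(2) b01]]
    by (simp add: h_def mult.assoc mult.left_commute[of _ "f _"])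
  obtain S where S: "S \<in> sets M"
    "\<bar>\<integral>z. D z * a (fst z) * b (snd z) \<partial>(M \<Otimes>\<^sub>M M)\<bar> \<le> \<bar>\<integral>z. D z * indicator S (fst z) * b (snd z) \<partial>(M \<Otimes>\<^sub>M M)\<bar>"
    using exists_set_integral_ge[OF h m(1)] a01 hE[OF m(1) a01] hE[OF ind] by fastforce
  define g where "g y = (\<integral>x. D (x, y) * indicator S x \<partial>M)" for y
  have g: "integrable M g"
    using PP.integrable_snd[of "\<lambda>x y. D (x, y) * indicator S x"] int[OF ind(1)[OF S(1)] one(1) ind(2)[OF S(1)] one(2)]
    by (simp add: g_def[abs_def] case_prod_unfold)
  have gE: "(\<integral>y. f y * g y \<partial>M) = (\<integral>z. D z * indicator S (fst z) * f (snd z) \<partial>(M \<Otimes>\<^sub>M M))"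
    if "f \<in> borel_measurable M" "\<forall>x\<in>space M. 0 \<le> f x \<and> f x \<le> 1" for f
    using PP.integral_snd[of "\<lambda>x y. D (x, y) * indicator S x * f y"] int[OF ind(1)[OF S(1)] that(1) ind(2)[OF S(1)] that(2)]
    by (simp add: g_def[abs_def] case_prod_unfold mult.commute[of "f _"])
  obtain T where T: "T \<in> sets M"
    "\<bar>\<integral>z. D z * indicator S (fst z) * b (snd z) \<partial>(M \<Otimes>\<^sub>M M)\<bar>
      \<le> \<bar>\<integral>z. D z * indicator S (fst z) * indicator T (snd z) \<partial>(M \<Otimes>\<^sub>M M)\<bar>"
    using exists_set_integral_ge[OF g m(2)] b01 gE[OF m(2) b01] gE[OF ind] by fastforce
  show "\<bar>\<integral>z. D z * a (fst z) * b (snd z) \<partial>(M \<Otimes>\<^sub>M M)\<bar> \<le> d"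
    using S(2) T(2) d[OF S(1) T(1)] by linarith
qed

text \<open>On squares a violation is witnessed by a single set, which costs a single bit of the
  code; rectangles are recovered by polarization at the price of a factor 2.\<close>

definition square_int :: "('a \<times> 'a \<Rightarrow> real) \<Rightarrow> 'a set \<Rightarrow> real" where
  "square_int D S = (\<integral>z. D z * indicator S (fst z) * indicator S (snd z) \<partial>(M \<Otimes>\<^sub>M M))"

definition symmetric_kernel :: "('a \<times> 'a \<Rightarrow> real) \<Rightarrow> bool" where
  "symmetric_kernel U \<longleftrightarrow> (\<forall>x\<in>space M. \<forall>y\<in>space M. U (x, y) = U (y, x))"

text \<open>Polarization: with \<open>S \<union> T\<close>, \<open>S \<inter> T\<close>, \<open>S - T\<close>, \<open>T - S\<close> the
  rectangles \<open>S \<times> T\<close> and \<open>T \<times> S\<close> are a signed sum of four squares.\<close>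

lemma cut_bound_from_squares:
  assumes D: "bounded_kernel M D" and sym: "symmetric_kernel D"
    and d: "\<And>S. S \<in> sets M \<Longrightarrow> \<bar>square_int D S\<bar> \<le> d"
  shows "cut_bound D (2 * d)"
proof (rule cut_bound_from_sets[OF D])
  fix S T assume ST: "S \<in> sets M" "T \<in> sets M"
  interpret PP: pair_sigma_finite M M by unfold_locales
  let ?q = "\<lambda>S T. \<integral>z. D z * indicator S (fst z) * indicator T (snd z) \<partial>(M \<Otimes>\<^sub>M M)"
  have int: "integrable (M \<Otimes>\<^sub>M M) (\<lambda>z. D z * indicator S (fst z) * indicator T (snd z))"
    if "S \<in> sets M" "T \<in> sets M" for S T
    using that by (intro integrable_kernel bounded_kernel_indicator D)
  have "?q S T = (\<integral>z. (\<lambda>z. D z * indicator S (fst z) * indicator T (snd z)) (snd z, fst z) \<partial>(M \<Otimes>\<^sub>M M))"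
    using PP.integral_product_swap[OF borel_measurable_integrable[OF int[OF ST]]]
    by (simp add: case_prod_unfold)
  also have "\<dots> = ?q T S"
    using sym by (intro Bochner_Integration.integral_cong)
      (auto simp: symmetric_kernel_def space_pair_measure)
  finally have "2 * ?q S T = ?q S T + ?q T S" by simp
  also have "\<dots> = (\<integral>z. D z * indicator S (fst z) * indicator T (snd z)
      + D z * indicator T (fst z) * indicator S (snd z) \<partial>(M \<Otimes>\<^sub>M M))"
    by (rule Bochner_Integration.integral_add[symmetric]) (intro int ST)+
  also have "\<dots> = (\<integral>z. D z * indicator (S \<union> T) (fst z) * indicator (S \<union> T) (snd z)
      + D z * indicator (S \<inter> T) (fst z) * indicator (S \<inter> T) (snd z)
      - D z * indicator (S - T) (fst z) * indicator (S - T) (snd z)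
      - D z * indicator (T - S) (fst z) * indicator (T - S) (snd z) \<partial>(M \<Otimes>\<^sub>M M))"
    by (intro Bochner_Integration.integral_cong refl) (auto simp: indicator_def)
  also have "\<dots> = square_int D (S \<union> T) + square_int D (S \<inter> T) - square_int D (S - T) - square_int D (T - S)"
    unfolding square_int_def using ST int[of "S \<union> T" "S \<union> T"] int[of "S \<inter> T" "S \<inter> T"]
      int[of "S - T" "S - T"] int[of "T - S" "T - S"] by simp
  finally show "\<bar>?q S T\<bar> \<le> 2 * d"
    using d[of "S \<union> T"] d[of "S \<inter> T"] d[of "S - T"] d[of "T - S"] ST by auto
qed

section \<open>Colorings, averages over cells and energy\<close>

definition coloring :: "nat \<Rightarrow> ('a \<Rightarrow> bool list) \<Rightarrow> bool" where
  "coloring j c \<longleftrightarrow> c \<in> M \<rightarrow>\<^sub>M count_space UNIV \<and> (\<forall>x\<in>space M. length (c x) = j)"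

definition cell :: "('a \<Rightarrow> bool list) \<Rightarrow> bool list \<Rightarrow> 'a set" where
  "cell c s = {x\<in>space M. c x = s}"

definition cell_int :: "('a \<Rightarrow> bool list) \<Rightarrow> ('a \<times> 'a \<Rightarrow> real) \<Rightarrow> bool list \<Rightarrow> bool list \<Rightarrow> real" where
  "cell_int c U s t = (\<integral>z. U z * indicator (cell c s) (fst z) * indicator (cell c t) (snd z) \<partial>(M \<Otimes>\<^sub>M M))"

text \<open>The stepping operator: \<open>U\<close> averaged over the product of the two cells. On a
  product of measure zero the quotient is 0, so values stay in [0,1] for unit kernels.\<close>

definition step :: "('a \<Rightarrow> bool list) \<Rightarrow> ('a \<times> 'a \<Rightarrow> real) \<Rightarrow> 'a \<times> 'a \<Rightarrow> real" where
  "step c U z = cell_int c U (c (fst z)) (c (snd z)) / (prob (cell c (c (fst z))) * prob (cell c (c (snd z))))"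

text \<open>Squared L2 norm of a conditional expectation: for unit kernels it grows under refinement
  and stays at most 1, so a large defect can be charged to its increments.\<close>

definition energy :: "('a \<Rightarrow> bool list) \<Rightarrow> ('a \<times> 'a \<Rightarrow> real) \<Rightarrow> real" where
  "energy c U = (\<integral>z. (step c U z)\<^sup>2 \<partial>(M \<Otimes>\<^sub>M M))"

end

definition words :: "nat \<Rightarrow> bool list set" where
  "words j = {s. length s = j}"

lemma finite_words [simp]: "finite (words j)"
  using finite_lists_length_eq[of "UNIV :: bool set" j] by (simp add: words_def)

context prob_space
begin

lemma cell_sets: "coloring j c \<Longrightarrow> cell c s \<in> sets M"
  using measurable_sets[of c M "count_space UNIV" "{s}"]
  by (simp add: coloring_def cell_def vimage_def Int_def conj_commute)

lemma coloring_words: "coloring j c \<Longrightarrow> x \<in> space M \<Longrightarrow> c x \<in> words j"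
  by (auto simp: coloring_def words_def)

lemma color_kernel:
  assumes "coloring j c"
  shows "bounded_kernel M (\<lambda>z. \<phi> (c (fst z)) (c (snd z)))"
proof -
  have m [measurable]: "c \<in> M \<rightarrow>\<^sub>M count_space UNIV" using assms by (simp add: coloring_def)
  have "(\<lambda>z. \<phi> (c (fst z)) (c (snd z))) \<in> borel_measurable (M \<Otimes>\<^sub>M M)"
    by measurable
  moreover have "\<bar>\<phi> (c (fst z)) (c (snd z))\<bar> \<le> (\<Sum>s\<in>words j. \<Sum>t\<in>words j. \<bar>\<phi> s t\<bar>)"
    if "z \<in> space (M \<Otimes>\<^sub>M M)" for z
  proof -
    have w: "c (fst z) \<in> words j" "c (snd z) \<in> words j"
      using that assms by (auto simp: space_pair_measure coloring_words)
    have "\<bar>\<phi> (c (fst z)) (c (snd z))\<bar> \<le> (\<Sum>t\<in>words j. \<bar>\<phi> (c (fst z)) t\<bar>)"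
      by (rule member_le_sum[OF w(2), of "\<lambda>t. \<bar>\<phi> (c (fst z)) t\<bar>"]) auto
    also have "\<dots> \<le> (\<Sum>s\<in>words j. \<Sum>t\<in>words j. \<bar>\<phi> s t\<bar>)"
      by (rule member_le_sum[OF w(1), of "\<lambda>s. \<Sum>t\<in>words j. \<bar>\<phi> s t\<bar>"]) (auto intro: sum_nonneg)
    finally show ?thesis .
  qed
  ultimately show ?thesis unfolding bounded_kernel_def by blast
qed

lemma integral_color:
  assumes c: "coloring j c" and U: "bounded_kernel M U"
  shows "(\<integral>z. U z * \<phi> (c (fst z)) (c (snd z)) \<partial>(M \<Otimes>\<^sub>M M))
    = (\<Sum>s\<in>words j. \<Sum>t\<in>words j. \<phi> s t * cell_int c U s t)"
proof -
  have "(\<integral>z. U z * \<phi> (c (fst z)) (c (snd z)) \<partial>(M \<Otimes>\<^sub>M M)) = (\<integral>z. (\<Sum>s\<in>words j. \<Sum>t\<in>words j.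
      \<phi> s t * (U z * indicator (cell c s) (fst z) * indicator (cell c t) (snd z))) \<partial>(M \<Otimes>\<^sub>M M))"
  proof (intro Bochner_Integration.integral_cong refl)
    fix z assume z: "z \<in> space (M \<Otimes>\<^sub>M M)"
    then have w: "c (fst z) \<in> words j" "c (snd z) \<in> words j" and zz: "fst z \<in> space M" "snd z \<in> space M"
      using c by (auto simp: space_pair_measure coloring_words)
    have "(\<Sum>s\<in>words j. \<Sum>t\<in>words j. \<phi> s t * (U z * indicator (cell c s) (fst z) * indicator (cell c t) (snd z)))
      = (\<Sum>s\<in>words j. \<Sum>t\<in>words j. if s = c (fst z) then if t = c (snd z) then \<phi> s t * U z else 0 else 0)"
      using zz by (intro sum.cong refl) (auto simp: cell_def indicator_def)
    also have "\<dots> = (\<Sum>s\<in>words j. if s = c (fst z) then (\<Sum>t\<in>words j. if t = c (snd z) then \<phi> s t * U z else 0) else 0)"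
      by (intro sum.cong refl) auto
    also have "\<dots> = U z * \<phi> (c (fst z)) (c (snd z))" using w by (simp add: sum.delta)
    finally show "U z * \<phi> (c (fst z)) (c (snd z)) = (\<Sum>s\<in>words j. \<Sum>t\<in>words j.
      \<phi> s t * (U z * indicator (cell c s) (fst z) * indicator (cell c t) (snd z)))" by simp
  qed
  also have "\<dots> = (\<Sum>s\<in>words j. \<Sum>t\<in>words j. \<phi> s t * cell_int c U s t)"
  proof -
    have i: "integrable (M \<Otimes>\<^sub>M M) (\<lambda>z. U z * indicator (cell c s) (fst z) * indicator (cell c t) (snd z))" for s t
      by (intro integrable_kernel bounded_kernel_indicator U cell_sets[OF c])
    show ?thesis unfolding cell_int_def using i by (simp add: Bochner_Integration.integral_sum)
  qed
  finally show ?thesis .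
qed

lemma cell_int_one:
  assumes c: "coloring j c"
  shows "cell_int c (\<lambda>_. 1) s t = prob (cell c s) * prob (cell c t)"
proof -
  interpret PP: pair_sigma_finite M M by unfold_locales
  have i: "integrable (M \<Otimes>\<^sub>M M) (\<lambda>z. indicator (cell c s) (fst z) * indicator (cell c t) (snd z) :: real)"
    using bounded_kernel_indicator[OF bounded_kernel_const[of M 1] cell_sets[OF c, of s] cell_sets[OF c, of t]]
    by (intro integrable_kernel) simp
  show ?thesis unfolding cell_int_def
    using PP.integral_fst'[OF i] cell_sets[OF c] by simp
qed

lemma cell_int_bounds:
  assumes c: "coloring j c" and U: "unit_kernel M U"
  shows "0 \<le> cell_int c U s t" "cell_int c U s t \<le> prob (cell c s) * prob (cell c t)"
proof -
  have i: "integrable (M \<Otimes>\<^sub>M M) (\<lambda>z. U z * indicator (cell c s) (fst z) * indicator (cell c t) (snd z))"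
    if "bounded_kernel M U" for U
    using that by (intro integrable_kernel bounded_kernel_indicator cell_sets[OF c])
  show "0 \<le> cell_int c U s t" unfolding cell_int_def
    using U by (intro Bochner_Integration.integral_nonneg_AE AE_I2) (auto simp: unit_kernel_def)
  show "cell_int c U s t \<le> prob (cell c s) * prob (cell c t)"
    unfolding cell_int_one[OF c, symmetric] cell_int_def
    using U by (intro integral_mono i unit_imp_bounded_kernel bounded_kernel_const U)
      (auto simp: unit_kernel_def indicator_def)
qed

lemma step_unit_kernel:
  assumes c: "coloring j c" and U: "unit_kernel M U"
  shows "unit_kernel M (step c U)"
proof -
  have "step c U \<in> borel_measurable (M \<Otimes>\<^sub>M M)"
    unfolding step_def[abs_def] by (intro bounded_kernel_measurable color_kernel[OF c])
  moreover have "0 \<le> step c U z \<and> step c U z \<le> 1" for z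
    unfolding step_def using cell_int_bounds[OF c U, of "c (fst z)" "c (snd z)"]
    by (auto intro!: divide_le_eq_1[THEN iffD2] simp: divide_nonneg_nonneg zero_less_mult_iff measure_nonneg less_le)
  ultimately show ?thesis by (simp add: unit_kernel_def)
qed

text \<open>The case U = 1 of the expansion over pairs of cells. A finite sum in the cell masses can
  be passed to the limit term by term, which is how integrals over different vertex spaces are
  compared.\<close>

lemma integral_color_prob:
  assumes c: "coloring j c"
  shows "(\<integral>z. \<phi> (c (fst z)) (c (snd z)) \<partial>(M \<Otimes>\<^sub>M M))
    = (\<Sum>s\<in>words j. \<Sum>t\<in>words j. \<phi> s t * (prob (cell c s) * prob (cell c t)))"
  using integral_color[OF c bounded_kernel_const[of M 1], of \<phi>] by (simp add: cell_int_one[OF c])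

text \<open>\<open>step c U\<close> is the conditional expectation of \<open>U\<close> given the two colors.\<close>

lemma integral_step_color:
  assumes c: "coloring j c" and U: "unit_kernel M U"
  shows "(\<integral>z. step c U z * \<phi> (c (fst z)) (c (snd z)) \<partial>(M \<Otimes>\<^sub>M M))
    = (\<integral>z. U z * \<phi> (c (fst z)) (c (snd z)) \<partial>(M \<Otimes>\<^sub>M M))"
proof -
  \<comment> \<open>A product of measure zero carries no integral of \<open>U\<close>, so the
    conventional quotient 0 does no harm.\<close>
  have "cell_int c U s t = 0" if "prob (cell c s) * prob (cell c t) = 0" for s t
    using cell_int_bounds[OF c U, of s t] that by linarith
  then have "cell_int c U s t / (prob (cell c s) * prob (cell c t)) * \<phi> s t * (prob (cell c s) * prob (cell c t))
      = \<phi> s t * cell_int c U s t" for s t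
    by (cases "prob (cell c s) * prob (cell c t) = 0") auto
  then show ?thesis
    unfolding step_def integral_color[OF c unit_imp_bounded_kernel[OF U]]
    by (subst integral_color_prob[OF c, of "\<lambda>s t. cell_int c U s t / (prob (cell c s) * prob (cell c t)) * \<phi> s t"])
       simp
qed

text \<open>Pythagoras for nested conditional expectations: \<open>step c U\<close> depends on the
  finer colors only through their prefixes, so in the cross term \<open>step c' U\<close> may be
  replaced by \<open>U\<close> and then by \<open>step c U\<close>.\<close>

lemma energy_increment:
  assumes c: "coloring j c" and c': "coloring j' c'" and tk: "\<And>x. x \<in> space M \<Longrightarrow> c x = take j (c' x)"
    and U: "unit_kernel M U"
  shows "(\<integral>z. (step c' U z - step c U z)\<^sup>2 \<partial>(M \<Otimes>\<^sub>M M)) = energy c' U - energy c U"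
proof -
  let ?\<psi> = "\<lambda>s t. cell_int c U s t / (prob (cell c s) * prob (cell c t))"
  have b: "bounded_kernel M (step c' U)" "bounded_kernel M (step c U)"
    using step_unit_kernel c c' U unit_imp_bounded_kernel by blast+
  have "(\<integral>z. step c' U z * step c U z \<partial>(M \<Otimes>\<^sub>M M))
    = (\<integral>z. step c' U z * ?\<psi> (take j (c' (fst z))) (take j (c' (snd z))) \<partial>(M \<Otimes>\<^sub>M M))"
    using tk by (intro Bochner_Integration.integral_cong refl) (auto simp: step_def space_pair_measure)
  also have "\<dots> = (\<integral>z. U z * ?\<psi> (take j (c' (fst z))) (take j (c' (snd z))) \<partial>(M \<Otimes>\<^sub>M M))"
    by (rule integral_step_color[OF c' U, of "\<lambda>s t. ?\<psi> (take j s) (take j t)"])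
  also have "\<dots> = (\<integral>z. U z * ?\<psi> (c (fst z)) (c (snd z)) \<partial>(M \<Otimes>\<^sub>M M))"
    using tk by (intro Bochner_Integration.integral_cong refl) (auto simp: space_pair_measure)
  also have "\<dots> = (\<integral>z. step c U z * ?\<psi> (c (fst z)) (c (snd z)) \<partial>(M \<Otimes>\<^sub>M M))"
    by (rule integral_step_color[OF c U, symmetric])
  also have "\<dots> = energy c U" unfolding energy_def step_def power2_eq_square by simp
  finally have cross: "(\<integral>z. step c' U z * step c U z \<partial>(M \<Otimes>\<^sub>M M)) = energy c U" .
  have "(\<integral>z. (step c' U z - step c U z)\<^sup>2 \<partial>(M \<Otimes>\<^sub>M M))
    = (\<integral>z. step c' U z * step c' U z - 2 * (step c' U z * step c U z) + step c U z * step c U z \<partial>(M \<Otimes>\<^sub>M M))"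
    by (intro Bochner_Integration.integral_cong refl) (auto simp: power2_eq_square algebra_simps)
  also have "\<dots> = energy c' U - 2 * energy c U + energy c U"
    using cross integrable_kernel[OF bounded_kernel_mult[OF b(1) b(1)]]
      integrable_kernel[OF bounded_kernel_mult[OF b(1) b(2)]] integrable_kernel[OF bounded_kernel_mult[OF b(2) b(2)]]
    by (simp add: energy_def power2_eq_square)
  finally show ?thesis by simp
qed

text \<open>Cauchy-Schwarz on a probability space, read off from the nonnegativity of the
  variance.\<close>

lemma square_integral_le:
  fixes f :: "'a \<Rightarrow> real"
  assumes "integrable M f" "integrable M (\<lambda>x. (f x)\<^sup>2)"
  shows "(\<integral>x. f x \<partial>M)\<^sup>2 \<le> (\<integral>x. (f x)\<^sup>2 \<partial>M)"
  using variance_eq[OF assms] variance_positive[of f] by linarith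

text \<open>The indicator of \<open>S \<times> S\<close> is a function of the finer colors, so
  \<open>U\<close> can be replaced by \<open>step c' U\<close> in the defect; Cauchy-Schwarz with a
  weight at most 1 then leaves the Pythagorean increment.\<close>

lemma square_int_energy_increment:
  assumes c: "coloring j c" and c': "coloring j' c'" and tk: "\<And>x. x \<in> space M \<Longrightarrow> c x = take j (c' x)"
    and U: "unit_kernel M U" and S: "\<And>x. x \<in> space M \<Longrightarrow> x \<in> S \<longleftrightarrow> P (c' x)"
  shows "(square_int (\<lambda>z. U z - step c U z) S)\<^sup>2 \<le> energy c' U - energy c U"
proof -
  interpret PP: prob_space "M \<Otimes>\<^sub>M M" by (rule pair_prob)
  let ?i = "\<lambda>s t. of_bool (P s) * of_bool (P t) :: real"
  define J where "J z = ?i (c' (fst z)) (c' (snd z))" for z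
  have b: "bounded_kernel M U" "bounded_kernel M (step c' U)" "bounded_kernel M (step c U)" "bounded_kernel M J"
    using step_unit_kernel c c' U unit_imp_bounded_kernel color_kernel[OF c', of ?i]
    unfolding J_def[abs_def] by blast+
  have "square_int (\<lambda>z. U z - step c U z) S = (\<integral>z. U z * J z - step c U z * J z \<partial>(M \<Otimes>\<^sub>M M))"
    unfolding square_int_def J_def using S
    by (intro Bochner_Integration.integral_cong refl) (auto simp: space_pair_measure indicator_def)
  also have "\<dots> = (\<integral>z. U z * J z \<partial>(M \<Otimes>\<^sub>M M)) - (\<integral>z. step c U z * J z \<partial>(M \<Otimes>\<^sub>M M))"
    by (intro Bochner_Integration.integral_diff integrable_kernel bounded_kernel_mult b)
  also have "(\<integral>z. U z * J z \<partial>(M \<Otimes>\<^sub>M M)) = (\<integral>z. step c' U z * J z \<partial>(M \<Otimes>\<^sub>M M))"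
    unfolding J_def by (rule integral_step_color[OF c' U, of ?i, symmetric])
  also have "\<dots> - (\<integral>z. step c U z * J z \<partial>(M \<Otimes>\<^sub>M M)) = (\<integral>z. step c' U z * J z - step c U z * J z \<partial>(M \<Otimes>\<^sub>M M))"
    by (intro Bochner_Integration.integral_diff[symmetric] integrable_kernel bounded_kernel_mult b)
  finally have e: "square_int (\<lambda>z. U z - step c U z) S = (\<integral>z. (step c' U z - step c U z) * J z \<partial>(M \<Otimes>\<^sub>M M))"
    by (simp only: left_diff_distrib)
  have "(square_int (\<lambda>z. U z - step c U z) S)\<^sup>2 \<le> (\<integral>z. ((step c' U z - step c U z) * J z)\<^sup>2 \<partial>(M \<Otimes>\<^sub>M M))"
    unfolding e
  proof (rule PP.square_integral_le)
    show "integrable (M \<Otimes>\<^sub>M M) (\<lambda>z. (step c' U z - step c U z) * J z)"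
      by (intro integrable_kernel bounded_kernel_mult bounded_kernel_diff b)
    show "integrable (M \<Otimes>\<^sub>M M) (\<lambda>z. ((step c' U z - step c U z) * J z)\<^sup>2)"
      unfolding power2_eq_square by (intro integrable_kernel bounded_kernel_mult bounded_kernel_diff b)
  qed
  also have "\<dots> \<le> (\<integral>z. (step c' U z - step c U z)\<^sup>2 \<partial>(M \<Otimes>\<^sub>M M))"
    by (unfold power2_eq_square, intro integral_mono integrable_kernel bounded_kernel_mult bounded_kernel_diff b)
      (auto simp: J_def)
  finally show ?thesis using energy_increment[OF c c' tk U] by simp
qed

lemma energy_bounds:
  assumes c: "coloring j c" and U: "unit_kernel M U"
  shows "0 \<le> energy c U" "energy c U \<le> 1"
proof -
  interpret PP: prob_space "M \<Otimes>\<^sub>M M" by (rule pair_prob)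
  have "\<bar>energy c U\<bar> \<le> 1" unfolding energy_def
    using step_unit_kernel[OF c U]
    by (intro PP.abs_integral_le_const) (auto simp: unit_kernel_def intro: power_le_one)
  then show "energy c U \<le> 1" by simp
  show "0 \<le> energy c U" unfolding energy_def by simp
qed

section \<open>Greedy refinement by nearly extremal sets\<close>

definition near_max_set :: "('a \<times> 'a \<Rightarrow> real) \<Rightarrow> 'a set" where
  "near_max_set D = (SOME S. S \<in> sets M \<and> (\<forall>T\<in>sets M. \<bar>square_int D T\<bar> \<le> 2 * \<bar>square_int D S\<bar>))"

text \<open>The supremum over measurable sets need not be attained, but half of it is exceeded by
  some set unless it is 0, and then every set works.\<close>

lemma near_max_set:
  assumes D: "bounded_kernel M D"
  shows "near_max_set D \<in> sets M" "T \<in> sets M \<Longrightarrow> \<bar>square_int D T\<bar> \<le> 2 * \<bar>square_int D (near_max_set D)\<bar>"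
proof -
  interpret PP: prob_space "M \<Otimes>\<^sub>M M" by (rule pair_prob)
  obtain B where B: "\<And>z. z \<in> space (M \<Otimes>\<^sub>M M) \<Longrightarrow> \<bar>D z\<bar> \<le> B"
    using D unfolding bounded_kernel_def by auto
  have bound: "\<bar>square_int D T\<bar> \<le> \<bar>B\<bar>" for T
    unfolding square_int_def
    by (intro PP.abs_integral_le_const) (use B in \<open>fastforce simp: abs_mult indicator_def\<close>)
  let ?s = "SUP T\<in>sets M. \<bar>square_int D T\<bar>"
  have bdd: "bdd_above ((\<lambda>T. \<bar>square_int D T\<bar>) ` sets M)"
    using bound by (auto intro!: bdd_aboveI[of _ "\<bar>B\<bar>"])
  have le: "\<bar>square_int D T\<bar> \<le> ?s" if "T \<in> sets M" for T
    using that by (intro cSUP_upper bdd)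
  have "\<exists>S. S \<in> sets M \<and> (\<forall>T\<in>sets M. \<bar>square_int D T\<bar> \<le> 2 * \<bar>square_int D S\<bar>)"
  proof (cases "?s = 0")
    case True
    have "{} \<in> sets M" by simp
    moreover have "\<bar>square_int D T\<bar> \<le> 2 * \<bar>square_int D {}\<bar>" if "T \<in> sets M" for T
      using le[OF that] True by linarith
    ultimately show ?thesis by blast
  next
    case False
    moreover have "0 \<le> ?s" using le[of "{}"] by (auto intro: order_trans[OF abs_ge_zero])
    ultimately have "?s / 2 < ?s" by simp
    then obtain S where "S \<in> sets M" "?s / 2 < \<bar>square_int D S\<bar>"
      using less_cSUP_iff[OF _ bdd, of "?s / 2"] by (metis sets.empty_sets empty_iff)
    then show ?thesis using le by (intro exI[of _ S]) force
  qed
  from someI_ex[OF this] show "near_max_set D \<in> sets M"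
    "T \<in> sets M \<Longrightarrow> \<bar>square_int D T\<bar> \<le> 2 * \<bar>square_int D (near_max_set D)\<bar>"
    unfolding near_max_set_def by auto
qed

lemma step_symmetric:
  assumes c: "coloring j c" and U: "bounded_kernel M U" and sym: "symmetric_kernel U"
  shows "cell_int c U s t = cell_int c U t s" "symmetric_kernel (step c U)"
proof -
  interpret PP: pair_sigma_finite M M by unfold_locales
  have *: "cell_int c U s t = cell_int c U t s" for s t
  proof -
    have i: "integrable (M \<Otimes>\<^sub>M M) (\<lambda>z. U z * indicator (cell c s) (fst z) * indicator (cell c t) (snd z))"
      by (intro integrable_kernel bounded_kernel_indicator U cell_sets[OF c])
    have "cell_int c U s t = (\<integral>z. (\<lambda>z. U z * indicator (cell c s) (fst z) * indicator (cell c t) (snd z)) (snd z, fst z) \<partial>(M \<Otimes>\<^sub>M M))"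
      unfolding cell_int_def using PP.integral_product_swap[OF borel_measurable_integrable[OF i]]
      by (simp add: case_prod_unfold)
    also have "\<dots> = cell_int c U t s"
      unfolding cell_int_def using sym by (intro Bochner_Integration.integral_cong)
        (auto simp: symmetric_kernel_def space_pair_measure)
    finally show ?thesis .
  qed
  show "cell_int c U s t = cell_int c U t s" by (rule *)
  show "symmetric_kernel (step c U)"
    unfolding symmetric_kernel_def step_def by (auto simp: * mult.commute)
qed

text \<open>Bit \<open>j\<close> of a code tells membership in a set nearly extremal for the kernel
  \<open>K j\<close> treated at step \<open>j\<close>; the kernel may change from step to step,
  while one coloring is refined for all of them.\<close>

primrec refinement :: "(nat \<Rightarrow> 'a \<times> 'a \<Rightarrow> real) \<Rightarrow> nat \<Rightarrow> 'a \<Rightarrow> bool list" where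
  "refinement K 0 = (\<lambda>x. [])"
| "refinement K (Suc j) = (\<lambda>x. refinement K j x @ [x \<in> near_max_set (\<lambda>z. K j z - step (refinement K j) (K j) z)])"

lemma refinement_coloring:
  assumes K: "\<And>j. unit_kernel M (K j)"
  shows "coloring j (refinement K j)"
proof (induction j)
  case (Suc j)
  let ?S = "near_max_set (\<lambda>z. K j z - step (refinement K j) (K j) z)"
  have [measurable]: "?S \<in> sets M"
    using step_unit_kernel[OF Suc K] K by (intro near_max_set bounded_kernel_diff unit_imp_bounded_kernel)
  have [measurable]: "refinement K j \<in> M \<rightarrow>\<^sub>M count_space UNIV" using Suc by (simp add: coloring_def)
  have "refinement K (Suc j) \<in> M \<rightarrow>\<^sub>M count_space UNIV" by simp
  then show ?case using Suc by (simp add: coloring_def)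
qed (simp add: coloring_def)

lemma refinement_take:
  assumes K: "\<And>j. unit_kernel M (K j)" and "i \<le> j" "x \<in> space M"
  shows "refinement K i x = take i (refinement K j x)"
  using assms(2)
proof (induction j rule: dec_induct)
  case base
  then show ?case using refinement_coloring[OF K, of i] assms(3) by (simp add: coloring_def)
next
  case (step j)
  then show ?case using refinement_coloring[OF K, of j] assms(3) by (simp add: coloring_def)
qed

text \<open>The factor 4 is 2 for the choice of a nearly, not exactly, maximal square times 2 for
  polarization.\<close>

lemma refinement_cut_bound:
  assumes K: "\<And>j. unit_kernel M (K j)" and sym: "symmetric_kernel (K j)"
  shows "cut_bound (\<lambda>z. K j z - step (refinement K j) (K j) z)
    (4 * sqrt (energy (refinement K (Suc j)) (K j) - energy (refinement K j) (K j)))"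
proof -
  let ?D = "\<lambda>z. K j z - step (refinement K j) (K j) z"
  let ?S = "near_max_set ?D"
  let ?e = "energy (refinement K (Suc j)) (K j) - energy (refinement K j) (K j)"
  note c = refinement_coloring[OF K]
  have D: "bounded_kernel M ?D"
    using step_unit_kernel[OF c K] K by (intro bounded_kernel_diff unit_imp_bounded_kernel)
  have Dsym: "symmetric_kernel ?D"
    using step_symmetric(2)[OF c unit_imp_bounded_kernel[OF K] sym] sym by (simp add: symmetric_kernel_def)
  have "(square_int ?D ?S)\<^sup>2 \<le> ?e"
    \<comment> \<open>The chosen set is read off from the new coloring as its last bit.\<close>
    by (rule square_int_energy_increment[OF c c, where P = last])
      (use refinement_take[OF K, of j "Suc j"] K in auto)
  then have "\<bar>square_int ?D ?S\<bar> \<le> sqrt ?e" by (simp add: real_le_rsqrt)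
  then have "\<bar>square_int ?D T\<bar> \<le> 2 * sqrt ?e" if "T \<in> sets M" for T
    using near_max_set(2)[OF D that] by linarith
  then have "cut_bound ?D (2 * (2 * sqrt ?e))" by (intro cut_bound_from_squares D Dsym)
  then show ?thesis by simp
qed

end

section \<open>Binary trees of masses and cells of a compact space\<close>

text \<open>The masses of the cylinders of a probability measure on Cantor space. Only equations and
  weak inequalities occur, so the notion survives pointwise limits.\<close>

definition tree_mass :: "(bool list \<Rightarrow> real) \<Rightarrow> bool" where
  "tree_mass p \<longleftrightarrow> p [] = 1 \<and> (\<forall>s. 0 \<le> p s \<and> p s = p (s @ [False]) + p (s @ [True]))"

lemma tree_massD:
  assumes "tree_mass p"
  shows "p [] = 1" "0 \<le> p s" "p s = p (s @ [False]) + p (s @ [True])"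
  using assms unfolding tree_mass_def by blast+

text \<open>For a \<open>tree_mass\<close> this is the total mass of the words of the same length
  that precede \<open>s\<close> lexicographically: each bit True of \<open>s\<close> passes over the
  left sibling.\<close>

definition left_end :: "(bool list \<Rightarrow> real) \<Rightarrow> bool list \<Rightarrow> real" where
  "left_end p s = (\<Sum>i<length s. if s ! i then p (take i s @ [False]) else 0)"

lemma left_end_Nil [simp]: "left_end p [] = 0"
  by (simp add: left_end_def)

lemma left_end_snoc: "left_end p (s @ [b]) = left_end p s + (if b then p (s @ [False]) else 0)"
proof -
  have "(\<Sum>i<length s. if (s @ [b]) ! i then p (take i (s @ [b]) @ [False]) else 0) = left_end p s"
    unfolding left_end_def by (intro sum.cong refl) (simp add: nth_append)
  then show ?thesis by (simp add: left_end_def)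
qed

text \<open>The dyadic-style partition of \<open>[0,1)\<close> into intervals \<open>[left_end p s, left_end p s + p s)\<close>:
  \<open>branch p u j\<close> is the word of length \<open>j\<close> whose interval contains \<open>u\<close>.\<close>

primrec branch :: "(bool list \<Rightarrow> real) \<Rightarrow> real \<Rightarrow> nat \<Rightarrow> bool list" where
  "branch p u 0 = []"
| "branch p u (Suc j) = branch p u j @ [left_end p (branch p u j) + p (branch p u j @ [False]) \<le> u]"

lemma length_branch [simp]: "length (branch p u j) = j"
  by (induction j) auto

lemma take_branch: "i \<le> j \<Longrightarrow> take i (branch p u j) = branch p u i"
  by (induction j rule: dec_induct) auto

lemma branch_interval:
  assumes p: "tree_mass p" and u: "0 \<le> u" "u < 1"
  shows "left_end p (branch p u j) \<le> u \<and> u < left_end p (branch p u j) + p (branch p u j)"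
proof (induction j)
  case 0
  then show ?case using tree_massD(1)[OF p] u by simp
next
  case (Suc j)
  have "p (branch p u j) = p (branch p u j @ [False]) + p (branch p u j @ [True])"
    by (rule tree_massD(3)[OF p])
  with Suc show ?case by (auto simp: left_end_snoc)
qed

lemma branch_pos: "tree_mass p \<Longrightarrow> 0 \<le> u \<Longrightarrow> u < 1 \<Longrightarrow> 0 < p (branch p u j)"
  using branch_interval[of p u j] by linarith

lemma left_end_bounds:
  assumes p: "tree_mass p"
  shows "0 \<le> left_end p s \<and> left_end p s + p s \<le> 1"
proof (induction s rule: rev_induct)
  case Nil
  then show ?case using tree_massD(1)[OF p] by simp
next
  case (snoc b s)
  have "p s = p (s @ [False]) + p (s @ [True])" "0 \<le> p (s @ [False])" "0 \<le> p (s @ [True])"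
    by (rule tree_massD[OF p])+
  with snoc show ?case by (cases b) (auto simp: left_end_snoc)
qed

lemma branch_eqI:
  assumes p: "tree_mass p"
  shows "left_end p s \<le> u \<Longrightarrow> u < left_end p s + p s \<Longrightarrow> branch p u (length s) = s"
proof (induction s rule: rev_induct)
  case (snoc b s)
  have "p s = p (s @ [False]) + p (s @ [True])" "0 \<le> p (s @ [False])" "0 \<le> p (s @ [True])"
    by (rule tree_massD[OF p])+
  with snoc show ?case by (cases b) (auto simp: left_end_snoc)
qed simp

lemma branch_eq_iff:
  assumes "tree_mass p" "0 \<le> u" "u < 1"
  shows "branch p u (length s) = s \<longleftrightarrow> left_end p s \<le> u \<and> u < left_end p s + p s"
  using branch_interval[OF assms, of "length s"] branch_eqI[OF assms(1), of s u] by auto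

text \<open>Each step of the path compares \<open>u\<close> with functions of the tree at a fixed
  word, and there are only countably many words to condition on. Joint measurability is asked for
  because the tree will vary with the pair of vertices.\<close>

lemma branch_measurable:
  assumes p: "\<And>s. (\<lambda>z. p z s) \<in> borel_measurable Z" and u: "u \<in> borel_measurable Z"
  shows "(\<lambda>z. branch (p z) (u z) j) \<in> Z \<rightarrow>\<^sub>M count_space UNIV"
proof (induction j)
  case (Suc j)
  note [measurable] = Suc p u
  have "(\<lambda>z. branch (p z) (u z) (Suc j)) = (\<lambda>z. (\<lambda>s z. s @ [left_end (p z) s + p z (s @ [False]) \<le> u z]) (branch (p z) (u z) j) z)"
    by simp
  also have "\<dots> \<in> Z \<rightarrow>\<^sub>M count_space UNIV"
  proof (rule measurable_compose_countable[OF _ Suc])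
    fix s :: "bool list"
    have [measurable]: "(\<lambda>z. left_end (p z) s) \<in> borel_measurable Z"
      unfolding left_end_def by measurable
    show "(\<lambda>z. s @ [left_end (p z) s + p z (s @ [False]) \<le> u z]) \<in> Z \<rightarrow>\<^sub>M count_space UNIV"
      by measurable
  qed
  finally show ?case .
qed simp

abbreviation unit_interval :: "real measure" where
  "unit_interval \<equiv> restrict_space lborel {0..1}"

lemma space_unit_interval [simp]: "space unit_interval = {0..1}"
  by (simp add: space_restrict_space)

lemma prob_space_unit_interval: "prob_space unit_interval"
  by (rule prob_spaceI) (simp add: emeasure_restrict_space)

text \<open>The endpoint \<open>1\<close> lies in no interval of the partition and is moved to \<open>0\<close>.\<close>

definition word_path :: "(bool list \<Rightarrow> real) \<Rightarrow> real \<Rightarrow> nat \<Rightarrow> bool list" where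
  "word_path p u = branch p (if u < 1 then u else 0)"

lemma length_path [simp]: "length (word_path p u j) = j"
  by (simp add: word_path_def)

lemma take_path: "i \<le> j \<Longrightarrow> take i (word_path p u j) = word_path p u i"
  by (simp add: word_path_def take_branch)

text \<open>Holds at every point of [0,1], not only almost everywhere: the intervals are half open,
  so no point lies in one of length 0. Later divisions by masses and the nonemptiness of cells along
  a path therefore hold everywhere.\<close>

lemma path_pos: "tree_mass p \<Longrightarrow> u \<in> {0..1} \<Longrightarrow> 0 < p (word_path p u j)"
  by (simp add: word_path_def branch_pos)

lemma path_measurable:
  assumes "\<And>s. (\<lambda>z. p z s) \<in> borel_measurable Z" and [measurable]: "u \<in> borel_measurable Z"
  shows "(\<lambda>z. word_path (p z) (u z) j) \<in> Z \<rightarrow>\<^sub>M count_space UNIV"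
  unfolding word_path_def using assms(1) by (rule branch_measurable) measurable

text \<open>Up to the null point 1 the event is an interval of length \<open>p s\<close>, so the
  path of a uniform point has the prescribed masses.\<close>

lemma measure_path:
  assumes p: "tree_mass p"
  shows "measure unit_interval {u\<in>{0..1}. word_path p u (length s) = s} = p s"
proof -
  have m: "{u\<in>{0..1}. word_path p u (length s) = s} \<in> sets unit_interval"
    using measurable_sets[OF path_measurable[of "\<lambda>_. p" unit_interval "\<lambda>u. u" "length s"], of "{s}"]
    by (simp add: vimage_def Int_def conj_commute measurable_restrict_space1)
  have lb: "0 \<le> left_end p s" "left_end p s + p s \<le> 1" using left_end_bounds[OF p] by auto
  have i: "{left_end p s..<left_end p s + p s} \<in> sets unit_interval"
    using lb by (subst sets_restrict_space_iff) auto
  have "AE u in unit_interval. u \<noteq> 1"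
    by (subst AE_restrict_space_iff) (auto intro: AE_mp[OF AE_lborel_singleton[of 1]])
  then have "AE u in unit_interval. u \<in> {u\<in>{0..1}. word_path p u (length s) = s} \<longleftrightarrow> u \<in> {left_end p s..<left_end p s + p s}"
  proof (rule AE_mp, intro AE_I2 impI)
    fix u assume "u \<in> space unit_interval" "u \<noteq> 1"
    then show "u \<in> {u\<in>{0..1}. word_path p u (length s) = s} \<longleftrightarrow> u \<in> {left_end p s..<left_end p s + p s}"
      using branch_eq_iff[OF p, of u s] by (auto simp: word_path_def)
  qed
  then have "measure unit_interval {u\<in>{0..1}. word_path p u (length s) = s}
      = measure unit_interval {left_end p s..<left_end p s + p s}"
    by (intro measure_eq_AE m i)
  also have "\<dots> = measure lborel {left_end p s..<left_end p s + p s}"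
    using lb by (intro measure_restrict_space) auto
  also have "\<dots> = p s" using tree_massD(2)[OF p] by simp
  finally show ?thesis .
qed

section \<open>Cells of a compact space and the points coded by infinite words\<close>

locale coded_space =
  fixes B :: "nat \<Rightarrow> 'k :: t2_space set"
  assumes open_B: "open (B i)"
    and basis_B: "open V \<Longrightarrow> x \<in> V \<Longrightarrow> \<exists>i. x \<in> B i \<and> B i \<subseteq> V"
    and compact_UNIV: "compact (UNIV :: 'k set)"
begin

definition Kcell :: "bool list \<Rightarrow> 'k set" where
  "Kcell s = {k. \<forall>i<length s. s ! i \<longleftrightarrow> k \<in> B i}"

lemma Kcell_Nil [simp]: "Kcell [] = UNIV"
  by (simp add: Kcell_def)

lemma Kcell_snoc: "Kcell (s @ [b]) = Kcell s \<inter> {k. b \<longleftrightarrow> k \<in> B (length s)}"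
  by (auto simp: Kcell_def nth_append less_Suc_eq)

lemma Kcell_measurable [measurable]: "Kcell s \<in> sets borel"
proof (induction s rule: rev_induct)
  case (snoc b s)
  have "{k. b \<longleftrightarrow> k \<in> B (length s)} = (if b then B (length s) else - B (length s))" by auto
  then have "{k. b \<longleftrightarrow> k \<in> B (length s)} \<in> sets borel"
    using open_B by (auto intro: borel_open borel_closed)
  then show ?case using snoc by (auto simp: Kcell_snoc)
qed simp

lemma Kcell_take: "Kcell s \<subseteq> Kcell (take i s)"
  by (auto simp: Kcell_def)

definition code :: "nat \<Rightarrow> 'k \<Rightarrow> bool list" where
  "code j k = map (\<lambda>i. k \<in> B i) [0..<j]"

lemma code_in_words: "code j k \<in> words j"
  by (simp add: code_def words_def)

lemma Kcell_iff_code: "s \<in> words j \<Longrightarrow> k \<in> Kcell s \<longleftrightarrow> s = code j k"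
  by (auto simp: Kcell_def code_def words_def list_eq_iff_nth_eq)

lemma separating_B: "x \<noteq> y \<Longrightarrow> \<exists>i. x \<in> B i \<and> y \<notin> closure (B i)"
proof -
  assume "x \<noteq> y"
  then obtain U V where UV: "open U" "open V" "x \<in> U" "y \<in> V" "U \<inter> V = {}"
    using hausdorff[OF \<open>x \<noteq> y\<close>] by (elim exE conjE)
  from basis_B[OF UV(1,3)] obtain i where i: "x \<in> B i" "B i \<subseteq> U" by (elim exE conjE)
  have "closure (B i) \<subseteq> - V"
    using i UV by (intro closure_minimal) auto
  with i UV show ?thesis by blast
qed

text \<open>Compactness: finitely many complements of the \<open>C j\<close> cover the complement of
  \<open>V\<close>, and by monotonicity the largest index suffices.\<close>

lemma nested_closed_subset_open:
  fixes C :: "nat \<Rightarrow> 'k set"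
  assumes C: "\<And>j. closed (C j)" "\<And>i j. i \<le> j \<Longrightarrow> C j \<subseteq> C i" and V: "open V" and sub: "(\<Inter>j. C j) \<subseteq> V"
  shows "\<exists>j. C j \<subseteq> V"
proof -
  have "compact (- V)" using V compact_UNIV compact_Int_closed[of UNIV "- V"] by auto
  moreover have "- V \<subseteq> (\<Union>j. - C j)" using sub by auto
  ultimately obtain J where J: "finite J" "- V \<subseteq> (\<Union>j\<in>J. - C j)"
    using compactE_image[of "- V" UNIV "\<lambda>j. - C j"] C(1) by (metis open_Compl)
  \<comment> \<open>Inserting 0 gives the maximum a meaning when the finite cover is empty.\<close>
  have "C (Max (insert 0 J)) \<subseteq> V"
  proof
    fix x assume x: "x \<in> C (Max (insert 0 J))"
    have "x \<in> C j" if "j \<in> J" for j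
      using C(2)[of j "Max (insert 0 J)"] J(1) that x by auto
    then show "x \<in> V" using J(2) by blast
  qed
  then show ?thesis by (rule exI)
qed

definition consistent :: "(nat \<Rightarrow> bool list) \<Rightarrow> bool" where
  "consistent w \<longleftrightarrow> (\<forall>j. length (w j) = j \<and> Kcell (w j) \<noteq> {}) \<and> (\<forall>i j. i \<le> j \<longrightarrow> take i (w j) = w i)"

text \<open>The closures are essential: decreasing nonempty cells may have empty intersection, while
  that of their closures is nonempty by compactness and a single point by the Hausdorff
  property.\<close>

definition limit_point :: "(nat \<Rightarrow> bool list) \<Rightarrow> 'k" where
  "limit_point w = (THE k. \<forall>j. k \<in> closure (Kcell (w j)))"

lemma consistent_decreasing:
  assumes "consistent w" "i \<le> j"
  shows "closure (Kcell (w j)) \<subseteq> closure (Kcell (w i))"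
  using Kcell_take[of "w j" i] assms by (intro closure_mono) (simp add: consistent_def)

text \<open>Let \<open>B i\<close> contain \<open>x\<close> with \<open>y\<close> outside its
  closure. If bit \<open>i\<close> is True, the cell lies in \<open>B i\<close> and its closure
  misses \<open>y\<close>; if it is False, the cell lies in the closed complement of
  \<open>B i\<close>, and its closure misses \<open>x\<close>.\<close>

lemma limit_point_unique:
  assumes w: "consistent w" and x: "\<And>j. x \<in> closure (Kcell (w j))" and y: "\<And>j. y \<in> closure (Kcell (w j))"
  shows "x = y"
proof (rule ccontr)
  assume "x \<noteq> y"
  then obtain i where i: "x \<in> B i" "y \<notin> closure (B i)" using separating_B by blast
  have l: "length (w (Suc i)) = Suc i" using w by (simp add: consistent_def)
  show False
  proof (cases "w (Suc i) ! i")
    case True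
    then have "Kcell (w (Suc i)) \<subseteq> B i" using l by (auto simp: Kcell_def)
    then show False using y[of "Suc i"] i(2) closure_mono by blast
  next
    case False
    then have "Kcell (w (Suc i)) \<subseteq> - B i" using l by (auto simp: Kcell_def)
    then have "closure (Kcell (w (Suc i))) \<subseteq> - B i" using open_B by (intro closure_minimal) auto
    then show False using x[of "Suc i"] i(1) by blast
  qed
qed

lemma limit_point_in_closure:
  assumes w: "consistent w"
  shows "limit_point w \<in> closure (Kcell (w j))"
proof -
  have "\<exists>k. \<forall>j. k \<in> closure (Kcell (w j))"
  proof (rule ccontr)
    assume "\<nexists>k. \<forall>j. k \<in> closure (Kcell (w j))"
    then have "\<exists>j. closure (Kcell (w j)) \<subseteq> {}"
      by (intro nested_closed_subset_open consistent_decreasing[OF w]) auto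
    then show False using w by (auto simp: consistent_def)
  qed
  then have "\<exists>!k. \<forall>j. k \<in> closure (Kcell (w j))" using limit_point_unique[OF w] by blast
  from theI'[OF this] show ?thesis unfolding limit_point_def by blast
qed

text \<open>This reduces the event that the limit point lies in an open set to countably many
  conditions on finite words, which is what makes the limit point measurable.\<close>

lemma limit_point_in_open_iff:
  assumes w: "consistent w" and V: "open V"
  shows "limit_point w \<in> V \<longleftrightarrow> (\<exists>j. closure (Kcell (w j)) \<subseteq> V)"
proof
  assume a: "limit_point w \<in> V"
  have "(\<Inter>j. closure (Kcell (w j))) \<subseteq> V"
    using limit_point_unique[OF w] limit_point_in_closure[OF w] a by blast
  then show "\<exists>j. closure (Kcell (w j)) \<subseteq> V"
    by (intro nested_closed_subset_open consistent_decreasing[OF w] V) auto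
qed (use limit_point_in_closure[OF w] in blast)

text \<open>Uniform continuity without a metric: finitely many base sets on which \<open>f\<close>
  varies by at most \<open>e\<close> cover the space, and a word longer than all their indices
  decides membership in each of them, so a nonempty cell lies inside one. The bound extends to
  closures because it is a closed condition in each variable.\<close>

lemma small_oscillation:
  fixes f :: "'k \<Rightarrow> real"
  assumes f: "continuous_on UNIV f" and e: "0 < e"
  shows "\<exists>j. \<forall>s\<in>words j. \<forall>x\<in>closure (Kcell s). \<forall>y\<in>closure (Kcell s). \<bar>f x - f y\<bar> \<le> e"
proof -
  define G where "G = {i. \<forall>x\<in>B i. \<forall>y\<in>B i. \<bar>f x - f y\<bar> \<le> e}"
  have "x \<in> (\<Union>i\<in>G. B i)" for x
  proof -
    let ?V = "f -` ball (f x) (e / 2)"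
    have "open ?V" using f by (simp add: continuous_on_open_vimage)
    then obtain i where i: "x \<in> B i" "B i \<subseteq> ?V" using basis_B[of ?V x] e by auto
    have "\<bar>f y - f z\<bar> \<le> e" if "y \<in> B i" "z \<in> B i" for y z
    proof -
      have "dist (f x) (f y) < e / 2" "dist (f x) (f z) < e / 2" using i(2) that by auto
      then show ?thesis unfolding dist_real_def by linarith
    qed
    with i show ?thesis by (auto simp: G_def)
  qed
  then have "UNIV \<subseteq> (\<Union>i\<in>G. B i)" by (intro subsetI)
  then obtain J where J: "J \<subseteq> G" "finite J" "UNIV \<subseteq> (\<Union>i\<in>J. B i)"
    by (rule compactE_image[OF compact_UNIV open_B])
  \<comment> \<open>The successor makes the largest index of the cover still a position of the
    word.\<close>
  let ?j = "Suc (Max (insert 0 J))"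
  have "\<bar>f x - f y\<bar> \<le> e" if s: "s \<in> words ?j" and xy: "x \<in> closure (Kcell s)" "y \<in> closure (Kcell s)" for s x y
  proof -
    from xy have "Kcell s \<noteq> {}" by auto
    then obtain k where k: "k \<in> Kcell s" by blast
    then obtain i where i: "i \<in> J" "k \<in> B i" using J by blast
    then have "i < length s" using J(2) s by (simp add: words_def le_imp_less_Suc)
    then have sub: "Kcell s \<subseteq> B i" using k i by (auto simp: Kcell_def)
    have cl: "closed {y. \<bar>f x - f y\<bar> \<le> e}" for x
      using f by (intro closed_Collect_le continuous_intros) auto
    have "\<bar>f x - f y\<bar> \<le> e" if "x \<in> Kcell s" "y \<in> Kcell s" for x y
      using that sub i(1) J(1) by (auto simp: G_def)
    then have "\<bar>f x - f y\<bar> \<le> e" if "x \<in> Kcell s" "y \<in> closure (Kcell s)" for x y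
      using closure_minimal[of "Kcell s" "{y. \<bar>f x - f y\<bar> \<le> e}"] cl[of x] that by blast
    then have "Kcell s \<subseteq> {x. \<bar>f y - f x\<bar> \<le> e}" using xy(2) by (auto simp: abs_minus_commute)
    then have "\<bar>f y - f x\<bar> \<le> e"
      using closure_minimal[of "Kcell s" "{x. \<bar>f y - f x\<bar> \<le> e}"] cl[of y] xy(1) by blast
    then show ?thesis by (simp add: abs_minus_commute)
  qed
  then show ?thesis by blast
qed

end

lemma coded_space_exists:
  assumes "compact (UNIV :: 'k::{t2_space, second_countable_topology} set)"
  shows "\<exists>B :: nat \<Rightarrow> 'k set. coded_space B"
proof -
  obtain \<B> :: "'k set set" where \<B>: "countable \<B>" "topological_basis \<B>"
    using ex_countable_basis by blast
  have "\<B> \<noteq> {}" using \<B>(2) topological_basisE[of \<B> UNIV undefined] by auto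
  then have r: "range (from_nat_into \<B>) = \<B>" using \<B>(1) by (rule range_from_nat_into)
  have "coded_space (from_nat_into \<B>)"
  proof
    show "open (from_nat_into \<B> i)" for i
      using r topological_basis_open[OF \<B>(2)] by blast
    show "\<exists>i. x \<in> from_nat_into \<B> i \<and> from_nat_into \<B> i \<subseteq> V" if "open V" "x \<in> V" for x V
      using topological_basisE[OF \<B>(2) that] r by (metis rangeE)
  qed (rule assms)
  then show ?thesis by blast
qed

section \<open>Limits of step kernels\<close>

lemma tree_mass_take_ge:
  assumes "tree_mass p"
  shows "p s \<le> p (take j s)"
proof (induction s rule: rev_induct)
  case (snoc b s)
  have "p (s @ [b]) \<le> p s"
    using tree_massD(2)[OF assms, of "s @ [\<not> b]"] tree_massD(3)[OF assms, of s] by (cases b) auto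
  with snoc show ?case by (cases "j \<le> length s") auto
qed simp

lemma convergent_diagonal_subsequence:
  fixes X :: "nat \<Rightarrow> 'i::countable \<Rightarrow> real"
  assumes X: "\<And>n i. 0 \<le> X n i \<and> X n i \<le> 1"
  shows "\<exists>r. strict_mono (r :: nat \<Rightarrow> nat) \<and> (\<forall>i. convergent (\<lambda>n. X (r n) i))"
proof -
  interpret S: subseqs "\<lambda>m r. convergent (\<lambda>n. X (r n) (from_nat m))"
  proof
    fix m and s :: "nat \<Rightarrow> nat"
    have "seq_compact {0..1::real}" using compact_Icc compact_eq_seq_compact_metric by blast
    moreover have "\<forall>n. X (s n) (from_nat m) \<in> {0..1}" using X by auto
    ultimately obtain l r where "strict_mono r" "((\<lambda>n. X (s n) (from_nat m)) \<circ> r) \<longlonglongrightarrow> l"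
      by (rule seq_compactE)
    then show "\<exists>r'. strict_mono r' \<and> convergent (\<lambda>n. X ((s \<circ> r') n) (from_nat m))"
      by (auto simp: convergent_def o_def)
  qed
  have "convergent (\<lambda>n. X (S.diagseq n) i)" for i
  proof -
    \<comment> \<open>Beyond its first \<open>m + 1\<close> terms the diagonal sequence is a
      subsequence of the one chosen for index \<open>m\<close>.\<close>
    have "convergent (\<lambda>n. X ((S.diagseq \<circ> (+) (Suc (to_nat i))) n) (from_nat (to_nat i)))"
    proof (rule S.diagseq_holds)
      fix r s :: "nat \<Rightarrow> nat" and m
      assume "strict_mono r" "convergent (\<lambda>n. X (s n) (from_nat m))"
      then show "convergent (\<lambda>n. X ((s \<circ> r) n) (from_nat m))"
        using LIMSEQ_subseq_LIMSEQ unfolding convergent_def by (fastforce simp: o_def)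
    qed
    then have "convergent (\<lambda>n. X (S.diagseq (n + Suc (to_nat i))) i)" by (simp add: o_def add.commute)
    then show ?thesis by (rule convergent_ignore_initial_segment[THEN iffD1])
  qed
  then show ?thesis using S.subseq_diagseq by blast
qed

context prob_space
begin

text \<open>Every point realizes exactly one assignment of words to vertices, so the integrand
  splits over finitely many assignments and the density becomes a polynomial in the cell masses,
  ready for termwise limits.\<close>

lemma edge_density_color:
  assumes c: "coloring j c"
  shows "edge_density M k (\<lambda>e z. \<phi> e (c (fst z)) (c (snd z)))
    = (\<Sum>f\<in>PiE {..<k} (\<lambda>_. words j). (\<Prod>e\<in>edges k. \<phi> e (f (fst e)) (f (snd e))) * (\<Prod>i<k. prob (cell c (f i))))"
proof -
  let ?P = "PiM {..<k} (\<lambda>_. M)" and ?F = "PiE {..<k} (\<lambda>_::nat. words j)"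
  let ?g = "\<lambda>f. \<Prod>e\<in>edges k. \<phi> e (f (fst e)) (f (snd e))"
  interpret PS: product_sigma_finite "\<lambda>_::nat. M" by unfold_locales
  have F: "finite ?F" by (intro finite_PiE) auto
  have ii: "integrable M (indicator (cell c s) :: _ \<Rightarrow> real)" for s
    using cell_sets[OF c, of s] by (simp add: less_top[symmetric])
  have "edge_density M k (\<lambda>e z. \<phi> e (c (fst z)) (c (snd z)))
    = (\<integral>x. (\<Sum>f\<in>?F. ?g f * (\<Prod>i<k. indicator (cell c (f i)) (x i))) \<partial>?P)"
    unfolding edge_density_def
  proof (intro Bochner_Integration.integral_cong refl)
    fix x assume x: "x \<in> space ?P"
    then have xM: "x i \<in> space M" if "i < k" for i using that by (auto simp: space_PiM)
    define f0 where "f0 = (\<lambda>i\<in>{..<k}. c (x i))"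
    have f0: "f0 \<in> ?F" using coloring_words[OF c] xM by (auto simp: f0_def)
    have "(\<Prod>i<k. indicator (cell c (f i)) (x i) :: real) = (if f = f0 then 1 else 0)" if f: "f \<in> ?F" for f
    proof (cases "f = f0")
      case True
      then show ?thesis using xM by (auto simp: f0_def cell_def intro!: prod.neutral)
    next
      case False
      then have "\<not> (\<forall>i\<in>{..<k}. f i = f0 i)" using PiE_ext[OF f f0] by blast
      then obtain i where "i < k" "f i \<noteq> c (x i)" by (auto simp: f0_def)
      then have "\<exists>i\<in>{..<k}. indicator (cell c (f i)) (x i) = (0::real)"
        by (auto simp: cell_def indicator_def intro!: bexI[of _ i])
      then show ?thesis using False prod_zero[of "{..<k}"] by simp
    qed
    then have "(\<Sum>f\<in>?F. ?g f * (\<Prod>i<k. indicator (cell c (f i)) (x i))) = (\<Sum>f\<in>?F. if f = f0 then ?g f else 0)"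
      by (intro sum.cong) auto
    also have "\<dots> = ?g f0" using f0 F by simp
    also have "\<dots> = edge_prod k (\<lambda>e z. \<phi> e (c (fst z)) (c (snd z))) x"
      unfolding edge_prod_def by (intro prod.cong refl) (auto simp: f0_def dest: edges_less)
    finally show "edge_prod k (\<lambda>e z. \<phi> e (c (fst z)) (c (snd z))) x
      = (\<Sum>f\<in>?F. ?g f * (\<Prod>i<k. indicator (cell c (f i)) (x i)))" by simp
  qed
  also have "\<dots> = (\<Sum>f\<in>?F. ?g f * (\<integral>x. (\<Prod>i<k. indicator (cell c (f i)) (x i)) \<partial>?P))"
    using PS.product_integrable_prod[of "{..<k}" "\<lambda>i. indicator (cell c (_ i))"] ii
    by (subst Bochner_Integration.integral_sum) (auto intro!: integrable_mult_right PS.product_integrable_prod)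
  also have "\<dots> = (\<Sum>f\<in>?F. ?g f * (\<Prod>i<k. prob (cell c (f i))))"
    using cell_sets[OF c] by (subst PS.product_integral_prod) (auto intro: ii)
  finally show ?thesis .
qed

end

section \<open>Refinements for a sequence of kernel trees\<close>

locale tree_kernels = prob_space M for M :: "'a measure" +
  fixes U :: "nat \<Rightarrow> bool list \<Rightarrow> 'a \<times> 'a \<Rightarrow> real"
  assumes U_kernel: "unit_kernel M (U n w)"
    and U_sym: "symmetric_kernel (U n w)"
    and U_tree: "z \<in> space (M \<Otimes>\<^sub>M M) \<Longrightarrow> tree_mass (\<lambda>w. U n w z)"
begin

text \<open>The first component of the pairing enumeration takes every value infinitely often.
  Repetition matters because a kernel is well approximated only at a late step devoted to it, when
  energy increments have become small.\<close>

definition schedule :: "nat \<Rightarrow> bool list" where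
  "schedule j = from_nat (fst (prod_decode j))"

lemma schedule_infinite: "\<exists>j\<ge>N. schedule j = w"
proof (intro exI conjI)
  show "schedule (prod_encode (to_nat w, N)) = w" by (simp add: schedule_def)
  show "N \<le> prod_encode (to_nat w, N)" by (rule le_prod_encode_2)
qed

definition c :: "nat \<Rightarrow> nat \<Rightarrow> 'a \<Rightarrow> bool list" where
  "c n = refinement (\<lambda>j. U n (schedule j))"

definition cmass :: "nat \<Rightarrow> bool list \<Rightarrow> real" where
  "cmass n s = prob (cell (c n (length s)) s)"

text \<open>Intended for words of equal length; the level of the coloring is read off from
  \<open>s\<close>. It is kept unnormalized, since the quotient by the cell masses may fail to
  converge where these tend to 0.\<close>

definition cint :: "nat \<Rightarrow> bool list \<Rightarrow> bool list \<Rightarrow> bool list \<Rightarrow> real" where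
  "cint n w s t = cell_int (c n (length s)) (U n w) s t"

lemma c_coloring: "coloring j (c n j)"
  unfolding c_def by (intro refinement_coloring U_kernel)

lemma c_take: "i \<le> j \<Longrightarrow> x \<in> space M \<Longrightarrow> c n i x = take i (c n j x)"
  unfolding c_def by (intro refinement_take U_kernel)

lemma c_cut_bound:
  "cut_bound (\<lambda>z. U n (schedule j) z - step (c n j) (U n (schedule j)) z)
    (4 * sqrt (energy (c n (Suc j)) (U n (schedule j)) - energy (c n j) (U n (schedule j))))"
  unfolding c_def using refinement_cut_bound[of "\<lambda>j. U n (schedule j)" j] U_kernel U_sym by blast

lemma cmass_tree: "tree_mass (cmass n)"
  unfolding tree_mass_def
proof (intro conjI allI)
  have "cell (c n 0) [] = space M" using c_coloring[of 0 n] by (auto simp: cell_def coloring_def)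
  then show "cmass n [] = 1" by (simp add: cmass_def prob_space)
  fix s
  show "0 \<le> cmass n s" by (simp add: cmass_def)
  let ?j = "length s"
  have l: "length (c n (Suc ?j) x) = Suc ?j" if "x \<in> space M" for x
    using c_coloring[of "Suc ?j" n] that by (simp add: coloring_def)
  have "take ?j v = s \<longleftrightarrow> v = s @ [False] \<or> v = s @ [True]" if "length v = Suc ?j" for v :: "bool list"
    using that by (cases v rule: rev_cases) auto
  then have "cell (c n ?j) s = cell (c n (Suc ?j)) (s @ [False]) \<union> cell (c n (Suc ?j)) (s @ [True])"
    using c_take[of ?j "Suc ?j" _ n] l by (auto simp: cell_def)
  moreover have "cell (c n (Suc ?j)) (s @ [False]) \<inter> cell (c n (Suc ?j)) (s @ [True]) = {}"
    by (auto simp: cell_def)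
  ultimately show "cmass n s = cmass n (s @ [False]) + cmass n (s @ [True])"
    unfolding cmass_def using cell_sets[OF c_coloring] by (simp add: finite_measure_Union)
qed

lemma cint_bounds:
  assumes "length s = length t"
  shows "0 \<le> cint n w s t" "cint n w s t \<le> cmass n s * cmass n t"
  using cell_int_bounds[OF c_coloring[of "length s" n] U_kernel[of n w], of s t] assms
  by (auto simp: cint_def cmass_def)

lemma cint_le_1: "length s = length t \<Longrightarrow> cint n w s t \<le> 1"
  using cint_bounds(2)[of s t n w] by (simp add: cmass_def) (metis mult_le_one order_trans prob_le_1 measure_nonneg)

lemma cint_tree:
  assumes "length s = length t"
  shows "cint n [] s t = cmass n s * cmass n t"
    "cint n w s t = cint n (w @ [False]) s t + cint n (w @ [True]) s t"
proof -
  let ?c = "c n (length s)"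
  note cs = cell_sets[OF c_coloring[of "length s" n]]
  have "cint n [] s t = cell_int ?c (\<lambda>_. 1) s t"
    unfolding cint_def cell_int_def using tree_massD(1)[OF U_tree]
    by (intro Bochner_Integration.integral_cong) auto
  then show "cint n [] s t = cmass n s * cmass n t"
    using cell_int_one[OF c_coloring[of "length s" n], of s t] assms by (simp add: cmass_def)
  have i: "integrable (M \<Otimes>\<^sub>M M) (\<lambda>z. U n w z * indicator (cell ?c s) (fst z) * indicator (cell ?c t) (snd z))" for w
    by (intro integrable_kernel bounded_kernel_indicator unit_imp_bounded_kernel U_kernel cs)
  have "cint n w s t = (\<integral>z. U n (w @ [False]) z * indicator (cell ?c s) (fst z) * indicator (cell ?c t) (snd z)
      + U n (w @ [True]) z * indicator (cell ?c s) (fst z) * indicator (cell ?c t) (snd z) \<partial>(M \<Otimes>\<^sub>M M))"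
    unfolding cint_def cell_int_def
  proof (intro Bochner_Integration.integral_cong refl)
    fix z assume "z \<in> space (M \<Otimes>\<^sub>M M)"
    from tree_massD(3)[OF U_tree[OF this], of n w]
    show "U n w z * indicator (cell ?c s) (fst z) * indicator (cell ?c t) (snd z)
      = U n (w @ [False]) z * indicator (cell ?c s) (fst z) * indicator (cell ?c t) (snd z)
      + U n (w @ [True]) z * indicator (cell ?c s) (fst z) * indicator (cell ?c t) (snd z)"
      by (simp add: algebra_simps)
  qed
  also have "\<dots> = cint n (w @ [False]) s t + cint n (w @ [True]) s t"
    unfolding cint_def cell_int_def by (intro Bochner_Integration.integral_add i)
  finally show "cint n w s t = cint n (w @ [False]) s t + cint n (w @ [True]) s t" .
qed

lemma cint_sym: "length s = length t \<Longrightarrow> cint n w s t = cint n w t s"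
  unfolding cint_def
  using step_symmetric(1)[OF c_coloring unit_imp_bounded_kernel[OF U_kernel] U_sym] by simp

lemma cint_zero:
  assumes "\<And>z. z \<in> space (M \<Otimes>\<^sub>M M) \<Longrightarrow> U n w z = 0"
  shows "cint n w s t = 0"
proof -
  have "cint n w s t = (\<integral>z. 0 \<partial>(M \<Otimes>\<^sub>M M))"
    unfolding cint_def cell_int_def using assms by (intro Bochner_Integration.integral_cong) auto
  then show ?thesis by simp
qed

definition cdens :: "nat \<Rightarrow> bool list \<Rightarrow> bool list \<Rightarrow> bool list \<Rightarrow> real" where
  "cdens n w s t = cint n w s t / (cmass n s * cmass n t)"

lemma cdens_bounds:
  assumes "length s = length t"
  shows "0 \<le> cdens n w s t" "cdens n w s t \<le> 1"
  using cint_bounds[OF assms, of n w] tree_massD(2)[OF cmass_tree, of n]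
  by (auto simp: cdens_def divide_le_eq_1 less_le)

lemma step_eq_cdens:
  assumes "z \<in> space (M \<Otimes>\<^sub>M M)"
  shows "step (c n j) (U n w) z = cdens n w (c n j (fst z)) (c n j (snd z))"
  using assms c_coloring[of j n]
  by (simp add: step_def cdens_def cint_def cmass_def coloring_def space_pair_measure mem_Times_iff)

end

section \<open>L1-Cauchy families and their limits\<close>

context prob_space
begin

text \<open>Along a rapidly Cauchy subsequence the successive differences have summable L1 norms, so
  they are summable almost everywhere. A diagonal choice of \<open>r\<close> serves all of the
  countably many indices at once.\<close>

lemma L1_Cauchy_AE_convergent_subsequence:
  fixes f :: "nat \<Rightarrow> 'i::countable \<Rightarrow> 'a \<Rightarrow> real"
  assumes f: "\<And>j w. integrable M (f j w)"
    and Cauchy: "\<And>w e. 0 < e \<Longrightarrow> \<exists>N. \<forall>j\<ge>N. \<forall>l\<ge>N. (\<integral>x. \<bar>f l w x - f j w x\<bar> \<partial>M) \<le> e"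
  shows "\<exists>r :: nat \<Rightarrow> nat. (\<forall>i. i \<le> r i) \<and> (AE x in M. \<forall>w. convergent (\<lambda>i. f (r i) w x))"
proof -
  have "\<exists>N. \<forall>j\<ge>N. \<forall>l\<ge>N. (\<integral>x. \<bar>f l (from_nat m) x - f j (from_nat m) x\<bar> \<partial>M) \<le> (1/2) ^ i" for m i :: nat
    by (rule Cauchy) simp
  then obtain N where N: "\<And>m i j l. N m i \<le> j \<Longrightarrow> N m i \<le> l \<Longrightarrow>
      (\<integral>x. \<bar>f l (from_nat m) x - f j (from_nat m) x\<bar> \<partial>M) \<le> (1/2) ^ i" for m i :: nat
    by metis
  \<comment> \<open>The double sum keeps \<open>r\<close> monotone and beyond every threshold
    \<open>N m i\<close> with \<open>m \<le> i\<close>; a given index \<open>m\<close> is covered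
    from stage \<open>m\<close> on, hence the shift by \<open>?m\<close> below.\<close>
  define r where "r i = i + (\<Sum>i'\<le>i. \<Sum>m\<le>i'. N m i')" for i
  have rN: "N m i \<le> r i" if "m \<le> i" for m i
  proof -
    have "N m i \<le> (\<Sum>m\<le>i. N m i)" using that by (intro member_le_sum) auto
    also have "\<dots> \<le> (\<Sum>i'\<le>i. \<Sum>m\<le>i'. N m i')" by (rule member_le_sum) auto
    finally show ?thesis by (simp add: r_def)
  qed
  have "AE x in M. convergent (\<lambda>i. f (r i) w x)" for w
  proof -
    let ?m = "to_nat w"
    define g where "g i x = \<bar>f (r (Suc i + ?m)) w x - f (r (i + ?m)) w x\<bar>" for i x
    have g: "integrable M (g i)" "0 \<le> g i x" for i x using f by (auto simp: g_def[abs_def])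
    have r: "r i \<le> r (Suc i)" for i by (simp add: r_def)
    have gi: "(\<integral>x. g i x \<partial>M) \<le> (1/2) ^ i" for i
    proof -
      have "(\<integral>x. g i x \<partial>M) \<le> (1/2) ^ (i + ?m)"
        using N[of ?m "i + ?m" "r (i + ?m)" "r (Suc i + ?m)"] rN[of ?m "i + ?m"] r[of "i + ?m"]
        by (simp add: g_def)
      also have "\<dots> \<le> (1/2) ^ i" by (rule power_decreasing) auto
      finally show ?thesis .
    qed
    have "(\<integral>\<^sup>+x. (\<Sum>i. ennreal (g i x)) \<partial>M) = (\<Sum>i. \<integral>\<^sup>+x. ennreal (g i x) \<partial>M)"
      using borel_measurable_integrable[OF g(1)] by (intro nn_integral_suminf) measurable
    also have "\<dots> = (\<Sum>i. ennreal (\<integral>x. g i x \<partial>M))"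
      using g by (simp add: nn_integral_eq_integral)
    also have "\<dots> \<le> (\<Sum>i. ennreal ((1/2) ^ i))"
      by (intro suminf_le ennreal_leI gi) auto
    also have "\<dots> = ennreal (\<Sum>i. (1/2) ^ i)"
      by (intro suminf_ennreal2 summable_geometric) auto
    finally have "(\<integral>\<^sup>+x. (\<Sum>i. ennreal (g i x)) \<partial>M) \<noteq> \<infinity>" by (auto simp: top_unique)
    then have "AE x in M. (\<Sum>i. ennreal (g i x)) \<noteq> \<infinity>"
      using g by (intro nn_integral_PInf_AE) auto
    then show ?thesis
    proof (rule AE_mp, intro AE_I2 impI)
      fix x assume "(\<Sum>i. ennreal (g i x)) \<noteq> \<infinity>"
      then have "summable (\<lambda>i. g i x)" using g(2) by (intro summable_suminf_not_top) auto
      then have "summable (\<lambda>i. f (r (Suc i + ?m)) w x - f (r (i + ?m)) w x)"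
        unfolding g_def by (rule summable_rabs_cancel)
      then have "convergent (\<lambda>n. \<Sum>i<n. f (r (Suc i + ?m)) w x - f (r (i + ?m)) w x)"
        by (simp add: summable_iff_convergent)
      moreover have "(\<Sum>i<n. f (r (Suc i + ?m)) w x - f (r (i + ?m)) w x) = f (r (n + ?m)) w x - f (r ?m) w x" for n
        using sum_lessThan_telescope[of "\<lambda>i. f (r (i + ?m)) w x" n] by simp
      ultimately have "convergent (\<lambda>n. f (r (n + ?m)) w x - f (r ?m) w x)" by simp
      then have "convergent (\<lambda>n. f (r (n + ?m)) w x)" by (simp add: convergent_diff_const_right_iff)
      then show "convergent (\<lambda>i. f (r i) w x)" by (rule convergent_ignore_initial_segment[THEN iffD1])
    qed
  qed
  then have "AE x in M. \<forall>w. convergent (\<lambda>i. f (r i) w x)" by (simp add: AE_all_countable)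
  then show ?thesis by (intro exI[of _ r]) (simp add: r_def)
qed

text \<open>Along \<open>r\<close> dominated convergence applies, with bound 2 for a difference of
  functions bounded by 1; the Cauchy property carries the conclusion to all
  \<open>j\<close>.\<close>

lemma L1_Cauchy_tendsto:
  fixes f :: "nat \<Rightarrow> 'a \<Rightarrow> real"
  assumes f: "\<And>j. f j \<in> borel_measurable M" "\<And>j x. x \<in> space M \<Longrightarrow> \<bar>f j x\<bar> \<le> 1"
    and g: "g \<in> borel_measurable M" "\<And>x. x \<in> space M \<Longrightarrow> \<bar>g x\<bar> \<le> 1"
    and Cauchy: "\<And>e. 0 < e \<Longrightarrow> \<exists>N. \<forall>j\<ge>N. \<forall>l\<ge>N. (\<integral>x. \<bar>f l x - f j x\<bar> \<partial>M) \<le> e"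
    and r: "\<And>i. i \<le> (r i :: nat)" and lim: "AE x in M. (\<lambda>i. f (r i) x) \<longlonglongrightarrow> g x"
  shows "(\<lambda>j. \<integral>x. \<bar>f j x - g x\<bar> \<partial>M) \<longlonglongrightarrow> 0"
proof (rule LIMSEQ_I)
  have int: "integrable M (f j)" "integrable M g" for j
    using f g by (auto intro!: integrable_const_bound[where B = 1])
  fix e :: real assume e: "0 < e"
  obtain N where N: "\<And>j l. N \<le> j \<Longrightarrow> N \<le> l \<Longrightarrow> (\<integral>x. \<bar>f l x - f j x\<bar> \<partial>M) \<le> e / 3"
    using Cauchy[of "e / 3"] e by auto
  have "(\<lambda>i. \<integral>x. \<bar>f (r i) x - g x\<bar> \<partial>M) \<longlonglongrightarrow> (\<integral>x. 0 \<partial>M)"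
  proof (rule integral_dominated_convergence[where w = "\<lambda>_. 2"])
    show "AE x in M. (\<lambda>i. \<bar>f (r i) x - g x\<bar>) \<longlonglongrightarrow> 0"
      using lim by (rule AE_mp) (auto intro!: AE_I2 tendsto_rabs_zero simp: LIM_zero)
    show "AE x in M. norm \<bar>f (r i) x - g x\<bar> \<le> 2" for i
    proof (rule AE_I2)
      fix x assume "x \<in> space M"
      then show "norm \<bar>f (r i) x - g x\<bar> \<le> 2" using f(2)[of x "r i"] g(2)[of x] by auto
    qed
  qed (use f g in auto)
  then have "\<forall>\<^sub>F i in sequentially. (\<integral>x. \<bar>f (r i) x - g x\<bar> \<partial>M) < e / 3"
    using e by (intro order_tendstoD(2)[of _ 0]) auto
  then obtain i0 where "\<And>i. i0 \<le> i \<Longrightarrow> (\<integral>x. \<bar>f (r i) x - g x\<bar> \<partial>M) < e / 3"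
    unfolding eventually_sequentially by blast
  then obtain i where i: "N \<le> i" "(\<integral>x. \<bar>f (r i) x - g x\<bar> \<partial>M) < e / 3"
    by (meson nle_le order_refl max.cobounded1 max.cobounded2)
  have "norm ((\<integral>x. \<bar>f j x - g x\<bar> \<partial>M) - 0) < e" if j: "N \<le> j" for j
  proof -
    have "(\<integral>x. \<bar>f j x - g x\<bar> \<partial>M) \<le> (\<integral>x. \<bar>f j x - f (r i) x\<bar> + \<bar>f (r i) x - g x\<bar> \<partial>M)"
      by (intro integral_mono Bochner_Integration.integrable_add integrable_abs Bochner_Integration.integrable_diff int) auto
    also have "\<dots> = (\<integral>x. \<bar>f j x - f (r i) x\<bar> \<partial>M) + (\<integral>x. \<bar>f (r i) x - g x\<bar> \<partial>M)"
      by (intro Bochner_Integration.integral_add) (auto intro!: int)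
    also have "\<dots> < e" using N[of "r i" j] j i r[of i] e by linarith
    finally show ?thesis by simp
  qed
  then show "\<exists>no. \<forall>n\<ge>no. norm ((\<integral>x. \<bar>f n x - g x\<bar> \<partial>M) - 0) < e" by blast
qed

text \<open>Weights with values in [0,1] can only shrink the absolute value of \<open>D\<close>;
  this is how L1 convergence enters the counting lemma.\<close>

lemma cut_bound_L1:
  assumes D: "bounded_kernel M D" and d: "(\<integral>z. \<bar>D z\<bar> \<partial>(M \<Otimes>\<^sub>M M)) \<le> d"
  shows "cut_bound D d"
  unfolding cut_bound_def
proof (intro allI impI)
  fix a b :: "'a \<Rightarrow> real"
  assume ab: "a \<in> borel_measurable M" "b \<in> borel_measurable M"
    "\<forall>x\<in>space M. 0 \<le> a x \<and> a x \<le> 1" "\<forall>x\<in>space M. 0 \<le> b x \<and> b x \<le> 1"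
  have i: "integrable (M \<Otimes>\<^sub>M M) (\<lambda>z. D z * a (fst z) * b (snd z))"
    using ab by (intro integrable_kernel bounded_kernel_fst_snd D) auto
  have "\<bar>\<integral>z. D z * a (fst z) * b (snd z) \<partial>(M \<Otimes>\<^sub>M M)\<bar> \<le> (\<integral>z. \<bar>D z * a (fst z) * b (snd z)\<bar> \<partial>(M \<Otimes>\<^sub>M M))"
    by (rule integral_abs_bound)
  also have "\<dots> \<le> (\<integral>z. \<bar>D z\<bar> \<partial>(M \<Otimes>\<^sub>M M))"
  proof (intro integral_mono integrable_abs i integrable_kernel D)
    fix z assume "z \<in> space (M \<Otimes>\<^sub>M M)"
    then have z: "0 \<le> a (fst z) \<and> a (fst z) \<le> 1" "0 \<le> b (snd z) \<and> b (snd z) \<le> 1"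
      using ab by (auto simp: space_pair_measure)
    then have "\<bar>D z\<bar> * (a (fst z) * b (snd z)) \<le> \<bar>D z\<bar> * 1"
      by (intro mult_left_mono mult_le_one) auto
    then show "\<bar>D z * a (fst z) * b (snd z)\<bar> \<le> \<bar>D z\<bar>"
      using z by (simp add: abs_mult mult.assoc)
  qed
  finally show "\<bar>\<integral>z. D z * a (fst z) * b (snd z) \<partial>(M \<Otimes>\<^sub>M M)\<bar> \<le> d" using d by linarith
qed

end

text \<open>Made for averages over cells: where the mass \<open>x0\<close> vanishes in the limit,
  the quotient \<open>g\<close> may fail to converge, but being bounded it is absorbed by the factor
  \<open>x\<close>.\<close>

lemma bounded_mult_tendsto:
  fixes g x :: "nat \<Rightarrow> real"
  assumes g: "\<And>n. \<bar>g n\<bar> \<le> 1" and x: "x \<longlonglongrightarrow> x0" and gg: "x0 \<noteq> 0 \<Longrightarrow> g \<longlonglongrightarrow> g0"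
  shows "(\<lambda>n. g n * x n) \<longlonglongrightarrow> g0 * x0"
proof (cases "x0 = 0")
  case True
  have "(\<lambda>n. g n * x n) \<longlonglongrightarrow> 0"
  proof (rule Lim_null_comparison[OF always_eventually])
    show "\<forall>n. norm (g n * x n) \<le> \<bar>x n\<bar>"
      using mult_right_mono[OF g abs_ge_zero] by (simp add: abs_mult)
    show "(\<lambda>n. \<bar>x n\<bar>) \<longlonglongrightarrow> 0" using x True tendsto_rabs_zero by blast
  qed
  then show ?thesis using True by simp
qed (use x gg in \<open>auto intro: tendsto_mult\<close>)

interpretation L: prob_space unit_interval
  by (rule prob_space_unit_interval)

section \<open>Limits of masses, step kernels and densities\<close>

locale tree_kernels_limit = tree_kernels M U for M :: "'a measure" and U +
  fixes p :: "bool list \<Rightarrow> real" and q :: "bool list \<Rightarrow> bool list \<Rightarrow> bool list \<Rightarrow> real"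
  assumes cmass_tendsto: "(\<lambda>n. cmass n s) \<longlonglongrightarrow> p s"
    and cint_tendsto: "length s = length t \<Longrightarrow> (\<lambda>n. cint n w s t) \<longlonglongrightarrow> q w s t"
begin

lemma p_tree: "tree_mass p"
  unfolding tree_mass_def
proof (intro conjI allI)
  show "p [] = 1"
    using LIMSEQ_unique[OF cmass_tendsto[of "[]"]] tree_massD(1)[OF cmass_tree] by simp
  fix s
  show "0 \<le> p s"
    by (rule LIMSEQ_le_const[OF cmass_tendsto]) (use tree_massD(2)[OF cmass_tree] in blast)
  have "(\<lambda>n. cmass n s) \<longlonglongrightarrow> p (s @ [False]) + p (s @ [True])"
    using tendsto_add[OF cmass_tendsto[of "s @ [False]"] cmass_tendsto[of "s @ [True]"]]
    by (simp flip: tree_massD(3)[OF cmass_tree])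
  then show "p s = p (s @ [False]) + p (s @ [True])" by (rule LIMSEQ_unique[OF cmass_tendsto])
qed

lemma q_bounds:
  assumes l: "length s = length t"
  shows "0 \<le> q w s t" "q w s t \<le> p s * p t"
proof -
  show "0 \<le> q w s t"
    by (rule LIMSEQ_le_const[OF cint_tendsto[OF l]]) (use cint_bounds(1)[OF l] in blast)
  show "q w s t \<le> p s * p t"
    by (rule LIMSEQ_le[OF cint_tendsto[OF l] tendsto_mult[OF cmass_tendsto cmass_tendsto]])
      (use cint_bounds(2)[OF l] in blast)
qed

lemma q_tree:
  assumes l: "length s = length t"
  shows "q [] s t = p s * p t" "q w s t = q (w @ [False]) s t + q (w @ [True]) s t"
proof -
  show "q [] s t = p s * p t"
    using LIMSEQ_unique[OF cint_tendsto[OF l, of "[]"]] tendsto_mult[OF cmass_tendsto[of s] cmass_tendsto[of t]]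
    by (simp add: cint_tree(1)[OF l])
  have "(\<lambda>n. cint n w s t) \<longlonglongrightarrow> q (w @ [False]) s t + q (w @ [True]) s t"
    using tendsto_add[OF cint_tendsto[OF l, of "w @ [False]"] cint_tendsto[OF l, of "w @ [True]"]]
    by (simp flip: cint_tree(2)[OF l])
  then show "q w s t = q (w @ [False]) s t + q (w @ [True]) s t" by (rule LIMSEQ_unique[OF cint_tendsto[OF l]])
qed

lemma q_sym:
  assumes l: "length s = length t"
  shows "q w s t = q w t s"
  using LIMSEQ_unique[OF cint_tendsto[OF l, of w]] cint_tendsto[OF l[symmetric], of w]
  by (simp add: cint_sym[OF l])

definition ldens :: "bool list \<Rightarrow> bool list \<Rightarrow> bool list \<Rightarrow> real" where
  "ldens w s t = q w s t / (p s * p t)"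

lemma ldens_bounds:
  assumes "length s = length t"
  shows "0 \<le> ldens w s t" "ldens w s t \<le> 1"
  using q_bounds[OF assms, of w] tree_massD(2)[OF p_tree]
  by (auto simp: ldens_def divide_le_eq_1 less_le)

lemma cdens_tendsto:
  assumes "length s = length t" "p s * p t \<noteq> 0"
  shows "(\<lambda>n. cdens n w s t) \<longlonglongrightarrow> ldens w s t"
  unfolding cdens_def ldens_def using assms
  by (intro tendsto_divide tendsto_mult cmass_tendsto cint_tendsto) auto

text \<open>A point \<open>x\<close> of [0,1] receives the color \<open>word_path p x j\<close>, so
  that the word \<open>s\<close> occupies an interval of length \<open>p s\<close>. Then
  \<open>V j w\<close> is the limit of the step kernels at level \<open>j\<close>, transported to a
  common vertex space.\<close>

definition V :: "nat \<Rightarrow> bool list \<Rightarrow> real \<times> real \<Rightarrow> real" where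
  "V j w z = ldens w (word_path p (fst z) j) (word_path p (snd z) j)"

lemma path_coloring: "L.coloring j (\<lambda>x. word_path p x j)"
  unfolding L.coloring_def
  using path_measurable[of "\<lambda>_. p" unit_interval "\<lambda>u. u" j] by (simp add: measurable_restrict_space1)

lemma path_cell: "s \<in> words j \<Longrightarrow> L.prob (L.cell (\<lambda>x. word_path p x j) s) = p s"
  using measure_path[OF p_tree, of s] by (auto simp: L.cell_def words_def)

lemma V_kernel: "unit_kernel unit_interval (V j w)"
  unfolding unit_kernel_def V_def[abs_def]
  using bounded_kernel_measurable[OF L.color_kernel[OF path_coloring, of "ldens w"]] ldens_bounds by auto

lemma V_sym: "L.symmetric_kernel (V j w)"
  using q_sym by (auto simp: L.symmetric_kernel_def V_def ldens_def mult.commute)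

text \<open>True at every point because the words along a path have positive mass, so the quotients
  are genuine ones.\<close>

lemma V_tree:
  assumes z: "z \<in> space (unit_interval \<Otimes>\<^sub>M unit_interval)"
  shows "tree_mass (\<lambda>w. V j w z)"
proof -
  let ?s = "word_path p (fst z) j" and ?t = "word_path p (snd z) j"
  have l: "length ?s = length ?t" by simp
  have pos: "0 < p ?s" "0 < p ?t"
    using z by (auto intro!: path_pos[OF p_tree] simp: space_pair_measure)
  have "V j [] z = 1" using pos by (simp add: V_def ldens_def q_tree(1)[OF l])
  moreover have "V j w z = V j (w @ [False]) z + V j (w @ [True]) z" for w
    using q_tree(2)[OF l, of w] by (simp add: V_def ldens_def add_divide_distrib)
  moreover have "0 \<le> V j w z" for w using ldens_bounds(1)[OF l] by (simp add: V_def)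
  ultimately show ?thesis unfolding tree_mass_def by blast
qed

text \<open>Both sides are finite sums over pairs of words. Pairs of vanishing limit mass contribute
  nothing in the limit because the weights are bounded, so convergence of the weights is asked for
  only on the other pairs.\<close>

lemma color_sum_tendsto:
  fixes g :: "nat \<Rightarrow> bool list \<Rightarrow> bool list \<Rightarrow> real"
  assumes g: "\<And>n s t. s \<in> words j \<Longrightarrow> t \<in> words j \<Longrightarrow> \<bar>g n s t\<bar> \<le> 1"
    and lim: "\<And>s t. s \<in> words j \<Longrightarrow> t \<in> words j \<Longrightarrow> p s * p t \<noteq> 0 \<Longrightarrow> (\<lambda>n. g n s t) \<longlonglongrightarrow> g0 s t"
  shows "(\<lambda>n. \<integral>z. g n (c n j (fst z)) (c n j (snd z)) \<partial>(M \<Otimes>\<^sub>M M))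
    \<longlonglongrightarrow> (\<integral>z. g0 (word_path p (fst z) j) (word_path p (snd z) j) \<partial>(unit_interval \<Otimes>\<^sub>M unit_interval))"
proof -
  have "(\<lambda>n. \<Sum>s\<in>words j. \<Sum>t\<in>words j. g n s t * (cmass n s * cmass n t))
    \<longlonglongrightarrow> (\<Sum>s\<in>words j. \<Sum>t\<in>words j. g0 s t * (p s * p t))"
    using g lim by (intro tendsto_sum bounded_mult_tendsto tendsto_mult cmass_tendsto) auto
  moreover have "(\<Sum>s\<in>words j. \<Sum>t\<in>words j. g n s t * (cmass n s * cmass n t))
    = (\<Sum>s\<in>words j. \<Sum>t\<in>words j. g n s t * (prob (cell (c n j) s) * prob (cell (c n j) t)))" for n
    by (intro sum.cong refl) (simp add: cmass_def words_def)
  moreover have "(\<Sum>s\<in>words j. \<Sum>t\<in>words j. g0 s t * (p s * p t)) = (\<Sum>s\<in>words j. \<Sum>t\<in>words j.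
      g0 s t * (L.prob (L.cell (\<lambda>x. word_path p x j) s) * L.prob (L.cell (\<lambda>x. word_path p x j) t)))"
    by (intro sum.cong refl) (simp add: path_cell)
  ultimately show ?thesis
    by (simp add: integral_color_prob[OF c_coloring] L.integral_color_prob[OF path_coloring])
qed

definition lenergy :: "nat \<Rightarrow> bool list \<Rightarrow> real" where
  "lenergy j w = (\<integral>z. (V j w z)\<^sup>2 \<partial>(unit_interval \<Otimes>\<^sub>M unit_interval))"

lemma words_length: "s \<in> words j \<Longrightarrow> t \<in> words j \<Longrightarrow> length (take i s) = length (take i t)"
  by (simp add: words_def)

lemma energy_tendsto: "(\<lambda>n. energy (c n j) (U n w)) \<longlonglongrightarrow> lenergy j w"
proof -
  have "energy (c n j) (U n w) = (\<integral>z. (cdens n w (c n j (fst z)) (c n j (snd z)))\<^sup>2 \<partial>(M \<Otimes>\<^sub>M M))" for n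
    unfolding energy_def by (intro Bochner_Integration.integral_cong refl) (simp add: step_eq_cdens)
  moreover have "(\<lambda>n. \<integral>z. (cdens n w (c n j (fst z)) (c n j (snd z)))\<^sup>2 \<partial>(M \<Otimes>\<^sub>M M)) \<longlonglongrightarrow> lenergy j w"
    unfolding lenergy_def V_def
  proof (rule color_sum_tendsto)
    fix s t assume "s \<in> words j" "t \<in> words j"
    then have l: "length s = length t" by (simp add: words_def)
    show "\<bar>(cdens n w s t)\<^sup>2\<bar> \<le> 1" for n using cdens_bounds[OF l, of n w] by (simp add: power_le_one)
    show "(\<lambda>n. (cdens n w s t)\<^sup>2) \<longlonglongrightarrow> (ldens w s t)\<^sup>2" if "p s * p t \<noteq> 0"
      by (intro tendsto_power cdens_tendsto l that)
  qed
  ultimately show ?thesis by simp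
qed

text \<open>Obtained as the limit of the Pythagorean identity for the colorings of \<open>M\<close>:
  at this point the \<open>V j w\<close> are not known to arise by averaging a single kernel on
  [0,1].\<close>

lemma lenergy_increment:
  assumes "j \<le> l"
  shows "(\<integral>z. (V l w z - V j w z)\<^sup>2 \<partial>(unit_interval \<Otimes>\<^sub>M unit_interval)) = lenergy l w - lenergy j w"
proof -
  let ?g = "\<lambda>n s t. (cdens n w s t - cdens n w (take j s) (take j t))\<^sup>2"
  let ?h = "\<lambda>s t. (ldens w s t - ldens w (take j s) (take j t))\<^sup>2"
  have "(\<lambda>n. \<integral>z. ?g n (c n l (fst z)) (c n l (snd z)) \<partial>(M \<Otimes>\<^sub>M M))
    \<longlonglongrightarrow> (\<integral>z. ?h (word_path p (fst z) l) (word_path p (snd z) l) \<partial>(unit_interval \<Otimes>\<^sub>M unit_interval))"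
  proof (rule color_sum_tendsto)
    fix s t assume st: "s \<in> words l" "t \<in> words l"
    then have le: "length s = length t" by (simp add: words_def)
    note le' = words_length[OF st, of j]
    show "\<bar>?g n s t\<bar> \<le> 1" for n
    proof -
      have "\<bar>cdens n w s t - cdens n w (take j s) (take j t)\<bar> \<le> 1"
        using cdens_bounds[OF le, of n w] cdens_bounds[OF le', of n w] by linarith
      then show ?thesis by (simp add: abs_square_le_1)
    qed
    assume "p s * p t \<noteq> 0"
    moreover have "p s \<le> p (take j s)" "p t \<le> p (take j t)" "0 \<le> p s" "0 \<le> p t"
      using tree_mass_take_ge[OF p_tree] tree_massD(2)[OF p_tree] by auto
    ultimately have "p (take j s) * p (take j t) \<noteq> 0" by auto
    then show "(\<lambda>n. ?g n s t) \<longlonglongrightarrow> ?h s t"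
      using \<open>p s * p t \<noteq> 0\<close> le le' by (intro tendsto_power tendsto_diff cdens_tendsto) auto
  qed
  moreover have "(\<integral>z. ?h (word_path p (fst z) l) (word_path p (snd z) l) \<partial>(unit_interval \<Otimes>\<^sub>M unit_interval))
    = (\<integral>z. (V l w z - V j w z)\<^sup>2 \<partial>(unit_interval \<Otimes>\<^sub>M unit_interval))"
    using assms by (simp add: V_def take_path)
  moreover have "(\<integral>z. ?g n (c n l (fst z)) (c n l (snd z)) \<partial>(M \<Otimes>\<^sub>M M)) = energy (c n l) (U n w) - energy (c n j) (U n w)" for n
  proof -
    have "(\<integral>z. ?g n (c n l (fst z)) (c n l (snd z)) \<partial>(M \<Otimes>\<^sub>M M))
      = (\<integral>z. (step (c n l) (U n w) z - step (c n j) (U n w) z)\<^sup>2 \<partial>(M \<Otimes>\<^sub>M M))"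
      by (intro Bochner_Integration.integral_cong refl)
        (auto simp: step_eq_cdens c_take[OF assms] space_pair_measure)
    also have "\<dots> = energy (c n l) (U n w) - energy (c n j) (U n w)"
      by (rule energy_increment[OF c_coloring c_coloring _ U_kernel]) (rule c_take[OF assms])
    finally show ?thesis .
  qed
  ultimately show ?thesis
    using LIMSEQ_unique tendsto_diff[OF energy_tendsto[of l w] energy_tendsto[of j w]] by auto
qed

lemma V_L1_le:
  assumes "j \<le> l"
  shows "(\<integral>z. \<bar>V l w z - V j w z\<bar> \<partial>(unit_interval \<Otimes>\<^sub>M unit_interval)) \<le> sqrt (lenergy l w - lenergy j w)"
proof -
  let ?L2 = "unit_interval \<Otimes>\<^sub>M unit_interval"
  interpret L2: prob_space ?L2 by (rule L.pair_prob)
  have b: "bounded_kernel unit_interval (\<lambda>z. V l w z - V j w z)"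
    by (intro bounded_kernel_diff unit_imp_bounded_kernel V_kernel)
  have "(\<integral>z. \<bar>V l w z - V j w z\<bar> \<partial>?L2)\<^sup>2 \<le> (\<integral>z. \<bar>V l w z - V j w z\<bar>\<^sup>2 \<partial>?L2)"
    using L.integrable_kernel[OF b] L.integrable_kernel[OF bounded_kernel_mult[OF b b]]
    by (intro L2.square_integral_le) (auto simp: power2_eq_square)
  then have "(\<integral>z. \<bar>V l w z - V j w z\<bar> \<partial>?L2)\<^sup>2 \<le> lenergy l w - lenergy j w"
    by (simp add: lenergy_increment[OF assms])
  then show ?thesis by (rule real_le_rsqrt)
qed

lemma lenergy_convergent: "convergent (\<lambda>j. lenergy j w)"
proof (rule Bseq_mono_convergent)
  have "0 \<le> lenergy j w" for j by (simp add: lenergy_def)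
  moreover have "lenergy j w \<le> 1" for j
    by (rule LIMSEQ_le_const2[OF energy_tendsto]) (use energy_bounds(2)[OF c_coloring U_kernel] in blast)
  ultimately show "Bseq (\<lambda>j. lenergy j w)" by (intro BseqI'[of _ 1]) simp
  show "\<forall>m n. m \<le> n \<longrightarrow> lenergy m w \<le> lenergy n w"
  proof (intro allI impI)
    fix m n :: nat assume "m \<le> n"
    have "0 \<le> (\<integral>z. (V n w z - V m w z)\<^sup>2 \<partial>(unit_interval \<Otimes>\<^sub>M unit_interval))" by simp
    then show "lenergy m w \<le> lenergy n w" using lenergy_increment[OF \<open>m \<le> n\<close>, of w] by simp
  qed
qed

text \<open>Up to the factor 4 these are the limits in \<open>n\<close> of the cut bounds at a step
  \<open>j\<close> devoted to \<open>w\<close>; increments of a convergent sequence vanish.\<close>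

lemma lenergy_Suc_tendsto: "(\<lambda>j. sqrt (lenergy (Suc j) w - lenergy j w)) \<longlonglongrightarrow> 0"
proof -
  obtain a where a: "(\<lambda>j. lenergy j w) \<longlonglongrightarrow> a" using lenergy_convergent convergent_def by blast
  have "(\<lambda>j. sqrt (lenergy (Suc j) w - lenergy j w)) \<longlonglongrightarrow> sqrt (a - a)"
    by (intro tendsto_real_sqrt tendsto_diff a LIMSEQ_Suc)
  then show ?thesis by simp
qed

lemma V_L1_Cauchy:
  assumes "0 < e"
  shows "\<exists>N. \<forall>j\<ge>N. \<forall>l\<ge>N. (\<integral>z. \<bar>V l w z - V j w z\<bar> \<partial>(unit_interval \<Otimes>\<^sub>M unit_interval)) \<le> e"
proof -
  have "Cauchy (\<lambda>j. lenergy j w)" using lenergy_convergent by (simp add: Cauchy_convergent_iff)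
  then obtain N where N: "\<And>j l. N \<le> j \<Longrightarrow> N \<le> l \<Longrightarrow> \<bar>lenergy j w - lenergy l w\<bar> < e\<^sup>2"
    using assms unfolding Cauchy_def dist_real_def by (meson zero_less_power)
  have le: "(\<integral>z. \<bar>V l w z - V j w z\<bar> \<partial>(unit_interval \<Otimes>\<^sub>M unit_interval)) \<le> e" if "N \<le> j" "j \<le> l" for j l
  proof -
    have "lenergy l w - lenergy j w \<le> e\<^sup>2" using N[of j l] that by linarith
    then have "sqrt (lenergy l w - lenergy j w) \<le> sqrt (e\<^sup>2)" by (rule real_sqrt_le_mono)
    also have "\<dots> = e" using assms by simp
    finally show ?thesis using V_L1_le[OF that(2), of w] by linarith
  qed
  have "(\<integral>z. \<bar>V l w z - V j w z\<bar> \<partial>(unit_interval \<Otimes>\<^sub>M unit_interval)) \<le> e" if "N \<le> j" "N \<le> l" for j l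
    using le[of j l] le[of l j] that by (cases "j \<le> l") (auto simp: abs_minus_commute)
  then show ?thesis by blast
qed

text \<open>The tree \<open>d\<close> is a default value on the null set where the chosen
  subsequence of the \<open>V j\<close> does not converge, so that the limit is a tree at every
  point. The last clause serves words with empty cell: their kernels must vanish everywhere, so
  \<open>d\<close> has to vanish there as well.\<close>

lemma limit_kernel_exists:
  assumes d: "tree_mass d"
  shows "\<exists>W. (\<forall>w. unit_kernel unit_interval (W w) \<and> L.symmetric_kernel (W w)
      \<and> (\<lambda>j. \<integral>z. \<bar>V j w z - W w z\<bar> \<partial>(unit_interval \<Otimes>\<^sub>M unit_interval)) \<longlonglongrightarrow> 0)
    \<and> (\<forall>z\<in>space (unit_interval \<Otimes>\<^sub>M unit_interval). tree_mass (\<lambda>w. W w z))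
    \<and> (\<forall>w. d w = 0 \<longrightarrow> (\<forall>s t. q w s t = 0) \<longrightarrow> (\<forall>z. W w z = 0))"
proof -
  let ?L2 = "unit_interval \<Otimes>\<^sub>M unit_interval"
  interpret L2: prob_space ?L2 by (rule L.pair_prob)
  have "\<exists>r :: nat \<Rightarrow> nat. (\<forall>i. i \<le> r i) \<and> (AE z in ?L2. \<forall>w. convergent (\<lambda>i. V (r i) w z))"
    by (intro L2.L1_Cauchy_AE_convergent_subsequence L.integrable_kernel unit_imp_bounded_kernel V_kernel V_L1_Cauchy)
  then obtain r :: "nat \<Rightarrow> nat" where r: "\<And>i. i \<le> r i" and conv: "AE z in ?L2. \<forall>w. convergent (\<lambda>i. V (r i) w z)"
    by blast
  \<comment> \<open>The Cauchy condition amounts to countably many measurable ones. On the unit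
    square \<open>G\<close> is invariant under exchanging coordinates, as the \<open>V j\<close> are
    symmetric, so the default does not spoil symmetry.\<close>
  define G where "G z \<longleftrightarrow> (\<forall>w. Cauchy (\<lambda>i. V (r i) w z))" for z
  define W where "W w z = (if G z then lim (\<lambda>i. V (r i) w z) else d w)" for w z
  have lim: "(\<lambda>i. V (r i) w z) \<longlonglongrightarrow> W w z" if "G z" for w z
    using that by (simp add: G_def W_def Cauchy_convergent_iff convergent_LIMSEQ_iff)
  have Vm [measurable]: "V j w \<in> borel_measurable ?L2" for j w using V_kernel[of j w] by (simp add: unit_kernel_def)
  have tree: "tree_mass (\<lambda>w. W w z)" if z: "z \<in> space ?L2" for z
  proof (cases "G z")
    case True
    note lim = lim[OF True] and Vt = V_tree[OF z]
    show ?thesis unfolding tree_mass_def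
    proof (intro conjI allI)
      show "W [] z = 1" using LIMSEQ_unique[OF lim[of "[]"]] tree_massD(1)[OF Vt] by simp
      fix w
      show "0 \<le> W w z" by (rule LIMSEQ_le_const[OF lim]) (use tree_massD(2)[OF Vt] in blast)
      have "(\<lambda>i. V (r i) w z) \<longlonglongrightarrow> W (w @ [False]) z + W (w @ [True]) z"
        using tendsto_add[OF lim[of "w @ [False]"] lim[of "w @ [True]"]]
        by (simp flip: tree_massD(3)[OF Vt])
      then show "W w z = W (w @ [False]) z + W (w @ [True]) z" by (rule LIMSEQ_unique[OF lim])
    qed
  qed (simp add: W_def d)
  have le1: "W w z \<le> 1" if "z \<in> space ?L2" for w z
    using tree_mass_take_ge[OF tree[OF that], of w 0] tree_massD(1)[OF tree[OF that]] by simp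
  have Wm: "W w \<in> borel_measurable ?L2" for w
  proof -
    have [measurable]: "Measurable.pred ?L2 G" unfolding G_def[abs_def] by measurable
    show ?thesis unfolding W_def[abs_def] by measurable
  qed
  have unit: "unit_kernel unit_interval (W w)" for w
    unfolding unit_kernel_def using Wm le1 tree_massD(2)[OF tree] by blast
  have sym: "L.symmetric_kernel (W w)" for w
  proof -
    have "V j w (x, y) = V j w (y, x)" if "x \<in> {0..1}" "y \<in> {0..1}" for x y j w
      using V_sym[of j w] that by (simp add: L.symmetric_kernel_def)
    then show ?thesis by (simp add: L.symmetric_kernel_def W_def G_def)
  qed
  have L1: "(\<lambda>j. \<integral>z. \<bar>V j w z - W w z\<bar> \<partial>?L2) \<longlonglongrightarrow> 0" for w
  proof (rule L2.L1_Cauchy_tendsto[OF Vm _ Wm _ V_L1_Cauchy r])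
    show "\<bar>V j w z\<bar> \<le> 1" if "z \<in> space ?L2" for j z
      using V_kernel[of j w] that by (auto simp: unit_kernel_def)
    show "\<bar>W w z\<bar> \<le> 1" if "z \<in> space ?L2" for z
      using unit[of w] that by (auto simp: unit_kernel_def)
    show "AE z in ?L2. (\<lambda>i. V (r i) w z) \<longlonglongrightarrow> W w z"
      using conv by (rule AE_mp) (auto intro!: AE_I2 lim simp: G_def Cauchy_convergent_iff)
  qed
  have zero: "W w z = 0" if "d w = 0" "\<forall>s t. q w s t = 0" for w z
  proof -
    have "V j w z = 0" for j using that by (simp add: V_def ldens_def)
    then show ?thesis using lim[of z w] LIMSEQ_unique[OF _ tendsto_const] that by (cases "G z") (auto simp: W_def)
  qed
  show ?thesis using unit sym L1 tree zero by (intro exI[of _ W]) blast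
qed

text \<open>All levels \<open>h e\<close> are lifted to one common level, where both densities are
  the same polynomial expression in masses and averages; assignments that meet a word of limit mass
  0 are absorbed by boundedness.\<close>

lemma step_density_tendsto:
  "(\<lambda>n. edge_density M k (\<lambda>e. step (c n (h e)) (U n (ws e))))
    \<longlonglongrightarrow> edge_density unit_interval k (\<lambda>e. V (h e) (ws e))"
proof -
  define J where "J = (\<Sum>e\<in>edges k. h e)"
  have hJ: "h e \<le> J" if "e \<in> edges k" for e
    unfolding J_def using that by (intro member_le_sum) auto
  let ?F = "PiE {..<k} (\<lambda>_::nat. words J)"
  have c: "edge_density M k (\<lambda>e. step (c n (h e)) (U n (ws e)))
    = (\<Sum>f\<in>?F. (\<Prod>e\<in>edges k. cdens n (ws e) (take (h e) (f (fst e))) (take (h e) (f (snd e)))) * (\<Prod>i<k. cmass n (f i)))" for n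
  proof -
    have "edge_density M k (\<lambda>e. step (c n (h e)) (U n (ws e)))
      = edge_density M k (\<lambda>e z. cdens n (ws e) (take (h e) (c n J (fst z))) (take (h e) (c n J (snd z))))"
      by (intro edge_density_cong) (auto simp: step_eq_cdens c_take[OF hJ] space_pair_measure)
    also have "\<dots> = (\<Sum>f\<in>?F. (\<Prod>e\<in>edges k. cdens n (ws e) (take (h e) (f (fst e))) (take (h e) (f (snd e))))
        * (\<Prod>i<k. prob (cell (c n J) (f i))))"
      by (rule edge_density_color[OF c_coloring, of _ "\<lambda>e s t. cdens n (ws e) (take (h e) s) (take (h e) t)"])
    also have "\<dots> = (\<Sum>f\<in>?F. (\<Prod>e\<in>edges k. cdens n (ws e) (take (h e) (f (fst e))) (take (h e) (f (snd e))))
        * (\<Prod>i<k. cmass n (f i)))"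
      by (intro sum.cong arg_cong2[of _ _ _ _ "(*)"] prod.cong refl) (auto simp: cmass_def words_def PiE_iff)
    finally show ?thesis .
  qed
  have v: "edge_density unit_interval k (\<lambda>e. V (h e) (ws e))
    = (\<Sum>f\<in>?F. (\<Prod>e\<in>edges k. ldens (ws e) (take (h e) (f (fst e))) (take (h e) (f (snd e)))) * (\<Prod>i<k. p (f i)))"
  proof -
    have "edge_density unit_interval k (\<lambda>e. V (h e) (ws e))
      = edge_density unit_interval k (\<lambda>e z. ldens (ws e) (take (h e) (word_path p (fst z) J)) (take (h e) (word_path p (snd z) J)))"
      by (intro edge_density_cong) (auto simp: V_def take_path[OF hJ])
    also have "\<dots> = (\<Sum>f\<in>?F. (\<Prod>e\<in>edges k. ldens (ws e) (take (h e) (f (fst e))) (take (h e) (f (snd e))))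
        * (\<Prod>i<k. L.prob (L.cell (\<lambda>x. word_path p x J) (f i))))"
      by (rule L.edge_density_color[OF path_coloring, of _ "\<lambda>e s t. ldens (ws e) (take (h e) s) (take (h e) t)"])
    also have "\<dots> = (\<Sum>f\<in>?F. (\<Prod>e\<in>edges k. ldens (ws e) (take (h e) (f (fst e))) (take (h e) (f (snd e))))
        * (\<Prod>i<k. p (f i)))"
      by (intro sum.cong arg_cong2[of _ _ _ _ "(*)"] prod.cong refl) (auto simp: path_cell PiE_iff)
    finally show ?thesis .
  qed
  show ?thesis unfolding c v
  proof (intro tendsto_sum bounded_mult_tendsto tendsto_prod cmass_tendsto)
    fix f assume f: "f \<in> ?F"
    have l: "length (take (h e) (f (fst e))) = length (take (h e) (f (snd e)))" if "e \<in> edges k" for e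
      using f edges_less[OF that] by (intro words_length[of _ J]) auto
    show "\<bar>\<Prod>e\<in>edges k. cdens n (ws e) (take (h e) (f (fst e))) (take (h e) (f (snd e)))\<bar> \<le> 1" for n
      unfolding abs_prod using cdens_bounds[OF l] by (intro prod_le_1) auto
    fix e assume nz: "(\<Prod>i<k. p (f i)) \<noteq> 0" and e: "e \<in> edges k"
    have "0 < p (take (h e) (f i))" if "i < k" for i
    proof -
      have "p (f i) \<noteq> 0" using nz that by auto
      then show ?thesis
        using tree_massD(2)[OF p_tree, of "f i"] tree_mass_take_ge[OF p_tree, of "f i" "h e"] by linarith
    qed
    then have "p (take (h e) (f (fst e))) * p (take (h e) (f (snd e))) \<noteq> 0"
      using edges_less[OF e] by (metis less_irrefl no_zero_divisors)
    then show "(\<lambda>n. cdens n (ws e) (take (h e) (f (fst e))) (take (h e) (f (snd e))))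
      \<longlonglongrightarrow> ldens (ws e) (take (h e) (f (fst e))) (take (h e) (f (snd e)))"
      by (rule cdens_tendsto[OF l[OF e]])
  qed
qed

text \<open>Three comparisons: kernels with their steps by the cut bounds, steps with the
  \<open>V\<close> by convergence in \<open>n\<close>, and the \<open>V\<close> with
  \<open>W\<close> by L1 distance. The levels are chosen from limiting quantities only, before
  \<open>n\<close> is sent to infinity.\<close>

lemma density_tendsto:
  assumes W: "\<And>w. unit_kernel unit_interval (W w)"
    and L1: "\<And>w. (\<lambda>j. \<integral>z. \<bar>V j w z - W w z\<bar> \<partial>(unit_interval \<Otimes>\<^sub>M unit_interval)) \<longlonglongrightarrow> 0"
  shows "(\<lambda>n. edge_density M k (\<lambda>e. U n (ws e))) \<longlonglongrightarrow> edge_density unit_interval k (\<lambda>e. W (ws e))"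
proof (rule LIMSEQ_I)
  fix \<epsilon> :: real assume \<epsilon>: "0 < \<epsilon>"
  \<comment> \<open>An error \<eta> is allowed per edge; the added 1 covers the graph without edges
    and makes the total strictly less than \<epsilon>/4.\<close>
  define \<eta> where "\<eta> = \<epsilon> / (4 * (real (card (edges k)) + 1))"
  have \<eta>: "0 < \<eta>" using \<epsilon> by (simp add: \<eta>_def)
  let ?L2 = "unit_interval \<Otimes>\<^sub>M unit_interval"
  have "\<exists>j. schedule j = w \<and> 4 * sqrt (lenergy (Suc j) w - lenergy j w) < \<eta> \<and> (\<integral>z. \<bar>V j w z - W w z\<bar> \<partial>?L2) < \<eta>" for w
  proof -
    have "\<forall>\<^sub>F j in sequentially. sqrt (lenergy (Suc j) w - lenergy j w) < \<eta> / 4"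
      using \<eta> by (intro order_tendstoD(2)[OF lenergy_Suc_tendsto]) auto
    moreover have "\<forall>\<^sub>F j in sequentially. (\<integral>z. \<bar>V j w z - W w z\<bar> \<partial>?L2) < \<eta>"
      using \<eta> by (intro order_tendstoD(2)[OF L1])
    ultimately have "\<forall>\<^sub>F j in sequentially. sqrt (lenergy (Suc j) w - lenergy j w) < \<eta> / 4 \<and> (\<integral>z. \<bar>V j w z - W w z\<bar> \<partial>?L2) < \<eta>"
      by (rule eventually_conj)
    then obtain N where N: "\<And>j. N \<le> j \<Longrightarrow> sqrt (lenergy (Suc j) w - lenergy j w) < \<eta> / 4 \<and> (\<integral>z. \<bar>V j w z - W w z\<bar> \<partial>?L2) < \<eta>"
      unfolding eventually_sequentially by blast
    \<comment> \<open>A step late enough for both estimates at which \<open>w\<close> is the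
      scheduled word.\<close>
    obtain j where "N \<le> j" "schedule j = w" using schedule_infinite by blast
    with N[of j] show ?thesis by (intro exI[of _ j]) simp
  qed
  then obtain g where g: "\<And>w. schedule (g w) = w" "\<And>w. 4 * sqrt (lenergy (Suc (g w)) w - lenergy (g w) w) < \<eta>"
      "\<And>w. (\<integral>z. \<bar>V (g w) w z - W w z\<bar> \<partial>?L2) < \<eta>"
    by metis
  define h where "h e = g (ws e)" for e
  let ?a = "\<lambda>n. edge_density M k (\<lambda>e. U n (ws e))" and ?b = "\<lambda>n. edge_density M k (\<lambda>e. step (c n (h e)) (U n (ws e)))"
  let ?v = "edge_density unit_interval k (\<lambda>e. V (h e) (ws e))" and ?w = "edge_density unit_interval k (\<lambda>e. W (ws e))"
  let ?d = "\<lambda>n e. 4 * sqrt (energy (c n (Suc (h e))) (U n (ws e)) - energy (c n (h e)) (U n (ws e)))"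
  have card: "real (card (edges k)) * \<eta> < \<epsilon> / 4"
  proof -
    have "real (card (edges k)) * \<eta> < (real (card (edges k)) + 1) * \<eta>" using \<eta> by simp
    also have "\<dots> = \<epsilon> / 4" by (simp add: \<eta>_def field_simps)
    finally show ?thesis .
  qed
  have 1: "\<bar>?a n - ?b n\<bar> \<le> (\<Sum>e\<in>edges k. ?d n e)" for n
  proof (rule counting_lemma)
    fix e
    show "unit_kernel M (U n (ws e))" by (rule U_kernel)
    show "unit_kernel M (step (c n (h e)) (U n (ws e)))" by (rule step_unit_kernel[OF c_coloring U_kernel])
    show "cut_bound (\<lambda>z. U n (ws e) z - step (c n (h e)) (U n (ws e)) z) (?d n e)"
      using c_cut_bound[of n "h e"] by (simp add: h_def g(1))
  qed
  have "(\<lambda>n. \<Sum>e\<in>edges k. ?d n e) \<longlonglongrightarrow> (\<Sum>e\<in>edges k. 4 * sqrt (lenergy (Suc (h e)) (ws e) - lenergy (h e) (ws e)))"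
    by (intro tendsto_sum tendsto_mult tendsto_const tendsto_real_sqrt tendsto_diff energy_tendsto)
  moreover have "(\<Sum>e\<in>edges k. 4 * sqrt (lenergy (Suc (h e)) (ws e) - lenergy (h e) (ws e))) < \<epsilon> / 4"
  proof -
    have "(\<Sum>e\<in>edges k. 4 * sqrt (lenergy (Suc (h e)) (ws e) - lenergy (h e) (ws e))) \<le> (\<Sum>e\<in>edges k. \<eta>)"
      unfolding h_def by (intro sum_mono less_imp_le g(2))
    then show ?thesis using card by simp
  qed
  ultimately have 2: "\<forall>\<^sub>F n in sequentially. (\<Sum>e\<in>edges k. ?d n e) < \<epsilon> / 4"
    by (rule order_tendstoD(2))
  have 3: "\<forall>\<^sub>F n in sequentially. \<bar>?b n - ?v\<bar> < \<epsilon> / 4"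
    using tendstoD[OF step_density_tendsto[of k h ws], of "\<epsilon> / 4"] \<epsilon> by (simp add: dist_real_def)
  have 4: "\<bar>?v - ?w\<bar> \<le> (\<Sum>e\<in>edges k. \<eta>)"
    using g(3) by (intro L.counting_lemma V_kernel W L.cut_bound_L1 bounded_kernel_diff unit_imp_bounded_kernel)
      (auto simp: h_def intro: less_imp_le)
  have "\<forall>\<^sub>F n in sequentially. norm (?a n - ?w) < \<epsilon>"
    using 2 3
  proof eventually_elim
    case (elim n)
    moreover have "\<bar>?v - ?w\<bar> \<le> real (card (edges k)) * \<eta>" using 4 by simp
    ultimately show ?case unfolding real_norm_def using 1[of n] card by linarith
  qed
  then show "\<exists>no. \<forall>n\<ge>no. norm (?a n - ?w) < \<epsilon>" by (simp add: eventually_sequentially)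
qed

end

section \<open>Extending the class of decorations\<close>

lemma (in tree_kernels) subsequence_limit_exists:
  assumes d: "tree_mass d"
  shows "\<exists>r W. strict_mono (r :: nat \<Rightarrow> nat)
    \<and> (\<forall>w. unit_kernel unit_interval (W w) \<and> L.symmetric_kernel (W w))
    \<and> (\<forall>z\<in>space (unit_interval \<Otimes>\<^sub>M unit_interval). tree_mass (\<lambda>w. W w z))
    \<and> (\<forall>w. d w = 0 \<longrightarrow> (\<forall>n. \<forall>z\<in>space (M \<Otimes>\<^sub>M M). U n w z = 0) \<longrightarrow> (\<forall>z. W w z = 0))
    \<and> (\<forall>k ws. (\<lambda>n. edge_density M k (\<lambda>e. U (r n) (ws e))) \<longlonglongrightarrow> edge_density unit_interval k (\<lambda>e. W (ws e)))"
proof -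
  \<comment> \<open>A single countable index type gathers masses and cell integrals, so that one
    diagonal argument makes all of them converge.\<close>
  define X where "X n i = (case i of Inl s \<Rightarrow> cmass n s
    | Inr (w, s, t) \<Rightarrow> if length s = length t then cint n w s t else 0)"
    for n and i :: "bool list + bool list \<times> bool list \<times> bool list"
  have "0 \<le> X n i \<and> X n i \<le> 1" for n i
    using cint_bounds(1) cint_le_1 by (auto simp: X_def cmass_def split: sum.splits)
  then obtain r :: "nat \<Rightarrow> nat" where r: "strict_mono r" "\<And>i. convergent (\<lambda>n. X (r n) i)"
    using convergent_diagonal_subsequence by blast
  define p where "p s = lim (\<lambda>n. X (r n) (Inl s))" for s
  define q where "q w s t = lim (\<lambda>n. X (r n) (Inr (w, s, t)))" for w s t
  \<comment> \<open>The colorings for index \<open>n\<close> depend on the kernels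
    \<open>U n\<close> alone, so passing to a subsequence merely renames indices.\<close>
  interpret R: tree_kernels M "\<lambda>n. U (r n)"
    by unfold_locales (use U_kernel U_sym U_tree in auto)
  have Rc: "R.c n = c (r n)" for n by (simp add: R.c_def c_def)
  have Rmass: "R.cmass n s = cmass (r n) s" for n s by (simp add: R.cmass_def cmass_def Rc)
  have Rint: "R.cint n w s t = cint (r n) w s t" for n w s t by (simp add: R.cint_def cint_def Rc)
  interpret R: tree_kernels_limit M "\<lambda>n. U (r n)" p q
  proof
    show "(\<lambda>n. R.cmass n s) \<longlonglongrightarrow> p s" for s
      using r(2)[of "Inl s"] by (simp add: convergent_LIMSEQ_iff p_def X_def Rmass)
    show "(\<lambda>n. R.cint n w s t) \<longlonglongrightarrow> q w s t" if "length s = length t" for w s t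
      using r(2)[of "Inr (w, s, t)"] that by (simp add: convergent_LIMSEQ_iff q_def X_def Rint)
  qed
  obtain W where W: "\<And>w. unit_kernel unit_interval (W w)" "\<And>w. L.symmetric_kernel (W w)"
    "\<And>w. (\<lambda>j. \<integral>z. \<bar>R.V j w z - W w z\<bar> \<partial>(unit_interval \<Otimes>\<^sub>M unit_interval)) \<longlonglongrightarrow> 0"
    "\<And>z. z \<in> space (unit_interval \<Otimes>\<^sub>M unit_interval) \<Longrightarrow> tree_mass (\<lambda>w. W w z)"
    "\<And>w z. d w = 0 \<Longrightarrow> (\<forall>s t. q w s t = 0) \<Longrightarrow> W w z = 0"
    using R.limit_kernel_exists[OF d] by blast
  have "q w s t = 0" if "\<forall>n. \<forall>z\<in>space (M \<Otimes>\<^sub>M M). U n w z = 0" for w s t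
    using that by (simp add: q_def X_def cint_zero cong: if_cong)
  then have "W w z = 0" if "d w = 0" "\<forall>n. \<forall>z\<in>space (M \<Otimes>\<^sub>M M). U n w z = 0" for w z
    using W(5)[OF that(1)] that(2) by blast
  moreover have "(\<lambda>n. edge_density M k (\<lambda>e. U (r n) (ws e))) \<longlonglongrightarrow> edge_density unit_interval k (\<lambda>e. W (ws e))"
    for k ws by (rule R.density_tendsto[OF W(1,3)])
  ultimately show ?thesis using r(1) W(1,2,4) by (intro exI[of _ r] exI[of _ W]) blast
qed

context prob_space
begin

lemma edge_density_upd_bound:
  assumes e: "e \<in> edges k"
    and H: "\<And>e' z. e' \<in> edges k - {e} \<Longrightarrow> z \<in> space (M \<Otimes>\<^sub>M M) \<Longrightarrow> \<bar>H e' z\<bar> \<le> b e'"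
    and D: "\<And>z. z \<in> space (M \<Otimes>\<^sub>M M) \<Longrightarrow> \<bar>D z\<bar> \<le> \<epsilon>" and \<epsilon>: "0 \<le> \<epsilon>"
  shows "\<bar>edge_density M k (H(e := D))\<bar> \<le> \<epsilon> * (\<Prod>e'\<in>edges k - {e}. b e')"
proof -
  interpret P: prob_space "PiM {..<k} (\<lambda>_. M)" by (rule PiM_prob)
  show ?thesis unfolding edge_density_def
  proof (rule P.abs_integral_le_const)
    fix x assume x: "x \<in> space (PiM {..<k} (\<lambda>_. M))"
    show "\<bar>edge_prod k (H(e := D)) x\<bar> \<le> \<epsilon> * (\<Prod>e'\<in>edges k - {e}. b e')"
      unfolding edge_prod_remove[OF e] abs_mult abs_prod
      using D[OF edge_eval_space[OF e x]] H edge_eval_space[OF _ x] \<epsilon>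
      by (intro mult_mono prod_mono prod_nonneg) auto
  qed
qed

text \<open>A decoration \<open>f\<close> stands for the kernels \<open>\<kappa> n f\<close> and their candidate limit \<open>\<kappa>' f\<close>;
  convergence of densities passes from \<open>X\<close> to uniform limits of linear combinations,
  one edge at a time.\<close>

lemma density_tendsto_extend:
  fixes \<kappa> :: "nat \<Rightarrow> 'f \<Rightarrow> 'a \<times> 'a \<Rightarrow> real" and \<kappa>' :: "'f \<Rightarrow> 'a \<times> 'a \<Rightarrow> real"
  assumes meas: "\<And>n f. \<kappa> n f \<in> borel_measurable (M \<Otimes>\<^sub>M M)" "\<And>f. \<kappa>' f \<in> borel_measurable (M \<Otimes>\<^sub>M M)"
    and bound: "\<And>n f z. z \<in> space (M \<Otimes>\<^sub>M M) \<Longrightarrow> \<bar>\<kappa> n f z\<bar> \<le> b f" "\<And>f z. z \<in> space (M \<Otimes>\<^sub>M M) \<Longrightarrow> \<bar>\<kappa>' f z\<bar> \<le> b f"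
    and approx: "\<And>f \<epsilon>. f \<in> Y \<Longrightarrow> 0 < \<epsilon> \<Longrightarrow> \<exists>S a. finite S \<and> S \<subseteq> X \<and> (\<forall>z\<in>space (M \<Otimes>\<^sub>M M).
        (\<forall>n. \<bar>\<kappa> n f z - (\<Sum>x\<in>S. a x * \<kappa> n x z)\<bar> \<le> \<epsilon>) \<and> \<bar>\<kappa>' f z - (\<Sum>x\<in>S. a x * \<kappa>' x z)\<bar> \<le> \<epsilon>)"
    and X: "\<And>F. (\<And>e. e \<in> edges k \<Longrightarrow> F e \<in> X) \<Longrightarrow>
        (\<lambda>n. edge_density M k (\<lambda>e. \<kappa> n (F e))) \<longlonglongrightarrow> edge_density M k (\<lambda>e. \<kappa>' (F e))"
    and F: "\<And>e. e \<in> edges k \<Longrightarrow> F e \<in> Y"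
  shows "(\<lambda>n. edge_density M k (\<lambda>e. \<kappa> n (F e))) \<longlonglongrightarrow> edge_density M k (\<lambda>e. \<kappa>' (F e))"
proof -
  have bk: "bounded_kernel M (\<kappa> n f)" "bounded_kernel M (\<kappa>' f)" for n f
    using meas bound unfolding bounded_kernel_def by blast+
  \<comment> \<open>Edges in \<open>D\<close> carry decorations from \<open>Y\<close>, the others
    from \<open>X\<close>; the induction step expands the decoration of one edge of \<open>D\<close>
    over \<open>X\<close>.\<close>
  have "(\<lambda>n. edge_density M k (\<lambda>e. \<kappa> n (F e))) \<longlonglongrightarrow> edge_density M k (\<lambda>e. \<kappa>' (F e))"
    if "finite D" "D \<subseteq> edges k" "\<And>e. e \<in> D \<Longrightarrow> F e \<in> Y" "\<And>e. e \<in> edges k - D \<Longrightarrow> F e \<in> X" for D F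
    using that
  proof (induction D arbitrary: F)
    case (insert e D)
    have e: "e \<in> edges k" using insert.prems by blast
    have IH: "(\<lambda>n. edge_density M k (\<lambda>e'. \<kappa> n ((F(e := x)) e'))) \<longlonglongrightarrow> edge_density M k (\<lambda>e'. \<kappa>' ((F(e := x)) e'))"
      if "x \<in> X" for x
      using insert that by (intro insert.IH) auto
    have upd: "(\<lambda>e'. g ((F(e := x)) e')) = (\<lambda>e'. g (F e'))(e := g x)" for g :: "'f \<Rightarrow> 'a \<times> 'a \<Rightarrow> real" and x by auto
    \<comment> \<open>A bound for the product of the remaining factors, by which an error at the
      edge \<open>e\<close> is amplified.\<close>
    define C where "C = (\<Prod>e'\<in>edges k - {e}. b (F e'))"
    obtain z0 where z0: "z0 \<in> space (M \<Otimes>\<^sub>M M)" using not_empty by (auto simp: space_pair_measure)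
    have "0 \<le> b f" for f using bound(2)[OF z0, of f] by linarith
    then have C: "0 \<le> C" unfolding C_def by (intro prod_nonneg) auto
    show ?case
    proof (rule LIMSEQ_I)
      fix \<epsilon> :: real assume \<epsilon>: "0 < \<epsilon>"
      define \<eta> where "\<eta> = \<epsilon> / (3 * (C + 1))"
      have \<eta>: "0 < \<eta>" "\<eta> * C < \<epsilon> / 3"
      proof -
        show "0 < \<eta>" using \<epsilon> C by (simp add: \<eta>_def)
        then have "\<eta> * C < \<eta> * (C + 1)" by simp
        also have "\<dots> = \<epsilon> / 3" using C by (simp add: \<eta>_def field_simps)
        finally show "\<eta> * C < \<epsilon> / 3" .
      qed
      obtain S a where S: "finite S" "S \<subseteq> X"
        and apS: "\<forall>z\<in>space (M \<Otimes>\<^sub>M M). (\<forall>n. \<bar>\<kappa> n (F e) z - (\<Sum>x\<in>S. a x * \<kappa> n x z)\<bar> \<le> \<eta>)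
          \<and> \<bar>\<kappa>' (F e) z - (\<Sum>x\<in>S. a x * \<kappa>' x z)\<bar> \<le> \<eta>"
        using approx[OF insert.prems(2)[OF insertI1] \<eta>(1)] by (elim exE conjE)
      have ap: "\<bar>\<kappa> n (F e) z - (\<Sum>x\<in>S. a x * \<kappa> n x z)\<bar> \<le> \<eta>" "\<bar>\<kappa>' (F e) z - (\<Sum>x\<in>S. a x * \<kappa>' x z)\<bar> \<le> \<eta>"
        if "z \<in> space (M \<Otimes>\<^sub>M M)" for n z
        using bspec[OF apS that] by simp_all
      have close: "\<bar>edge_density M k (\<lambda>e. g (F e)) - (\<Sum>x\<in>S. a x * edge_density M k (\<lambda>e'. g ((F(e := x)) e')))\<bar> \<le> \<eta> * C"
        if g: "\<And>f. bounded_kernel M (g f)" "\<And>f z. z \<in> space (M \<Otimes>\<^sub>M M) \<Longrightarrow> \<bar>g f z\<bar> \<le> b f"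
          "\<And>z. z \<in> space (M \<Otimes>\<^sub>M M) \<Longrightarrow> \<bar>g (F e) z - (\<Sum>x\<in>S. a x * g x z)\<bar> \<le> \<eta>" for g
      proof -
        let ?H = "\<lambda>e. g (F e)"
        have H: "?H(e := g (F e)) = ?H" by auto
        have "(\<Sum>x\<in>S. a x * edge_density M k (\<lambda>e'. g ((F(e := x)) e')))
          = (\<Sum>x\<in>S. edge_density M k (?H(e := \<lambda>z. a x * g x z)))"
          unfolding upd by (simp add: edge_density_upd_cmult[OF e])
        also have "\<dots> = edge_density M k (?H(e := \<lambda>z. \<Sum>x\<in>S. a x * g x z))"
          by (rule edge_density_upd_sum[OF e, symmetric]) (intro g bounded_kernel_cmult)+
        finally have "edge_density M k ?H - (\<Sum>x\<in>S. a x * edge_density M k (\<lambda>e'. g ((F(e := x)) e')))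
          = edge_density M k (?H(e := g (F e))) - edge_density M k (?H(e := \<lambda>z. \<Sum>x\<in>S. a x * g x z))"
          by (simp only: H)
        also have "\<dots> = edge_density M k (?H(e := \<lambda>z. g (F e) z - (\<Sum>x\<in>S. a x * g x z)))"
          by (rule edge_density_upd_diff[OF e, symmetric]) (intro g bounded_kernel_sum bounded_kernel_cmult)+
        also have "\<bar>\<dots>\<bar> \<le> \<eta> * C"
          unfolding C_def using g(2,3) \<eta>(1) by (intro edge_density_upd_bound[OF e]) auto
        finally show ?thesis .
      qed
      let ?s = "\<lambda>n. \<Sum>x\<in>S. a x * edge_density M k (\<lambda>e'. \<kappa> n ((F(e := x)) e'))"
      let ?t = "\<Sum>x\<in>S. a x * edge_density M k (\<lambda>e'. \<kappa>' ((F(e := x)) e'))"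
      have "?s \<longlonglongrightarrow> ?t"
        using S(2) by (intro tendsto_sum tendsto_mult tendsto_const IH) auto
      from tendstoD[OF this, of "\<epsilon> / 3"] have "\<forall>\<^sub>F n in sequentially. \<bar>?s n - ?t\<bar> < \<epsilon> / 3"
        using \<epsilon> by (simp only: dist_real_def)
      then have "\<forall>\<^sub>F n in sequentially. norm (edge_density M k (\<lambda>e. \<kappa> n (F e)) - edge_density M k (\<lambda>e. \<kappa>' (F e))) < \<epsilon>"
      proof eventually_elim
        case (elim n)
        then show ?case unfolding real_norm_def
          using close[of "\<kappa> n", OF bk(1) bound(1) ap(1)] close[of \<kappa>', OF bk(2) bound(2) ap(2)] \<eta>(2) by linarith
      qed
      then show "\<exists>no. \<forall>n\<ge>no. norm (edge_density M k (\<lambda>e. \<kappa> n (F e)) - edge_density M k (\<lambda>e. \<kappa>' (F e))) < \<epsilon>"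
        by (simp add: eventually_sequentially)
    qed
  qed (use X in auto)
  from this[of "edges k" F] show ?thesis using F by auto
qed

text \<open>Used both on the compact space, colored by cells, and on [0,1], colored by path words,
  so that integrals against a graphon and against the constructed limit are approximated by the same
  combination of masses.\<close>

lemma color_approx:
  assumes c: "coloring j c" and F: "F \<in> borel_measurable M" "\<And>x. x \<in> space M \<Longrightarrow> \<bar>F x\<bar> \<le> B"
    and close: "\<And>x. x \<in> space M \<Longrightarrow> \<bar>F x - h (c x)\<bar> \<le> \<epsilon>"
  shows "\<bar>(\<integral>x. F x \<partial>M) - (\<Sum>s\<in>words j. h s * prob (cell c s))\<bar> \<le> \<epsilon>"
proof -
  have i: "integrable M (indicator (cell c s) :: _ \<Rightarrow> real)" for s
    using cell_sets[OF c, of s] by (simp add: less_top[symmetric])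
  have iF: "integrable M F" using F by (auto intro!: integrable_const_bound[where B = B])
  have "(\<Sum>s\<in>words j. h s * prob (cell c s)) = (\<integral>x. (\<Sum>s\<in>words j. h s * indicator (cell c s) x) \<partial>M)"
  proof -
    have "(\<integral>x. (\<Sum>s\<in>words j. h s * indicator (cell c s) x) \<partial>M) = (\<Sum>s\<in>words j. \<integral>x. h s * indicator (cell c s) x \<partial>M)"
      by (intro Bochner_Integration.integral_sum integrable_mult_right i)
    then show ?thesis using cell_sets[OF c] by simp
  qed
  also have "(\<integral>x. F x \<partial>M) - \<dots> = (\<integral>x. F x - (\<Sum>s\<in>words j. h s * indicator (cell c s) x) \<partial>M)"
    by (intro Bochner_Integration.integral_diff[symmetric] iF Bochner_Integration.integrable_sum integrable_mult_right i)
  finally have "(\<integral>x. F x \<partial>M) - (\<Sum>s\<in>words j. h s * prob (cell c s))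
      = (\<integral>x. F x - (\<Sum>s\<in>words j. h s * indicator (cell c s) x) \<partial>M)" .
  also have "\<bar>\<dots>\<bar> \<le> \<epsilon>"
  proof (rule abs_integral_le_const)
    fix x assume x: "x \<in> space M"
    have "(\<Sum>s\<in>words j. h s * indicator (cell c s) x) = (\<Sum>s\<in>words j. if s = c x then h s else 0)"
      using x by (intro sum.cong) (auto simp: cell_def)
    also have "\<dots> = h (c x)" using coloring_words[OF c x] by simp
    finally show "\<bar>F x - (\<Sum>s\<in>words j. h s * indicator (cell c s) x)\<bar> \<le> \<epsilon>" using close[OF x] by simp
  qed
  finally show ?thesis .
qed

end

section \<open>Graphons with values in probability measures\<close>

text \<open>Graphons are measurable for a restriction of a product, while densities involve a
  product of restrictions; measurability is carried from one to the other.\<close>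

lemma sets_unit_sq: "sets unit_sq = sets (unit_interval \<Otimes>\<^sub>M unit_interval)"
proof
  have sp: "space unit_sq = {0..1} \<times> {0..1}"
    by (simp add: unit_sq_def space_restrict_space space_pair_measure)
  have f: "fst \<in> unit_sq \<rightarrow>\<^sub>M unit_interval" "snd \<in> unit_sq \<rightarrow>\<^sub>M unit_interval"
    unfolding unit_sq_def by (rule measurable_restrict_space3; auto)+
  show "sets (unit_interval \<Otimes>\<^sub>M unit_interval) \<subseteq> sets unit_sq"
    unfolding sets_pair_measure
  proof (rule sets.sigma_sets_subset', safe)
    fix a b assume ab: "a \<in> sets unit_interval" "b \<in> sets unit_interval"
    have "a \<times> b = (fst -` a \<inter> space unit_sq) \<inter> (snd -` b \<inter> space unit_sq)"
      using ab[THEN sets.sets_into_space] by (auto simp: sp)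
    then show "a \<times> b \<in> sets unit_sq"
      using measurable_sets[OF f(1) ab(1)] measurable_sets[OF f(2) ab(2)] by simp
  qed (use sp sets.top[of unit_sq] in simp)
  show "sets unit_sq \<subseteq> sets (unit_interval \<Otimes>\<^sub>M unit_interval)"
  proof
    fix A assume "A \<in> sets unit_sq"
    then obtain A' where A': "A' \<in> sets (lborel \<Otimes>\<^sub>M lborel)" "A = {0..1} \<times> {0..1} \<inter> A'"
      unfolding unit_sq_def by (auto simp: sets_restrict_space)
    have "(\<lambda>z. (fst z, snd z)) \<in> unit_interval \<Otimes>\<^sub>M unit_interval \<rightarrow>\<^sub>M lborel \<Otimes>\<^sub>M (lborel :: real measure)"
      by (intro measurable_Pair measurable_compose[OF measurable_fst] measurable_compose[OF measurable_snd]
          measurable_restrict_space1) auto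
    from measurable_sets[OF this A'(1)] show "A \<in> sets (unit_interval \<Otimes>\<^sub>M unit_interval)"
      by (simp add: A'(2) space_pair_measure Int_commute)
  qed
qed

definition graphon_kernel :: "(real \<times> real \<Rightarrow> 'k::topological_space measure) \<Rightarrow> ('k \<Rightarrow>\<^sub>C real) \<Rightarrow> real \<times> real \<Rightarrow> real" where
  "graphon_kernel W f z = (\<integral>k. f k \<partial>(W z))"

lemma hom_density_eq_edge_density:
  "hom_density k F W = edge_density unit_interval k (\<lambda>e. graphon_kernel W (F (fst e) (snd e)))"
  unfolding hom_density_def edge_density_def edge_prod_def W_fun_def graphon_kernel_def edges_def
  by (simp add: case_prod_unfold)

lemma K_graphonD:
  assumes W: "K_graphon W"
  shows "W \<in> unit_interval \<Otimes>\<^sub>M unit_interval \<rightarrow>\<^sub>M prob_algebra borel"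
    and "z \<in> space (unit_interval \<Otimes>\<^sub>M unit_interval) \<Longrightarrow> prob_space (W z) \<and> sets (W z) = sets borel"
proof -
  show m: "W \<in> unit_interval \<Otimes>\<^sub>M unit_interval \<rightarrow>\<^sub>M prob_algebra borel"
    using W measurable_cong_sets[OF sets_unit_sq refl] by (auto simp: K_graphon_def)
  show "prob_space (W z) \<and> sets (W z) = sets borel" if "z \<in> space (unit_interval \<Otimes>\<^sub>M unit_interval)"
    using measurable_space[OF m that] by (simp add: space_prob_algebra)
qed

lemma bcontfun_borel_measurable: "apply_bcontfun f \<in> borel_measurable borel"
  for f :: "'k::topological_space \<Rightarrow>\<^sub>C real"
  by (intro borel_measurable_continuous_onI) simp

lemma graphon_kernel_measurable:
  assumes "K_graphon W"
  shows "graphon_kernel W f \<in> borel_measurable (unit_interval \<Otimes>\<^sub>M unit_interval)"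
  unfolding graphon_kernel_def[abs_def]
  by (rule measurable_compose[OF measurable_prob_algebraD[OF K_graphonD(1)[OF assms]]
        integral_measurable_subprob_algebra[OF bcontfun_borel_measurable]])

lemma integrable_bcontfun:
  fixes f :: "'k::topological_space \<Rightarrow>\<^sub>C real"
  assumes "prob_space P" "sets P = sets borel"
  shows "integrable P (apply_bcontfun f)"
proof -
  interpret prob_space P by fact
  have "apply_bcontfun f \<in> borel_measurable P"
    using bcontfun_borel_measurable assms(2) by (simp cong: measurable_cong_sets)
  then show ?thesis
    using norm_bounded[of f] by (intro integrable_const_bound[where B = "norm f"]) auto
qed

lemma abs_graphon_kernel_le:
  assumes "K_graphon W" "z \<in> space (unit_interval \<Otimes>\<^sub>M unit_interval)"
  shows "\<bar>graphon_kernel W f z\<bar> \<le> norm f"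
proof -
  interpret prob_space "W z" using K_graphonD(2)[OF assms] by simp
  show ?thesis unfolding graphon_kernel_def
    using norm_bounded[of f] by (intro abs_integral_le_const) auto
qed

lemma graphon_kernel_span:
  assumes W: "K_graphon W" and z: "z \<in> space (unit_interval \<Otimes>\<^sub>M unit_interval)"
    and f: "norm (f - (\<Sum>g\<in>S. a g *\<^sub>R g)) \<le> \<epsilon>" and S: "finite S"
  shows "\<bar>graphon_kernel W f z - (\<Sum>g\<in>S. a g * graphon_kernel W g z)\<bar> \<le> \<epsilon>"
proof -
  have i: "integrable (W z) (apply_bcontfun g)" for g :: "'a \<Rightarrow>\<^sub>C real"
    using K_graphonD(2)[OF W z] by (intro integrable_bcontfun) auto
  have ap: "apply_bcontfun (\<Sum>g\<in>S. a g *\<^sub>R g) k = (\<Sum>g\<in>S. a g * apply_bcontfun g k)" for k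
    using S by (induction S) auto
  have "(\<Sum>g\<in>S. a g * graphon_kernel W g z) = (\<integral>k. (\<Sum>g\<in>S. a g * apply_bcontfun g k) \<partial>(W z))"
    unfolding graphon_kernel_def using i by (subst Bochner_Integration.integral_sum) auto
  then have "graphon_kernel W f z - (\<Sum>g\<in>S. a g * graphon_kernel W g z) = graphon_kernel W (f - (\<Sum>g\<in>S. a g *\<^sub>R g)) z"
    unfolding graphon_kernel_def minus_bcontfun.rep_eq ap
    using i by (subst Bochner_Integration.integral_diff) auto
  then show ?thesis using abs_graphon_kernel_le[OF W z, of "f - (\<Sum>g\<in>S. a g *\<^sub>R g)"] f by simp
qed

section \<open>Trees of masses and measures on the compact space\<close>

context coded_space
begin

lemma Kcell_measure_tree:
  assumes "prob_space P" "sets P = sets borel"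
  shows "tree_mass (\<lambda>w. measure P (Kcell w))"
  unfolding tree_mass_def
proof (intro conjI allI)
  interpret prob_space P by fact
  show "prob (Kcell []) = 1" using prob_space sets_eq_imp_space_eq[OF assms(2)] by simp
  fix w
  have "Kcell w = Kcell (w @ [False]) \<union> Kcell (w @ [True])" "Kcell (w @ [False]) \<inter> Kcell (w @ [True]) = {}"
    by (auto simp: Kcell_snoc)
  then show "prob (Kcell w) = prob (Kcell (w @ [False])) + prob (Kcell (w @ [True]))"
    using finite_measure_Union[of "Kcell (w @ [False])" "Kcell (w @ [True])"] by (simp add: assms(2))
qed simp

text \<open>For an empty cell this is an arbitrary point, harmless because its value is always
  weighted by the mass of that cell, which is 0.\<close>

definition representative :: "bool list \<Rightarrow> 'k" where
  "representative s = (SOME k. k \<in> Kcell s)"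

lemma representative: "Kcell s \<noteq> {} \<Longrightarrow> representative s \<in> Kcell s"
  unfolding representative_def by (rule someI_ex) auto

lemma integral_cell_approx:
  fixes f :: "'k \<Rightarrow>\<^sub>C real"
  assumes P: "prob_space P" "sets P = sets borel"
    and j: "\<And>s x y. s \<in> words j \<Longrightarrow> x \<in> closure (Kcell s) \<Longrightarrow> y \<in> closure (Kcell s) \<Longrightarrow> \<bar>f x - f y\<bar> \<le> \<epsilon>"
  shows "\<bar>(\<integral>k. f k \<partial>P) - (\<Sum>s\<in>words j. f (representative s) * measure P (Kcell s))\<bar> \<le> \<epsilon>"
proof -
  interpret prob_space P by fact
  have sp: "space P = UNIV" using sets_eq_imp_space_eq[OF P(2)] by simp
  have cell: "cell (code j) s = (if s \<in> words j then Kcell s else {})" for s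
    using Kcell_iff_code[of s j] code_in_words[of j] by (auto simp: cell_def sp)
  have "code j -` {s} \<inter> space P = cell (code j) s" for s by (auto simp: cell_def)
  then have "code j \<in> P \<rightarrow>\<^sub>M count_space UNIV"
    using P(2) by (subst measurable_count_space_eq_countable) (auto simp: cell)
  then have c: "coloring j (code j)" using code_in_words by (auto simp: coloring_def words_def)
  have "\<bar>(\<integral>k. f k \<partial>P) - (\<Sum>s\<in>words j. f (representative s) * prob (cell (code j) s))\<bar> \<le> \<epsilon>"
  proof (rule color_approx[OF c])
    show "apply_bcontfun f \<in> borel_measurable P"
      using bcontfun_borel_measurable P(2) by (simp cong: measurable_cong_sets)
    show "\<bar>f x\<bar> \<le> norm f" for x using norm_bounded[of f x] by simp
    fix x
    have "x \<in> Kcell (code j x)" using Kcell_iff_code[OF code_in_words] by simp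
    then show "\<bar>f x - f (representative (code j x))\<bar> \<le> \<epsilon>"
      using representative[of "code j x"] closure_subset
      by (intro j[OF code_in_words[of j x]]) blast+
  qed
  then show ?thesis by (simp add: cell cong: sum.cong)
qed

lemma word_path_consistent:
  assumes p: "tree_mass p" and u: "u \<in> {0..1}" and zero: "\<And>w. Kcell w = {} \<Longrightarrow> p w = 0"
  shows "consistent (word_path p u)"
  unfolding consistent_def using take_path path_pos[OF p u] zero by (metis length_path less_irrefl)

text \<open>The law of the point coded by the path of a uniform \<open>u\<close> through the tree at
  \<open>z\<close>. The same \<open>u\<close> serves every \<open>z\<close>, so measurability in
  \<open>z\<close> follows from joint measurability of the coded point.\<close>

definition limit_graphon :: "(bool list \<Rightarrow> real \<times> real \<Rightarrow> real) \<Rightarrow> real \<times> real \<Rightarrow> 'k measure" where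
  "limit_graphon V z = distr unit_interval borel (\<lambda>u. limit_point (word_path (\<lambda>w. V w z) u))"

text \<open>For the second part: the coded point and the representative both lie in the closure of
  the cell reached at level \<open>j\<close>, so \<open>f\<close> differs at them by at most
  \<epsilon>, and the path reaches the word \<open>s\<close> with probability
  \<open>V s z\<close>.\<close>

lemma limit_graphon:
  fixes f :: "'k \<Rightarrow>\<^sub>C real"
  assumes V: "\<And>w. V w \<in> borel_measurable (unit_interval \<Otimes>\<^sub>M unit_interval)"
    and tree: "\<And>z. z \<in> space (unit_interval \<Otimes>\<^sub>M unit_interval) \<Longrightarrow> tree_mass (\<lambda>w. V w z)"
    and zero: "\<And>w z. Kcell w = {} \<Longrightarrow> V w z = 0"
    and sym: "\<And>w. L.symmetric_kernel (V w)"
  shows "K_graphon (limit_graphon V)"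
    and "z \<in> space (unit_interval \<Otimes>\<^sub>M unit_interval) \<Longrightarrow>
      (\<And>s x y. s \<in> words j \<Longrightarrow> x \<in> closure (Kcell s) \<Longrightarrow> y \<in> closure (Kcell s) \<Longrightarrow> \<bar>f x - f y\<bar> \<le> \<epsilon>) \<Longrightarrow>
      \<bar>graphon_kernel (limit_graphon V) f z - (\<Sum>s\<in>words j. f (representative s) * V s z)\<bar> \<le> \<epsilon>"
proof -
  let ?L2 = "unit_interval \<Otimes>\<^sub>M unit_interval"
  let ?pt = "\<lambda>z u. limit_point (word_path (\<lambda>w. V w z) u)"
  have cons: "consistent (word_path (\<lambda>w. V w z) u)" if "z \<in> space ?L2" "u \<in> {0..1}" for z u
    using word_path_consistent[OF tree[OF that(1)] that(2)] zero by blast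
  have m: "(\<lambda>(z, u). ?pt z u) \<in> ?L2 \<Otimes>\<^sub>M unit_interval \<rightarrow>\<^sub>M borel"
  proof (rule borel_measurableI)
    fix S :: "'k set" assume S: "open S"
    let ?Z = "?L2 \<Otimes>\<^sub>M unit_interval"
    \<comment> \<open>The event that the path starts with \<open>w\<close>; the preimage of an open
      set is the union of these events over the words whose cell has its closure inside that
      set.\<close>
    let ?A = "\<lambda>w. (\<lambda>x. word_path (\<lambda>w. V w (fst x)) (snd x) (length w)) -` {w} \<inter> space ?Z"
    have "?A w \<in> sets ?Z" for w
    proof (rule measurable_sets)
      show "(\<lambda>x. word_path (\<lambda>w. V w (fst x)) (snd x) (length w)) \<in> ?Z \<rightarrow>\<^sub>M count_space UNIV"
        by (intro path_measurable measurable_compose[OF measurable_fst V]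
            measurable_compose[OF measurable_snd] measurable_restrict_space1) auto
    qed simp
    then have "(\<Union>w\<in>{w. closure (Kcell w) \<subseteq> S}. ?A w) \<in> sets ?Z"
      by (intro sets.countable_UN') auto
    also have "(\<Union>w\<in>{w. closure (Kcell w) \<subseteq> S}. ?A w) = (\<lambda>(z, u). ?pt z u) -` S \<inter> space ?Z"
    proof (intro equalityI subsetI)
      fix x assume "x \<in> (\<Union>w\<in>{w. closure (Kcell w) \<subseteq> S}. ?A w)"
      then obtain w where "closure (Kcell w) \<subseteq> S" "x \<in> ?A w" by blast
      then show "x \<in> (\<lambda>(z, u). ?pt z u) -` S \<inter> space ?Z"
        using limit_point_in_open_iff[OF cons S, of "fst x" "snd x"]
        by (auto simp: space_pair_measure) metis
    next
      fix x assume x: "x \<in> (\<lambda>(z, u). ?pt z u) -` S \<inter> space ?Z"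
      then have "\<exists>j. closure (Kcell (word_path (\<lambda>w. V w (fst x)) (snd x) j)) \<subseteq> S"
        using limit_point_in_open_iff[OF cons S, of "fst x" "snd x"]
        by (auto simp: space_pair_measure)
      then show "x \<in> (\<Union>w\<in>{w. closure (Kcell w) \<subseteq> S}. ?A w)" using x by auto
    qed
    finally show "(\<lambda>(z, u). ?pt z u) -` S \<inter> space ?Z \<in> sets ?Z" .
  qed
  have m1: "?pt z \<in> unit_interval \<rightarrow>\<^sub>M borel" if "z \<in> space ?L2" for z
    using measurable_compose[OF measurable_Pair1'[OF that] m] by simp
  have "limit_graphon V \<in> ?L2 \<rightarrow>\<^sub>M prob_algebra borel"
    unfolding limit_graphon_def[abs_def]
  proof (rule measurable_distr_prob_space2[OF _ m])
    show "(\<lambda>_. unit_interval) \<in> ?L2 \<rightarrow>\<^sub>M prob_algebra unit_interval"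
      by (intro measurable_const) (simp add: space_prob_algebra prob_space_unit_interval)
  qed
  then have "limit_graphon V \<in> unit_sq \<rightarrow>\<^sub>M prob_algebra borel"
    using measurable_cong_sets[OF sets_unit_sq refl] by blast
  moreover have "V w (x, y) = V w (y, x)" if "x \<in> {0..1}" "y \<in> {0..1}" for w x y
    using sym[of w] that by (simp add: L.symmetric_kernel_def)
  ultimately show "K_graphon (limit_graphon V)"
    by (simp add: K_graphon_def limit_graphon_def)
  assume z: "z \<in> space ?L2"
    and j: "\<And>s x y. s \<in> words j \<Longrightarrow> x \<in> closure (Kcell s) \<Longrightarrow> y \<in> closure (Kcell s) \<Longrightarrow> \<bar>f x - f y\<bar> \<le> \<epsilon>"
  let ?c = "\<lambda>u. word_path (\<lambda>w. V w z) u j"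
  have c: "L.coloring j ?c"
    unfolding L.coloring_def
    using path_measurable[of "\<lambda>_ w. V w z" unit_interval "\<lambda>u. u" j] by (simp add: measurable_restrict_space1)
  have "\<bar>(\<integral>u. f (?pt z u) \<partial>unit_interval) - (\<Sum>s\<in>words j. f (representative s) * L.prob (L.cell ?c s))\<bar> \<le> \<epsilon>"
  proof (rule L.color_approx[OF c])
    show "(\<lambda>u. f (?pt z u)) \<in> borel_measurable unit_interval"
      by (rule measurable_compose[OF m1[OF z] bcontfun_borel_measurable])
    show "\<bar>f (?pt z u)\<bar> \<le> norm f" for u using norm_bounded[of f] by simp
    fix u assume "u \<in> space unit_interval"
    then have cu: "consistent (word_path (\<lambda>w. V w z) u)" using cons[OF z] by simp
    then have "Kcell (?c u) \<noteq> {}" by (simp add: consistent_def)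
    then show "\<bar>f (?pt z u) - f (representative (?c u))\<bar> \<le> \<epsilon>"
      using limit_point_in_closure[OF cu, of j] representative[of "?c u"] closure_subset
      by (intro j[of "?c u"]) (auto simp: words_def)
  qed
  moreover have "L.prob (L.cell ?c s) = V s z" if "s \<in> words j" for s
    using measure_path[OF tree[OF z], of s] that by (auto simp: L.cell_def words_def)
  moreover have "graphon_kernel (limit_graphon V) f z = (\<integral>u. f (?pt z u) \<partial>unit_interval)"
    unfolding graphon_kernel_def limit_graphon_def
    by (rule integral_distr[OF m1[OF z] bcontfun_borel_measurable])
  ultimately show "\<bar>graphon_kernel (limit_graphon V) f z - (\<Sum>s\<in>words j. f (representative s) * V s z)\<bar> \<le> \<epsilon>"
    by (simp cong: sum.cong)
qed

lemma subsequence_limit_graphon_exists: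
  fixes Ws :: "nat \<Rightarrow> real \<times> real \<Rightarrow> 'k measure"
  assumes W: "\<And>n. K_graphon (Ws n)"
  shows "\<exists>r W. strict_mono (r :: nat \<Rightarrow> nat) \<and> K_graphon W \<and>
    (\<forall>k F. (\<lambda>n. hom_density k F (Ws (r n))) \<longlonglongrightarrow> hom_density k F W)"
proof -
  let ?L2 = "unit_interval \<Otimes>\<^sub>M unit_interval"
  define U where "U n w z = measure (Ws n z) (Kcell w)" for n w z
  have Wz: "prob_space (Ws n z)" "sets (Ws n z) = sets borel" if "z \<in> space ?L2" for n z
    using K_graphonD(2)[OF W that] by auto
  have Utree: "tree_mass (\<lambda>w. U n w z)" if "z \<in> space ?L2" for n z
    unfolding U_def by (intro Kcell_measure_tree Wz that)
  have Um: "U n w \<in> borel_measurable ?L2" for n w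
    unfolding U_def[abs_def]
    by (rule measurable_compose[OF measurable_prob_algebraD[OF K_graphonD(1)[OF W]]])
      (intro measurable_measure_subprob_algebra Kcell_measurable)
  have Uunit: "unit_kernel unit_interval (U n w)" for n w
    unfolding unit_kernel_def using Um Wz(1) by (auto simp: U_def prob_space.prob_le_1)
  have Usym: "L.symmetric_kernel (U n w)" for n w
    using W[of n] by (auto simp: L.symmetric_kernel_def U_def K_graphon_def)
  interpret U: tree_kernels unit_interval U
    by unfold_locales (use Uunit Usym Utree in auto)
  \<comment> \<open>The default tree is that of a point mass, which vanishes on empty cells as the
    zero clause demands.\<close>
  define d where "d w = measure (return borel (undefined :: 'k)) (Kcell w)" for w
  have d: "tree_mass d" unfolding d_def by (intro Kcell_measure_tree prob_space_return) auto
  obtain r V where r: "strict_mono (r :: nat \<Rightarrow> nat)" and V: "\<And>w. unit_kernel unit_interval (V w)"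
    "\<And>w. L.symmetric_kernel (V w)" "\<And>z. z \<in> space ?L2 \<Longrightarrow> tree_mass (\<lambda>w. V w z)"
    and Vzero: "\<And>w z. d w = 0 \<Longrightarrow> (\<forall>n. \<forall>z\<in>space ?L2. U n w z = 0) \<Longrightarrow> V w z = 0"
    and lim: "\<And>k ws. (\<lambda>n. edge_density unit_interval k (\<lambda>e. U (r n) (ws e)))
      \<longlonglongrightarrow> edge_density unit_interval k (\<lambda>e. V (ws e))"
    using U.subsequence_limit_exists[OF d] by blast
  have Vm: "V w \<in> borel_measurable ?L2" for w using V(1)[of w] by (simp add: unit_kernel_def)
  have zero: "V w z = 0" if "Kcell w = {}" for w z
    using that by (intro Vzero) (auto simp: d_def U_def)
  let ?W = "limit_graphon V"
  have lg: "K_graphon ?W"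
    by (rule limit_graphon(1)) (fact Vm V(3) zero V(2))+
  \<comment> \<open>One sum type holds words and continuous functions as two kinds of decorations,
    so that convergence can be extended from the former to the latter within a single
    family.\<close>
  define \<kappa> where "\<kappa> n = case_sum (U (r n)) (graphon_kernel (Ws (r n)))" for n
  define \<kappa>' where "\<kappa>' = case_sum V (graphon_kernel ?W)"
  have "(\<lambda>n. hom_density k F (Ws (r n))) \<longlonglongrightarrow> hom_density k F ?W" for k F
  proof -
    have "(\<lambda>n. edge_density unit_interval k (\<lambda>e. \<kappa> n (Inr (F (fst e) (snd e)))))
      \<longlonglongrightarrow> edge_density unit_interval k (\<lambda>e. \<kappa>' (Inr (F (fst e) (snd e))))"
    proof (rule L.density_tendsto_extend[where X = "range Inl" and Y = "range Inr" and b = "case_sum (\<lambda>_. 1) norm"])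
      show "\<kappa> n f \<in> borel_measurable ?L2" "\<kappa>' f \<in> borel_measurable ?L2" for n f
        using Um Vm graphon_kernel_measurable[OF W] graphon_kernel_measurable[OF lg]
        by (auto simp: \<kappa>_def \<kappa>'_def split: sum.split)
      show "\<bar>\<kappa> n f z\<bar> \<le> case_sum (\<lambda>_. 1) norm f" "\<bar>\<kappa>' f z\<bar> \<le> case_sum (\<lambda>_. 1) norm f"
        if "z \<in> space ?L2" for n f z
        using that Uunit V(1) abs_graphon_kernel_le[OF W that] abs_graphon_kernel_le[OF lg that]
        by (auto simp: \<kappa>_def \<kappa>'_def unit_kernel_def split: sum.split)
      show "(\<lambda>n. edge_density unit_interval k (\<lambda>e. \<kappa> n (G e))) \<longlonglongrightarrow> edge_density unit_interval k (\<lambda>e. \<kappa>' (G e))"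
        if "\<And>e. e \<in> edges k \<Longrightarrow> G e \<in> range Inl" for G
      proof -
        have G: "G e = Inl (projl (G e))" if "e \<in> edges k" for e using \<open>\<And>e. e \<in> edges k \<Longrightarrow> G e \<in> range Inl\<close>[OF that] by auto
        have "edge_density unit_interval k (\<lambda>e. \<kappa> n (G e)) = edge_density unit_interval k (\<lambda>e. U (r n) (projl (G e)))" for n
          by (rule edge_density_cong) (subst G, auto simp: \<kappa>_def)
        moreover have "edge_density unit_interval k (\<lambda>e. \<kappa>' (G e)) = edge_density unit_interval k (\<lambda>e. V (projl (G e)))"
          by (rule edge_density_cong) (subst G, auto simp: \<kappa>'_def)
        ultimately show ?thesis using lim[of k "\<lambda>e. projl (G e)"] by simp
      qed
      fix f :: "bool list + ('k \<Rightarrow>\<^sub>C real)" and \<epsilon> :: real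
      assume "f \<in> range Inr" and \<epsilon>: "0 < \<epsilon>"
      then obtain g where g: "f = Inr g" by blast
      obtain j where j: "\<And>s x y. s \<in> words j \<Longrightarrow> x \<in> closure (Kcell s) \<Longrightarrow> y \<in> closure (Kcell s) \<Longrightarrow> \<bar>g x - g y\<bar> \<le> \<epsilon>"
        using small_oscillation[OF continuous_on_apply_bcontfun \<epsilon>, of g] by blast
      show "\<exists>S a. finite S \<and> S \<subseteq> range Inl \<and> (\<forall>z\<in>space ?L2.
        (\<forall>n. \<bar>\<kappa> n f z - (\<Sum>x\<in>S. a x * \<kappa> n x z)\<bar> \<le> \<epsilon>) \<and> \<bar>\<kappa>' f z - (\<Sum>x\<in>S. a x * \<kappa>' x z)\<bar> \<le> \<epsilon>)"
      proof (intro exI conjI ballI allI)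
        \<comment> \<open>The coefficients depend on \<open>g\<close> alone, so the same ones serve
          every graphon of the sequence and the limit.\<close>
        let ?S = "Inl ` words j" and ?a = "\<lambda>x. g (representative (projl x))"
        show "finite ?S" "?S \<subseteq> range Inl" by auto
        fix z assume z: "z \<in> space ?L2"
        show "\<bar>\<kappa> n f z - (\<Sum>x\<in>?S. ?a x * \<kappa> n x z)\<bar> \<le> \<epsilon>" for n
          using integral_cell_approx[OF Wz[OF z, of "r n"] j]
          by (simp add: g \<kappa>_def graphon_kernel_def U_def sum.reindex)
        show "\<bar>\<kappa>' f z - (\<Sum>x\<in>?S. ?a x * \<kappa>' x z)\<bar> \<le> \<epsilon>"
        proof -
          have "\<bar>graphon_kernel ?W g z - (\<Sum>s\<in>words j. g (representative s) * V s z)\<bar> \<le> \<epsilon>"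
            by (rule limit_graphon(2)) (fact Vm V(3) zero V(2) z j)+
          then show ?thesis by (simp add: g \<kappa>'_def sum.reindex)
        qed
      qed
    qed auto
    then show ?thesis by (simp add: hom_density_eq_edge_density \<kappa>_def \<kappa>'_def)
  qed
  then show ?thesis using r lg by blast
qed

end

theorem theorem3:
  fixes Fs :: "('k::{t2_space, second_countable_topology} \<Rightarrow>\<^sub>C real) set"
    and Ws :: "nat \<Rightarrow> (real \<times> real \<Rightarrow> 'k measure)"
  assumes "compact (UNIV :: 'k set)"
    and "countable Fs"
    and "generating_set Fs"
    and "\<And>n. K_graphon (Ws n)"
    and "\<And>k F. decorated_graph Fs k F \<Longrightarrow> convergent (\<lambda>n. hom_density k F (Ws n))"
  shows "\<exists>W. K_graphon W \<and>
    (\<forall>k F. decorated_graph UNIV k F \<longrightarrow> (\<lambda>n. hom_density k F (Ws n)) \<longlonglongrightarrow> hom_density k F W)"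
proof -
  obtain B :: "nat \<Rightarrow> 'k set" where "coded_space B" using coded_space_exists[OF assms(1)] by blast
  then interpret coded_space B .
  obtain r W where r: "strict_mono (r :: nat \<Rightarrow> nat)" and W: "K_graphon W"
    and sub: "\<And>k F. (\<lambda>n. hom_density k F (Ws (r n))) \<longlonglongrightarrow> hom_density k F W"
    using subsequence_limit_graphon_exists[of Ws] assms(4) by blast
  let ?L2 = "unit_interval \<Otimes>\<^sub>M unit_interval"
  have "(\<lambda>n. hom_density k F (Ws n)) \<longlonglongrightarrow> hom_density k F W" for k F
    unfolding hom_density_eq_edge_density
  proof (rule L.density_tendsto_extend[where X = Fs and Y = UNIV and b = norm])
    show "graphon_kernel (Ws n) f \<in> borel_measurable ?L2" "graphon_kernel W f \<in> borel_measurable ?L2" for n f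
      by (intro graphon_kernel_measurable assms(4) W)+
    show "\<bar>graphon_kernel (Ws n) f z\<bar> \<le> norm f" "\<bar>graphon_kernel W f z\<bar> \<le> norm f" if "z \<in> space ?L2" for n f z
      by (intro abs_graphon_kernel_le assms(4) W that)+
    show "(\<lambda>n. edge_density unit_interval k (\<lambda>e. graphon_kernel (Ws n) (G e)))
      \<longlonglongrightarrow> edge_density unit_interval k (\<lambda>e. graphon_kernel W (G e))"
      if G: "\<And>e. e \<in> edges k \<Longrightarrow> G e \<in> Fs" for G
    \<comment> \<open>Without edges there is no element of \<open>Fs\<close> at hand to fill in a
      decorated graph, but then both densities are the integral of the empty product.\<close>
    proof (cases "edges k = {}")
      case True
      then show ?thesis by (simp add: edge_density_def edge_prod_def)
    next
      case False
      then obtain e0 where e0: "e0 \<in> edges k" by blast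
      \<comment> \<open>A decorated graph must be symmetric with diagonal entries in
        \<open>Fs\<close>, although the density only sees pairs \<open>i < j\<close>; the diagonal
        is filled with the decoration of \<open>e0\<close>.\<close>
      define G' where "G' i j = (if i < j then G (i, j) else if j < i then G (j, i) else G e0)" for i j
      have "decorated_graph Fs k G'"
        unfolding decorated_graph_def G'_def using G e0 by (auto simp: edges_def)
      then obtain l where l: "(\<lambda>n. hom_density k G' (Ws n)) \<longlonglongrightarrow> l"
        using assms(5) convergent_def by blast
      \<comment> \<open>For decorations from \<open>Fs\<close> the whole sequence converges by
        assumption, and the subsequence identifies its limit.\<close>
      then have "l = hom_density k G' W"
        using LIMSEQ_unique[OF LIMSEQ_subseq_LIMSEQ[OF l r, unfolded o_def] sub] by simp
      moreover have "hom_density k G' X = edge_density unit_interval k (\<lambda>e. graphon_kernel X (G e))" for X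
        unfolding hom_density_eq_edge_density
        by (rule edge_density_cong) (auto simp: G'_def edges_def)
      ultimately show ?thesis using l by simp
    qed
    fix f :: "'k \<Rightarrow>\<^sub>C real" and \<epsilon> :: real assume \<epsilon>: "0 < \<epsilon>"
    have "f \<in> closure (span Fs)" using assms(3) by (simp add: generating_set_def)
    then obtain g where g: "g \<in> span Fs" "dist g f < \<epsilon>" using \<epsilon> closure_approachable by blast
    then obtain S a where S: "finite S" "S \<subseteq> Fs" "g = (\<Sum>h\<in>S. a h *\<^sub>R h)"
      unfolding span_explicit by blast
    then have "norm (f - (\<Sum>h\<in>S. a h *\<^sub>R h)) \<le> \<epsilon>" using g(2) by (simp add: dist_norm norm_minus_commute)
    then show "\<exists>S a. finite S \<and> S \<subseteq> Fs \<and> (\<forall>z\<in>space ?L2.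
      (\<forall>n. \<bar>graphon_kernel (Ws n) f z - (\<Sum>x\<in>S. a x * graphon_kernel (Ws n) x z)\<bar> \<le> \<epsilon>)
      \<and> \<bar>graphon_kernel W f z - (\<Sum>x\<in>S. a x * graphon_kernel W x z)\<bar> \<le> \<epsilon>)"
      using S graphon_kernel_span assms(4) W by (intro exI[of _ S] exI[of _ a]) blast
  qed simp
  then show ?thesis using W by blast
qed

end
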